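(* Let $\{\mu_t:t\geq0\}$ be a $\triangleright$-convolution semigroup of Borel probability measures on $\mathbb{R}$. (1) If there is a time parameter $t_0>0$ such that $\mu_{t_0}\in\mathcal{D}_{\triangleright}[\gamma]$, then one can find a positive function $B(t)\in R_{1/2}$ such that $D_{1/B(t)}\mu_t\Rightarrow\gamma$ as $t\to\infty$. In particular, $\mu_t\in\mathcal{D}_{\triangleright}[\gamma]$ for every $t>0$. (2) If the mean $a=m(\mu_{t_0})$ exists for some $t_0>0$, then $D_{1/t}\mu_t\Rightarrow\delta_{a/t_0}$ as $t\to\infty$.
   Context: Let $\mathbb{C}^{+}=\{z\in\mathbb{C}:\Im z>0\}$ and let $\mathcal{M}$ be the set of all Borel probability measures on $\mathbb{R}$. For $\mu\in\mathcal{M}$ let $G_\mu(z)=\int_{-\infty}^{\infty}\frac{1}{z-t}\,d\mu(t)$ and $F_\mu=1/G_\mu$ on $\mathbb{C}^{+}$; $F_\mu$ determines $\mu$. The monotone convolution $\mu\triangleright\nu\in\mathcal{M}$ is the measure determined by $F_{\mu\triangleright\nu}(z)=F_\mu(F_\nu(z))$, $z\in\mathbb{C}^{+}$; it is associative, and $\mu^{\triangleright n}$ is the $n$-fold monotone convolution power. $\delta_c$ is the Dirac mass at $c$. For $b>0$, $D_b\mu(A)=\mu(b^{-1}A)$ for Borel sets $A$. The symbol $\Rightarrow$ denotes weak convergence of probability measures. A $\triangleright$-convolution semigroup is a family $\{\mu_t:t\ge0\}\subset\mathcal{M}$ such that $\mu_0=\delta_0$, $\mu_t$ is nondegenerate (not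 a point mass) for every $t>0$, $\mu_s\triangleright\mu_t=\mu_{s+t}$ for all $s,t\ge0$, and $t\mapsto\mu_t$ is weakly continuous. The standard arc-sine law $\gamma$ has density $\pi^{-1}(2-x^2)^{-1/2}$ on $(-\sqrt2,\sqrt2)$. The strict domain of attraction $\mathcal{D}_{\triangleright}[\gamma]$ is the set of all $\mu\in\mathcal{M}$ for which there exists a sequence $B_n>0$ with $D_{1/B_n}\mu^{\triangleright n}\Rightarrow\gamma$ as $n\to\infty$. $R_d$ denotes the class of regularly varying functions of index $d$: positive Borel functions $f$ on $(0,\infty)$ with $\lim_{x\to\infty}f(cx)/f(x)=c^d$ for every constant $c>0$. The mean is $m(\mu)=\int t\,d\mu(t)$, and it exists when this integral converges absolutely. *)

theory Defs
  imports "HOL-Probability.Probability"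
begin

definition cauchy_transform :: "real measure \<Rightarrow> complex \<Rightarrow> complex" where
  "cauchy_transform \<mu> z = (LINT t|\<mu>. 1 / (z - complex_of_real t))"

definition F_transform :: "real measure \<Rightarrow> complex \<Rightarrow> complex" where
  "F_transform \<mu> z = 1 / cauchy_transform \<mu> z"

(* The definite description is meaningful for all Borel probability measures mu and nu: the
   composition of F-transforms is again the F-transform of a probability measure, which it
   determines. *)
definition mono_conv :: "real measure \<Rightarrow> real measure \<Rightarrow> real measure" where
  "mono_conv \<mu> \<nu> = (THE \<rho>. real_distribution \<rho> \<and>
     (\<forall>z. Im z > 0 \<longrightarrow> F_transform \<rho> z = F_transform \<mu> (F_transform \<nu> z)))"

(* The point mass at 0 is the unit of monotone convolution, since its F-transform is the identity. *)
definition mono_conv_power :: "nat \<Rightarrow> real measure \<Rightarrow> real measure" where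
  "mono_conv_power n \<mu> = (mono_conv \<mu> ^^ n) (return borel 0)"

definition dilation :: "real \<Rightarrow> real measure \<Rightarrow> real measure" where
  "dilation b \<mu> = distr \<mu> borel (\<lambda>x. b * x)"

(* The library's weak_conv_m covers sequences only; an arbitrary filter is needed for a real
   parameter. The two notions agree on sequences, see weak_conv_along_sequentially below. *)
definition weak_conv_along ::
    "('i \<Rightarrow> real measure) \<Rightarrow> real measure \<Rightarrow> 'i filter \<Rightarrow> bool" where
  "weak_conv_along M N \<F> \<longleftrightarrow>
     (\<forall>f :: real \<Rightarrow> real. continuous_on UNIV f \<and> bounded (range f) \<longrightarrow>
        ((\<lambda>i. LINT x|M i. f x) \<longlongrightarrow> (LINT x|N. f x)) \<F>)"

lemma weak_conv_along_sequentially: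
  assumes "\<And>n. real_distribution (M n)" "real_distribution N"
  shows "weak_conv_along M N sequentially \<longleftrightarrow> weak_conv_m M N"
proof
  assume *: "weak_conv_along M N sequentially"
  show "weak_conv_m M N"
  proof (rule integral_bdd_continuous_conv_imp_weak_conv[OF assms])
    fix f :: "real \<Rightarrow> real"
    assume "\<And>x. isCont f x" "\<And>x. \<bar>f x\<bar> \<le> 1"
    then have "continuous_on UNIV f" "bounded (range f)"
      by (auto simp: continuous_on_eq_continuous_at intro!: boundedI)
    with * show "(\<lambda>n. LINT x|M n. f x) \<longlonglongrightarrow> (LINT x|N. f x)"
      by (auto simp: weak_conv_along_def)
  qed
next
  assume *: "weak_conv_m M N"
  show "weak_conv_along M N sequentially"
    unfolding weak_conv_along_def
  proof (intro allI impI, elim conjE)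
    fix f :: "real \<Rightarrow> real"
    assume f: "continuous_on UNIV f" "bounded (range f)"
    then obtain C where "\<And>x. norm (f x) \<le> C"
      by (auto simp: bounded_iff)
    then show "(\<lambda>n. LINT x|M n. f x) \<longlonglongrightarrow> (LINT x|N. f x)"
      using f(1) by (intro weak_conv_imp_integral_bdd_continuous_conv[OF assms *])
        (auto simp: continuous_on_eq_continuous_at)
  qed
qed

definition mono_conv_semigroup :: "(real \<Rightarrow> real measure) \<Rightarrow> bool" where
  "mono_conv_semigroup \<mu> \<longleftrightarrow>
     (\<forall>t\<ge>0. real_distribution (\<mu> t)) \<and>
     \<mu> 0 = return borel 0 \<and>
     (\<forall>t>0. \<nexists>c. \<mu> t = return borel c) \<and>
     (\<forall>s\<ge>0. \<forall>t\<ge>0. mono_conv (\<mu> s) (\<mu> t) = \<mu> (s + t)) \<and>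
     (\<forall>t\<ge>0. weak_conv_along \<mu> (\<mu> t) (at t within {0..}))"

definition arcsine_law :: "real measure" where
  "arcsine_law = density lborel
     (\<lambda>x. ennreal (if \<bar>x\<bar> < sqrt 2 then 1 / (pi * sqrt (2 - x\<^sup>2)) else 0))"

definition strict_domain_of_attraction :: "real measure \<Rightarrow> real measure set" where
  "strict_domain_of_attraction \<nu> = {\<mu>. real_distribution \<mu> \<and>
     (\<exists>B :: nat \<Rightarrow> real. (\<forall>n. B n > 0) \<and>
        weak_conv_along (\<lambda>n. dilation (1 / B n) (mono_conv_power n \<mu>)) \<nu> sequentially)}"

(* Only the values on the positive half-line matter; the others are irrelevant. *)
definition regularly_varying :: "real \<Rightarrow> (real \<Rightarrow> real) set" where
  "regularly_varying d = {f. f \<in> borel_measurable (restrict_space borel {0<..}) \<and>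
     (\<forall>x>0. f x > 0) \<and>
     (\<forall>c>0. ((\<lambda>x. f (c * x) / f x) \<longlongrightarrow> c powr d) at_top)}"

definition mean :: "real measure \<Rightarrow> real" where
  "mean \<mu> = (LINT t|\<mu>. t)"

definition mean_exists :: "real measure \<Rightarrow> bool" where
  "mean_exists \<mu> \<longleftrightarrow> integrable \<mu> (\<lambda>t. t)"

end

theory Submission
  imports Defs "HOL-Complex_Analysis.Complex_Analysis"
begin

text \<open>Write \<open>F\<^sub>t\<close> for the \<open>F\<close>-transform of \<open>\<mu>\<^sub>t\<close>, so that \<open>F\<^sub>s\<^sub>+\<^sub>t = F\<^sub>s \<circ> F\<^sub>t\<close>; this needs that a composition of
  \<open>F\<close>-transforms is again an \<open>F\<close>-transform, which follows from the Poisson formula on half planes and Helly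
  selection. Every \<open>F\<^sub>t\<close> contracts the hyperbolic metric of the upper half plane and increases imaginary
  parts, hence \<open>Im F\<^sub>t(iy) / y\<close> is decreasing in \<open>y\<close> and increasing in \<open>t\<close>.

  (1) For the arc-sine law \<open>F(iy) = i \<surd>(y\<^sup>2 + 2)\<close>, whose \<open>k\<close>-th iterate is \<open>i \<surd>(y\<^sup>2 + 2k)\<close>. Comparing
  \<open>Im F\<^sub>t(iy) / y\<close> at different scales gives \<open>B\<^sub>k\<^sub>n / B\<^sub>n \<rightarrow> \<surd>k\<close> for the given norming sequence and also shows
  that \<open>B\<close> is almost increasing; both together make \<open>t \<mapsto> B\<^bsub>floor(t / t\<^sub>0)\<^esub>\<close> regularly varying of index
  \<open>1/2\<close>. The remainder \<open>F\<^sub>r\<close> with \<open>0 \<le> r \<le> t\<^sub>0\<close> is negligible at large scales since \<open>{\<mu>\<^sub>r : 0 \<le> r \<le> t\<^sub>0}\<close> is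
  weakly compact, hence uniformly tight.

  (2) A finite mean \<open>a\<close> gives \<open>F(z) = z - a + o(1)\<close> in Stolz angles, for \<open>F\<close> the transform at time \<open>t\<^sub>0\<close>;
  iterate this \<open>floor(t / t\<^sub>0)\<close> times from the starting point \<open>t z\<close>.\<close>

section \<open>The hyperbolic contraction property\<close>

text \<open>Weak convergence controls the transforms only at fixed points, whereas iteration
  evaluates them at points that move with \<open>n\<close>. The hyperbolic contraction is uniform
  over all probability measures, so convergence at one point carries over to every family of
  arguments tending to it.

  The imaginary axis is singled out because the arc-sine transform maps it into itself. There, at
  time \<open>k * n\<close> and height \<open>B n * y\<close>, the quotient Im F / height tends to
  sqrt (1 + 2k / y^2), strictly decreasing in \<open>y\<close> and strictly increasing in
  \<open>k\<close>. The value sqrt 3 at k = y = 1 marks the scale \<open>B n\<close> itself, so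
  comparing a limit with sqrt 3 locates an unknown norming constant from both sides. Ratios at
  integer multiples say nothing about indices in between; almost monotonicity of \<open>B\<close>
  fills these gaps.

  Convolution is a definite description and carries no information until a measure with the composed
  transform has been constructed and shown unique.\<close>

definition cauchy_energy :: "real measure \<Rightarrow> complex \<Rightarrow> real" where
  "cauchy_energy M z = (LINT t|M. 1 / (cmod (z - of_real t))\<^sup>2)"

text \<open>This is 4 sinh^2 (d / 2) for the hyperbolic distance d. The algebraic form avoids
  inverse hyperbolic functions and is visibly invariant under positive scaling.\<close>

definition hyp_disp :: "complex \<Rightarrow> complex \<Rightarrow> real" where
  "hyp_disp z w = (cmod (z - w))\<^sup>2 / (Im z * Im w)"

section \<open>Elementary estimates for the Cauchy kernel and transform\<close>

lemma Im_le_cmod_diff_of_real: "Im z \<le> cmod (z - of_real t)"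
  using abs_Im_le_cmod[of "z - of_real t"] by simp

lemma diff_of_real_nonzero: "Im z \<noteq> 0 \<Longrightarrow> z - of_real t \<noteq> 0"
  by (auto simp: complex_eq_iff)

lemma norm_cauchy_kernel_le: "Im z > 0 \<Longrightarrow> norm (1 / (z - of_real t)) \<le> 1 / Im z"
  using Im_le_cmod_diff_of_real[of z t] by (simp add: norm_divide frac_le)

lemma Im_cauchy_kernel: "Im (1 / (z - of_real t)) = - Im z / (cmod (z - of_real t))\<^sup>2"
  by (simp add: Im_divide cmod_power2)

context real_distribution
begin

lemma integrable_bounded:
  fixes f :: "real \<Rightarrow> 'a::{banach, second_countable_topology}"
  assumes "f \<in> borel_measurable borel" "\<And>t. norm (f t) \<le> C"
  shows "integrable M f"
  using assms by (intro integrable_const_bound[of _ C]) auto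

lemma integrable_cauchy_kernel:
  "Im z > 0 \<Longrightarrow> integrable M (\<lambda>t. 1 / (z - of_real t))"
  by (rule integrable_bounded[of _ "1 / Im z"]) (auto intro: norm_cauchy_kernel_le)

lemma integrable_cauchy_kernel_square:
  assumes "Im z > 0"
  shows "integrable M (\<lambda>t. 1 / (cmod (z - of_real t))\<^sup>2)"
proof (rule integrable_bounded[of _ "(1 / Im z)\<^sup>2"])
  show "norm (1 / (cmod (z - of_real t))\<^sup>2) \<le> (1 / Im z)\<^sup>2" for t
    using power_mono[OF norm_cauchy_kernel_le[OF assms, of t], of 2]
    by (simp add: norm_divide power_divide norm_power)
qed simp

lemma integral_pos:
  fixes f :: "real \<Rightarrow> real"
  assumes "integrable M f" "\<And>t. f t > 0"
  shows "(LINT t|M. f t) > 0"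
proof -
  have "(LINT t|M. f t) \<noteq> 0"
  proof
    assume "(LINT t|M. f t) = 0"
    then have "AE t in M. f t = 0"
      using assms integral_nonneg_eq_0_iff_AE[of M f] by (auto simp: less_imp_le)
    moreover have "f t \<noteq> 0" for t
      using assms(2)[of t] by simp
    ultimately show False by simp
  qed
  moreover have "(LINT t|M. f t) \<ge> 0"
    using assms(2) by (intro integral_nonneg_AE) (simp add: less_imp_le)
  ultimately show ?thesis by simp
qed

lemma cauchy_energy_pos: "Im z > 0 \<Longrightarrow> cauchy_energy M z > 0"
  unfolding cauchy_energy_def
  by (rule integral_pos[OF integrable_cauchy_kernel_square])
    (auto simp: diff_of_real_nonzero)

lemma Im_cauchy_transform:
  assumes "Im z > 0"
  shows "Im (cauchy_transform M z) = - Im z * cauchy_energy M z"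
proof -
  have "Im (cauchy_transform M z) = (LINT t|M. Im (1 / (z - of_real t)))"
    unfolding cauchy_transform_def by (rule integral_Im[symmetric]) (rule integrable_cauchy_kernel[OF assms])
  also have "\<dots> = (LINT t|M. - Im z * (1 / (cmod (z - of_real t))\<^sup>2))"
    by (intro Bochner_Integration.integral_cong refl) (simp only: Im_cauchy_kernel, simp)
  also have "\<dots> = - Im z * cauchy_energy M z"
    unfolding cauchy_energy_def by (rule integral_mult_right_zero)
  finally show ?thesis .
qed

lemma Im_cauchy_transform_neg: "Im z > 0 \<Longrightarrow> Im (cauchy_transform M z) < 0"
  by (simp add: Im_cauchy_transform cauchy_energy_pos)

lemma cauchy_transform_nonzero: "Im z > 0 \<Longrightarrow> cauchy_transform M z \<noteq> 0"
  using Im_cauchy_transform_neg[of z] by auto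

lemma norm_cauchy_transform_le:
  assumes "Im z > 0"
  shows "norm (cauchy_transform M z) \<le> 1 / Im z"
proof -
  have "norm (cauchy_transform M z) \<le> (LINT t|M. norm (1 / (z - of_real t)))"
    unfolding cauchy_transform_def by (rule integral_norm_bound)
  also have "\<dots> \<le> (LINT t|M. 1 / Im z)"
    using assms by (intro integral_mono integrable_norm integrable_cauchy_kernel norm_cauchy_kernel_le) auto
  finally show ?thesis using prob_space by simp
qed

lemma cauchy_kernel_Cauchy_Schwarz:
  assumes z: "Im z > 0" and w: "Im w > 0"
  shows "(LINT t|M. 1 / (cmod (z - of_real t) * cmod (w - of_real t)))\<^sup>2
    \<le> cauchy_energy M z * cauchy_energy M w" (is "?I\<^sup>2 \<le> ?a * ?b")
proof -
  \<comment> \<open>Cauchy-Schwarz is obtained from 2uv <= s u^2 + v^2 / s; this weight makes the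
    two integrated terms equal, which is the optimal choice.\<close>
  define s where "s = sqrt (?b / ?a)"
  have pos: "?a > 0" "?b > 0"
    using assms cauchy_energy_pos by auto
  then have s: "s > 0" by (simp add: s_def)
  note int = integrable_cauchy_kernel_square[OF z] integrable_cauchy_kernel_square[OF w]
  have "?I \<le> (LINT t|M. (s * (1 / (cmod (z - of_real t))\<^sup>2) + (1 / s) * (1 / (cmod (w - of_real t))\<^sup>2)) / 2)"
  proof (rule integral_mono)
    have "norm (1 / (cmod (z - of_real t) * cmod (w - of_real t))) \<le> 1 / Im z * (1 / Im w)" for t
      using mult_mono[OF norm_cauchy_kernel_le[OF z, of t] norm_cauchy_kernel_le[OF w, of t]] z
      by (simp add: norm_divide)
    then show "integrable M (\<lambda>t. 1 / (cmod (z - of_real t) * cmod (w - of_real t)))"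
      by (intro integrable_bounded[of _ "1 / Im z * (1 / Im w)"]) auto
    show "integrable M (\<lambda>t. (s * (1 / (cmod (z - of_real t))\<^sup>2) + (1 / s) * (1 / (cmod (w - of_real t))\<^sup>2)) / 2)"
      by (intro integrable_divide Bochner_Integration.integrable_add integrable_mult_right int)
    fix t
    define u v where "u = 1 / cmod (z - of_real t)" and "v = 1 / cmod (w - of_real t)"
    have "0 \<le> (s * u - v)\<^sup>2 / s"
      using s by simp
    also have "\<dots> = s * u\<^sup>2 + 1 / s * v\<^sup>2 - 2 * (u * v)"
      using s by (simp add: power2_eq_square field_simps)
    finally show "1 / (cmod (z - of_real t) * cmod (w - of_real t))
      \<le> (s * (1 / (cmod (z - of_real t))\<^sup>2) + (1 / s) * (1 / (cmod (w - of_real t))\<^sup>2)) / 2"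
      by (simp add: u_def v_def power_divide)
  qed
  also have "\<dots> = (s * ?a + 1 / s * ?b) / 2"
    unfolding cauchy_energy_def
    by (subst Bochner_Integration.integral_divide_zero, subst Bochner_Integration.integral_add)
      (intro integrable_mult_right int, intro integrable_mult_right int,
        simp only: Bochner_Integration.integral_mult_right_zero)
  also have "\<dots> = sqrt (?a * ?b)"
  proof -
    have a: "sqrt ?a * sqrt ?a = ?a" and b: "sqrt ?b * sqrt ?b = ?b"
      using pos by auto
    have "s * ?a = sqrt ?b * sqrt ?a"
      using pos a by (simp add: s_def real_sqrt_divide field_simps)
    moreover have "1 / s * ?b = sqrt ?b * sqrt ?a"
      using pos b by (simp add: s_def real_sqrt_divide field_simps)
    ultimately show ?thesis by (simp add: real_sqrt_mult)
  qed
  finally have "?I \<le> sqrt (?a * ?b)" .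
  moreover have "?I \<ge> 0" by (intro integral_nonneg_AE) auto
  ultimately have "?I\<^sup>2 \<le> (sqrt (?a * ?b))\<^sup>2" by (rule power_mono)
  with pos show ?thesis by simp
qed

lemma norm_integral_kernel_product_le:
  assumes z: "Im z > 0" and w: "Im w > 0"
  assumes f: "\<And>t. cmod (f t) = 1 / (cmod (z - of_real t) * cmod (w - of_real t))"
  shows "(cmod (LINT t|M. f t))\<^sup>2 \<le> cauchy_energy M z * cauchy_energy M w"
proof -
  have "cmod (LINT t|M. f t) \<le> (LINT t|M. 1 / (cmod (z - of_real t) * cmod (w - of_real t)))"
    unfolding f[symmetric] by (rule integral_norm_bound)
  then have "(cmod (LINT t|M. f t))\<^sup>2 \<le> (LINT t|M. 1 / (cmod (z - of_real t) * cmod (w - of_real t)))\<^sup>2"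
    by (intro power_mono) auto
  with cauchy_kernel_Cauchy_Schwarz[OF z w] show ?thesis by linarith
qed

text \<open>Jensen's inequality for the square. Since Im F is Im z times the quotient of the two
  sides, this is exactly the statement that F raises imaginary parts.\<close>

lemma norm_cauchy_transform_square_le:
  assumes z: "Im z > 0"
  shows "(cmod (cauchy_transform M z))\<^sup>2 \<le> cauchy_energy M z"
proof -
  have "cmod (cauchy_transform M z) \<le> (LINT t|M. norm (1 / (z - of_real t)))"
    unfolding cauchy_transform_def by (rule integral_norm_bound)
  then have "(cmod (cauchy_transform M z))\<^sup>2 \<le> (LINT t|M. norm (1 / (z - of_real t)))\<^sup>2"
    by (intro power_mono) auto
  also have "\<dots> \<le> (LINT t|M. (norm (1 / (z - of_real t)))\<^sup>2)"
    using integrable_cauchy_kernel_square[OF z] integrable_norm[OF integrable_cauchy_kernel[OF z]]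
    by (intro jensens_inequality[where I=UNIV and q="\<lambda>x. x\<^sup>2"])
      (auto simp: convex_power2 norm_divide power_divide)
  finally show ?thesis by (simp add: cauchy_energy_def norm_divide power_divide)
qed

lemma Im_F_transform:
  assumes z: "Im z > 0"
  shows "Im (F_transform M z) = Im z * cauchy_energy M z / (cmod (cauchy_transform M z))\<^sup>2"
  using assms by (simp add: F_transform_def Im_divide cmod_power2 Im_cauchy_transform)

lemma Im_F_transform_ge:
  assumes z: "Im z > 0"
  shows "Im (F_transform M z) \<ge> Im z"
proof -
  have "(cmod (cauchy_transform M z))\<^sup>2 > 0"
    using cauchy_transform_nonzero[OF z] by simp
  with norm_cauchy_transform_square_le[OF z] z show ?thesis
    by (simp add: Im_F_transform field_simps)
qed

lemma Im_F_transform_pos: "Im z > 0 \<Longrightarrow> Im (F_transform M z) > 0"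
  using Im_F_transform_ge[of z] by linarith

text \<open>The resolvent identity writes the difference of the two Cauchy transforms as
  \<open>z - cnj w\<close> times an integral of a product of kernels, and Cauchy-Schwarz bounds that
  integral by the energies. In terms of F this is the nonnegativity of the 2 x 2 Pick
  determinant.\<close>

lemma F_transform_Pick:
  assumes z: "Im z > 0" and w: "Im w > 0"
  shows "(cmod (F_transform M z - cnj (F_transform M w)))\<^sup>2 * (Im z * Im w)
    \<le> (cmod (z - cnj w))\<^sup>2 * (Im (F_transform M z) * Im (F_transform M w))"
proof -
  let ?G = "cauchy_transform M"
  have nz: "?G z \<noteq> 0" "?G w \<noteq> 0"
    using assms cauchy_transform_nonzero by auto
  have cnj: "cnj (?G w) = (LINT t|M. 1 / (cnj w - of_real t))"
    unfolding cauchy_transform_def by (simp flip: Bochner_Integration.integral_cnj)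
  have intc: "integrable M (\<lambda>t. 1 / (cnj w - of_real t))"
    using integrable_cnj[OF integrable_cauchy_kernel[OF w]] by simp
  have eq: "1 / (cnj w - of_real t) - 1 / (z - of_real t)
    = (z - cnj w) * (1 / ((z - of_real t) * (cnj w - of_real t)))" for t
    using diff_of_real_nonzero[of z t] diff_of_real_nonzero[of "cnj w" t] z w by (simp add: field_simps)
  have "cnj (?G w) - ?G z = (LINT t|M. 1 / (cnj w - of_real t) - 1 / (z - of_real t))"
    unfolding cnj using intc integrable_cauchy_kernel[OF z] by (simp add: cauchy_transform_def)
  also have "\<dots> = (z - cnj w) * (LINT t|M. 1 / ((z - of_real t) * (cnj w - of_real t)))"
    unfolding eq by (rule integral_mult_right_zero)
  finally have "(cmod (cnj (?G w) - ?G z))\<^sup>2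
    = (cmod (z - cnj w))\<^sup>2 * (cmod (LINT t|M. 1 / ((z - of_real t) * (cnj w - of_real t))))\<^sup>2"
    by (simp add: norm_mult power_mult_distrib)
  also have "\<dots> \<le> (cmod (z - cnj w))\<^sup>2 * (cauchy_energy M z * cauchy_energy M w)"
  proof (intro mult_left_mono norm_integral_kernel_product_le z w)
    fix t
    have "cmod (cnj w - of_real t) = cmod (w - of_real t)"
      by (metis complex_cnj_complex_of_real complex_cnj_diff complex_mod_cnj)
    then show "cmod (1 / ((z - of_real t) * (cnj w - of_real t))) = 1 / (cmod (z - of_real t) * cmod (w - of_real t))"
      by (simp add: norm_divide norm_mult)
  qed simp
  finally have main: "(cmod (cnj (?G w) - ?G z))\<^sup>2 \<le> (cmod (z - cnj w))\<^sup>2 * (cauchy_energy M z * cauchy_energy M w)" .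
  have "F_transform M z - cnj (F_transform M w) = (cnj (?G w) - ?G z) / (?G z * cnj (?G w))"
    using nz by (simp add: F_transform_def field_simps)
  then have "(cmod (F_transform M z - cnj (F_transform M w)))\<^sup>2
    = (cmod (cnj (?G w) - ?G z))\<^sup>2 / ((cmod (?G z))\<^sup>2 * (cmod (?G w))\<^sup>2)"
    by (simp add: norm_divide norm_mult power_divide power_mult_distrib)
  also have "\<dots> * (Im z * Im w) \<le> (cmod (z - cnj w))\<^sup>2 * (cauchy_energy M z * cauchy_energy M w) / ((cmod (?G z))\<^sup>2 * (cmod (?G w))\<^sup>2) * (Im z * Im w)"
    using main z w by (intro mult_right_mono divide_right_mono) auto
  finally show ?thesis
    by (simp add: Im_F_transform z w field_simps)
qed

text \<open>The Schwarz--Pick inequality; \<^const>\<open>hyp_disp\<close> is a monotone function of the hyperbolic distance.\<close>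

lemma hyp_disp_F_transform_le:
  assumes z: "Im z > 0" and w: "Im w > 0"
  shows "hyp_disp (F_transform M z) (F_transform M w) \<le> hyp_disp z w"
proof -
  \<comment> \<open>Applied on both sides of the Pick inequality, this produces the same product of
    the four imaginary parts, which cancels and leaves the inequality for
    \<open>hyp_disp\<close>.\<close>
  have eq: "(cmod (a - cnj b))\<^sup>2 = (cmod (a - b))\<^sup>2 + 4 * (Im a * Im b)" for a b
    unfolding cmod_power2 by (simp add: power2_eq_square algebra_simps)
  have "(cmod (F_transform M z - F_transform M w))\<^sup>2 * (Im z * Im w)
    \<le> (cmod (z - w))\<^sup>2 * (Im (F_transform M z) * Im (F_transform M w))"
    using F_transform_Pick[OF assms] unfolding eq by (simp add: algebra_simps)
  with assms Im_F_transform_pos[OF z] Im_F_transform_pos[OF w] show ?thesis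
    by (simp add: hyp_disp_def field_simps)
qed

text \<open>Pick's inequality at two points of the imaginary axis, with the real parts of F
  discarded, becomes a quadratic inequality that factors as (v1 y2 - v2 y1) (v1 y1 - v2 y2) <= 0. If
  the first factor were negative, y1 <= y2 would make the second negative too.\<close>

lemma Im_F_transform_ratio_antimono:
  assumes y: "0 < y1" "y1 \<le> y2"
  shows "Im (F_transform M (\<i> * of_real y2)) / y2 \<le> Im (F_transform M (\<i> * of_real y1)) / y1"
proof -
  define v1 v2 where "v1 = Im (F_transform M (\<i> * of_real y1))" and "v2 = Im (F_transform M (\<i> * of_real y2))"
  have v: "v1 > 0" "v2 > 0"
    using y by (auto simp: v1_def v2_def intro!: Im_F_transform_pos)
  have "(v1 + v2)\<^sup>2 \<le> (cmod (F_transform M (\<i> * of_real y1) - cnj (F_transform M (\<i> * of_real y2))))\<^sup>2"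
    by (simp add: cmod_power2 v1_def v2_def)
  then have "(v1 + v2)\<^sup>2 * (y1 * y2) \<le> (cmod (F_transform M (\<i> * of_real y1) - cnj (F_transform M (\<i> * of_real y2))))\<^sup>2 * (y1 * y2)"
    using y by (intro mult_right_mono) auto
  also have "\<dots> \<le> (y1 + y2)\<^sup>2 * (v1 * v2)"
  proof -
    have "(cmod (\<i> * of_real y1 - cnj (\<i> * of_real y2)))\<^sup>2 = (y1 + y2)\<^sup>2"
      by (simp add: cmod_power2)
    with F_transform_Pick[of "\<i> * of_real y1" "\<i> * of_real y2"] y show ?thesis
      by (simp add: v1_def v2_def)
  qed
  finally have *: "(v1 * y2 - v2 * y1) * (v1 * y1 - v2 * y2) \<le> 0"
    by (simp add: power2_eq_square algebra_simps)
  have "v2 * y1 \<le> v1 * y2"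
  proof (rule ccontr)
    assume "\<not> ?thesis"
    then have l: "v1 * y2 < v2 * y1" by simp
    have "v1 * y1 \<le> v1 * y2" "v2 * y1 \<le> v2 * y2"
      using v y by auto
    with l have "v1 * y1 < v2 * y2" by linarith
    with l have "(v1 * y2 - v2 * y1) * (v1 * y1 - v2 * y2) > 0"
      by (intro mult_neg_neg) auto
    with * show False by simp
  qed
  then show ?thesis
    using y by (simp add: v1_def v2_def field_simps)
qed

end

text \<open>Near an interior point of the half plane a small hyperbolic displacement forces a small
  Euclidean one, although nothing is known in advance about the size of Im p.\<close>

lemma tendsto_of_hyp_disp:
  assumes h: "((\<lambda>i. hyp_disp (p i) (q i)) \<longlongrightarrow> 0) \<F>"
    and q: "(q \<longlongrightarrow> l) \<F>" "Im l > 0" and p: "eventually (\<lambda>i. Im (p i) > 0) \<F>"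
  shows "(p \<longlongrightarrow> l) \<F>"
proof -
  define h where "h i = hyp_disp (p i) (q i)" for i
  have Imq: "((\<lambda>i. Im (q i)) \<longlongrightarrow> Im l) \<F>"
    using q by (intro tendsto_intros)
  then have qpos: "eventually (\<lambda>i. Im (q i) > 0) \<F>"
    using q(2) by (auto dest: order_tendstoD)
  have "((\<lambda>i. h i * Im (q i) + Im (q i) * sqrt (h i)) \<longlongrightarrow> 0 * Im l + Im l * sqrt 0) \<F>"
    using h unfolding h_def by (intro tendsto_intros Imq)
  \<comment> \<open>With a = Im q and d = |p - q|, the bound Im p <= a + d gives d^2 <= h a (a + d).
    The right-hand side here dominates the positive root of that quadratic.\<close>
  moreover have "eventually (\<lambda>i. norm (p i - q i) \<le> h i * Im (q i) + Im (q i) * sqrt (h i)) \<F>"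
    using qpos p
  proof eventually_elim
    case (elim i)
    define a d where "a = Im (q i)" and "d = cmod (p i - q i)"
    have h0: "h i \<ge> 0" and a: "a > 0"
      using elim by (auto simp: h_def hyp_disp_def a_def)
    have "Im (p i) \<le> a + d"
      using abs_Im_le_cmod[of "p i - q i"] by (simp add: a_def d_def)
    moreover have "d\<^sup>2 = h i * a * Im (p i)"
      using elim by (simp add: h_def hyp_disp_def a_def d_def field_simps)
    ultimately have d: "d\<^sup>2 \<le> h i * a * (a + d)"
      using h0 a by (simp add: mult_left_mono)
    show ?case
    proof (rule ccontr)
      assume "\<not> ?case"
      then have gt: "d > h i * a + a * sqrt (h i)" by (simp add: a_def d_def)
      have "d \<ge> a * sqrt (h i)" "d \<ge> 0"
        using gt h0 a by (auto intro: order_trans[rotated, OF less_imp_le] simp: d_def)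
      then have "a * sqrt (h i) * (a * sqrt (h i)) \<le> d * (a * sqrt (h i))"
        using h0 a by (intro mult_right_mono) auto
      also have "a * sqrt (h i) * (a * sqrt (h i)) = h i * a * a"
        using h0 by (simp add: algebra_simps)
      finally have "h i * a * (a + d) \<le> d * (h i * a + a * sqrt (h i))"
        by (simp add: algebra_simps)
      also have "\<dots> < d * d"
      proof (rule mult_strict_left_mono[OF gt])
        have "0 \<le> h i * a + a * sqrt (h i)" using h0 a by simp
        then show "0 < d" using gt by linarith
      qed
      finally show False using d by (simp add: power2_eq_square)
    qed
  qed
  ultimately have "((\<lambda>i. p i - q i) \<longlongrightarrow> 0) \<F>"
    by (intro Lim_null_comparison[of "\<lambda>i. p i - q i" "\<lambda>i. h i * Im (q i) + Im (q i) * sqrt (h i)"]) auto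
  from tendsto_add[OF this q(1)] show ?thesis by simp
qed

lemma hyp_disp_tendsto_0:
  assumes "(p \<longlongrightarrow> l) \<F>" "(q \<longlongrightarrow> l) \<F>" "Im l > 0"
  shows "((\<lambda>i. hyp_disp (p i) (q i)) \<longlongrightarrow> 0) \<F>"
proof -
  have "((\<lambda>i. hyp_disp (p i) (q i)) \<longlongrightarrow> (cmod (l - l))\<^sup>2 / (Im l * Im l)) \<F>"
    unfolding hyp_disp_def using assms by (intro tendsto_intros) auto
  then show ?thesis by simp
qed

lemma hyp_disp_divide: "b > 0 \<Longrightarrow> hyp_disp (z / of_real b) (w / of_real b) = hyp_disp z w"
  by (simp add: hyp_disp_def flip: diff_divide_distrib)
    (simp add: norm_divide power_divide power2_eq_square)

lemma hyp_disp_mult: "b > 0 \<Longrightarrow> hyp_disp (of_real b * z) (of_real b * w) = hyp_disp z w"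
  using hyp_disp_divide[of b "of_real b * z" "of_real b * w"] by simp

text \<open>Rescaling by \<open>B i\<close> preserves \<open>hyp_disp\<close> and each transform
  contracts it, so replacing the fixed argument \<open>w\<close> by the moving \<open>q i\<close>
  costs at most the displacement from \<open>q i\<close> to \<open>w\<close>, whatever the measures
  are. This does the work of locally uniform convergence.\<close>

lemma tendsto_rescaled_F_transform:
  assumes M: "eventually (\<lambda>i. real_distribution (M i)) \<F>"
    and B: "eventually (\<lambda>i. B i > 0) \<F>"
    and q: "(q \<longlongrightarrow> w) \<F>" "Im w > 0"
    and F: "((\<lambda>i. F_transform (M i) (of_real (B i) * w) / of_real (B i)) \<longlongrightarrow> l) \<F>" "Im l > 0"
  shows "((\<lambda>i. F_transform (M i) (of_real (B i) * q i) / of_real (B i)) \<longlongrightarrow> l) \<F>"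
proof (rule tendsto_of_hyp_disp[OF _ F])
  have Imq: "eventually (\<lambda>i. Im (q i) > 0) \<F>"
    using tendsto_Im[OF q(1)] q(2) by (auto dest: order_tendstoD)
  show "eventually (\<lambda>i. Im (F_transform (M i) (of_real (B i) * q i) / of_real (B i)) > 0) \<F>"
    using Imq M B by eventually_elim (simp add: real_distribution.Im_F_transform_pos)
  have "((\<lambda>i. hyp_disp (q i) w) \<longlongrightarrow> 0) \<F>"
    by (rule hyp_disp_tendsto_0[OF q(1) tendsto_const q(2)])
  moreover have "eventually (\<lambda>i. norm (hyp_disp (F_transform (M i) (of_real (B i) * q i) / of_real (B i))
      (F_transform (M i) (of_real (B i) * w) / of_real (B i))) \<le> hyp_disp (q i) w) \<F>"
    using Imq M B
  proof eventually_elim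
    case (elim i)
    interpret real_distribution "M i" by fact
    show ?case
      using elim q(2) hyp_disp_F_transform_le[of "of_real (B i) * q i" "of_real (B i) * w"]
      by (simp add: hyp_disp_divide hyp_disp_mult) 
        (simp add: hyp_disp_def Im_F_transform_pos less_imp_le)
  qed
  ultimately show "((\<lambda>i. hyp_disp (F_transform (M i) (of_real (B i) * q i) / of_real (B i))
      (F_transform (M i) (of_real (B i) * w) / of_real (B i))) \<longlongrightarrow> 0) \<F>"
    by (rule Lim_null_comparison[rotated])
qed

section \<open>Holomorphy, dilations, and closeness to the identity at large scales\<close>

context real_distribution
begin

lemma cauchy_transform_has_field_derivative:
  assumes w: "Im w > 0"
  shows "(cauchy_transform M has_field_derivative - (LINT t|M. 1 / (w - of_real t)\<^sup>2)) (at w)"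
  unfolding DERIV_def
proof (rule LIM_zero_cancel)
  let ?D = "LINT t|M. 1 / (w - of_real t)\<^sup>2"
  \<comment> \<open>The difference quotient minus its limit is \<open>h\<close> times the integral
    of 1 / ((w + h - t) (w - t)^2). For |h| < Im w / 2 the shifted point keeps height Im w / 2,
    which yields this bound.\<close>
  define C where "C = 1 / (Im w / 2) * (1 / Im w)\<^sup>2"
  have intD: "integrable M (\<lambda>t. 1 / (w - of_real t)\<^sup>2)"
  proof (rule integrable_bounded[of _ "(1 / Im w)\<^sup>2"])
    show "norm (1 / (w - of_real t)\<^sup>2) \<le> (1 / Im w)\<^sup>2" for t
      using power_mono[OF norm_cauchy_kernel_le[OF w, of t], of 2]
      by (simp add: norm_divide power_divide norm_power)
  qed simp
  have "eventually (\<lambda>h. h \<noteq> 0 \<and> cmod h < Im w / 2) (at 0)"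
    using w by (auto simp: eventually_at intro!: exI[of _ "Im w / 2"])
  then have "eventually (\<lambda>h. norm ((cauchy_transform M (w + h) - cauchy_transform M w) / h - - ?D) \<le> cmod h * C) (at 0)"
  proof eventually_elim
    case (elim h)
    then have im: "Im (w + h) > Im w / 2"
      using abs_Im_le_cmod[of h] unfolding plus_complex.sel by linarith
    then have pos: "Im (w + h) > 0" using w by linarith
    have k: "(1 / (w + h - of_real t) - 1 / (w - of_real t)) / h + 1 / (w - of_real t)\<^sup>2
      = h * (1 / (w + h - of_real t) * (1 / (w - of_real t))\<^sup>2)" for t
    proof -
      have "w + h - of_real t \<noteq> 0" "w - of_real t \<noteq> 0"
        using diff_of_real_nonzero[of "w + h" t] diff_of_real_nonzero[of w t] pos w by auto
      then show ?thesis using elim by (simp add: divide_simps power2_eq_square)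
    qed
    have "(cauchy_transform M (w + h) - cauchy_transform M w) / h - - ?D
      = (LINT t|M. (1 / (w + h - of_real t) - 1 / (w - of_real t)) / h + 1 / (w - of_real t)\<^sup>2)"
      unfolding cauchy_transform_def
      using intD integrable_cauchy_kernel[OF w] integrable_cauchy_kernel[OF pos] by simp
    also have "norm \<dots> \<le> (LINT t|M. cmod h * C)"
      unfolding k
    proof (rule Bochner_Integration.integral_norm_bound_integral)
      have b: "norm (h * (1 / (w + h - of_real t) * (1 / (w - of_real t))\<^sup>2)) \<le> cmod h * C" for t
      proof -
        have "norm (1 / (w + h - of_real t)) \<le> 1 / (Im w / 2)"
          by (rule order_trans[OF norm_cauchy_kernel_le[OF pos]]) (use im w in \<open>intro divide_left_mono; simp\<close>)
        moreover have "norm (1 / (w - of_real t)) ^ 2 \<le> (1 / Im w)\<^sup>2"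
          by (intro power_mono norm_cauchy_kernel_le w) auto
        ultimately show ?thesis
          unfolding C_def norm_mult norm_power using w
          by (intro mult_mono) auto
      qed
      then show "norm (h * (1 / (w + h - of_real t) * (1 / (w - of_real t))\<^sup>2)) \<le> cmod h * C" for t .
      show "integrable M (\<lambda>t. h * (1 / (w + h - of_real t) * (1 / (w - of_real t))\<^sup>2))"
        by (rule integrable_bounded[OF _ b]) simp
    qed simp
    finally show ?case using prob_space by simp
  qed
  moreover have "((\<lambda>h. cmod h * C) \<longlongrightarrow> 0) (at 0)"
    by (auto intro!: tendsto_eq_intros)
  ultimately show "((\<lambda>h. (cauchy_transform M (w + h) - cauchy_transform M w) / h - - ?D) \<longlongrightarrow> 0) (at 0)"
    by (rule Lim_null_comparison)
qed

lemma cauchy_transform_holomorphic: "cauchy_transform M holomorphic_on {z. Im z > 0}"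
  unfolding holomorphic_on_def field_differentiable_def
  using cauchy_transform_has_field_derivative has_field_derivative_at_within by blast

lemma F_transform_holomorphic: "F_transform M holomorphic_on {z. Im z > 0}"
  unfolding F_transform_def
  by (intro holomorphic_intros cauchy_transform_holomorphic) (auto simp: cauchy_transform_nonzero)

lemma real_distribution_dilation: "real_distribution (dilation b M)"
  unfolding dilation_def by simp

lemma integral_dilation:
  fixes f :: "real \<Rightarrow> 'a::{banach, second_countable_topology}"
  assumes "f \<in> borel_measurable borel"
  shows "(LINT t|dilation b M. f t) = (LINT t|M. f (b * t))"
  unfolding dilation_def using assms by (intro integral_distr) auto

lemma cauchy_transform_dilation:
  assumes b: "b > 0"
  shows "cauchy_transform (dilation (1 / b) M) z = of_real b * cauchy_transform M (of_real b * z)"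
proof -
  have "cauchy_transform (dilation (1 / b) M) z = (LINT t|M. 1 / (z - of_real (1 / b * t)))"
    unfolding cauchy_transform_def by (rule integral_dilation) simp
  also have "\<dots> = (LINT t|M. of_real b * (1 / (of_real b * z - of_real t)))"
    using b by (intro Bochner_Integration.integral_cong refl) (auto simp: divide_simps mult.commute)
  also have "\<dots> = of_real b * cauchy_transform M (of_real b * z)"
    unfolding cauchy_transform_def by (rule integral_mult_right_zero)
  finally show ?thesis .
qed

lemma F_transform_dilation:
  "b > 0 \<Longrightarrow> F_transform (dilation (1 / b) M) z = F_transform M (of_real b * z) / of_real b"
  by (simp add: F_transform_def cauchy_transform_dilation)

text \<open>A smoothed tail probability: the integrand is bounded and continuous, so the quantity is
  continuous under weak convergence, and it is monotone in the scale. Both properties enter the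
  uniformity over compact time intervals.\<close>

definition dispersion :: "real \<Rightarrow> real" where
  "dispersion B = (LINT t|M. min 1 (\<bar>t\<bar> / B))"

lemma integrable_min_abs_divide: "B > 0 \<Longrightarrow> integrable M (\<lambda>t. min 1 (\<bar>t\<bar> / B))"
  by (rule integrable_bounded[of _ 1]) auto

lemma dispersion_nonneg: "B > 0 \<Longrightarrow> dispersion B \<ge> 0"
  unfolding dispersion_def by (intro integral_nonneg_AE) auto

lemma dispersion_antimono:
  assumes "0 < B" "B \<le> C"
  shows "dispersion C \<le> dispersion B"
  unfolding dispersion_def using assms
  by (intro integral_mono integrable_min_abs_divide min.mono divide_left_mono) auto

lemma dispersion_tendsto_0: "(dispersion \<longlongrightarrow> 0) at_top"
proof -
  have "((\<lambda>B. LINT t|M. min 1 (\<bar>t\<bar> / B)) \<longlongrightarrow> (LINT t|M. 0)) at_top"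
  proof (rule integral_dominated_convergence_at_top[where w = "\<lambda>_. 1"])
    show "\<forall>\<^sub>F B in at_top. AE t in M. norm (min 1 (\<bar>t\<bar> / B)) \<le> 1"
      using eventually_gt_at_top[of 0] by eventually_elim auto
    show "AE t in M. ((\<lambda>B. min 1 (\<bar>t\<bar> / B)) \<longlongrightarrow> 0) at_top"
    proof (rule AE_I2)
      fix t :: real
      have "((\<lambda>B. \<bar>t\<bar> / B) \<longlongrightarrow> 0) at_top"
        by (intro tendsto_divide_0[OF tendsto_const] filterlim_at_top_imp_at_infinity filterlim_ident)
      then have "((\<lambda>B. min 1 (\<bar>t\<bar> / B)) \<longlongrightarrow> min 1 0) at_top"
        by (intro tendsto_min tendsto_const)
      then show "((\<lambda>B. min 1 (\<bar>t\<bar> / B)) \<longlongrightarrow> 0) at_top" by simp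
    qed
  qed auto
  then show ?thesis by (simp add: dispersion_def[abs_def])
qed

text \<open>After the substitution s = t / B the integrand is s / (u (u - s)). The quotient |s| / |u
  - s| is at most |s| / Im u, useful for small s, and at most 1 + |u| / Im u, useful for large s;
  the minimum of the two is a multiple of the integrand of \<open>dispersion\<close>.\<close>

lemma norm_rescaled_cauchy_transform_diff_le:
  assumes B: "B > 0" and u: "Im u > 0"
  shows "norm (of_real B * cauchy_transform M (of_real B * u) - 1 / u)
    \<le> max (1 / Im u) (1 + cmod u / Im u) / cmod u * dispersion B"
    (is "_ \<le> ?K / _ * _")
proof -
  let ?f = "\<lambda>t. of_real B * (1 / (of_real B * u - of_real t)) - 1 / u"
  have Bu: "Im (of_real B * u) > 0" using B u by simp
  have "of_real B * cauchy_transform M (of_real B * u) - 1 / u = (LINT t|M. ?f t)"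
    unfolding cauchy_transform_def
    by (subst Bochner_Integration.integral_diff[OF integrable_mult_right[OF integrable_cauchy_kernel[OF Bu]]])
      (use prob_space in \<open>simp_all only: integral_mult_right_zero, simp_all\<close>)
  also have "norm \<dots> \<le> (LINT t|M. ?K / cmod u * min 1 (\<bar>t\<bar> / B))"
  proof (rule Bochner_Integration.integral_norm_bound_integral)
    show "integrable M ?f"
      by (intro Bochner_Integration.integrable_diff integrable_mult_right integrable_cauchy_kernel Bu) simp
    show "integrable M (\<lambda>t. ?K / cmod u * min 1 (\<bar>t\<bar> / B))"
      by (intro integrable_mult_right integrable_min_abs_divide B)
    fix t
    define s where "s = t / B"
    have u0: "u \<noteq> 0" using u by auto
    have us: "u - of_real s \<noteq> 0" using u by (intro diff_of_real_nonzero) simp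
    have ge: "cmod (u - of_real s) \<ge> Im u" by (rule Im_le_cmod_diff_of_real)
    have "?f t = of_real s / (u * (u - of_real s))"
    proof -
      have "of_real B * (1 / (of_real B * u - of_real t)) = 1 / (u - of_real s)"
        using B us by (simp add: s_def field_simps)
      moreover have "1 / (u - of_real s) - 1 / u = of_real s / (u * (u - of_real s))"
        using u0 us by (simp add: divide_simps)
      ultimately show ?thesis by simp
    qed
    then have n: "norm (?f t) = \<bar>s\<bar> / cmod (u - of_real s) / cmod u"
      by (simp add: norm_divide norm_mult)
    have 1: "\<bar>s\<bar> / cmod (u - of_real s) \<le> ?K * \<bar>s\<bar>"
    proof -
      have "\<bar>s\<bar> / cmod (u - of_real s) \<le> \<bar>s\<bar> / Im u"
        using ge u by (intro divide_left_mono mult_pos_pos) auto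
      also have "\<dots> = 1 / Im u * \<bar>s\<bar>" by simp
      also have "\<dots> \<le> ?K * \<bar>s\<bar>" by (intro mult_right_mono) auto
      finally show ?thesis .
    qed
    have 2: "\<bar>s\<bar> / cmod (u - of_real s) \<le> ?K * 1"
    proof -
      have "\<bar>s\<bar> \<le> cmod (u - of_real s) + cmod u"
        using norm_triangle_ineq4[of u "u - of_real s"] by simp
      then have "\<bar>s\<bar> / cmod (u - of_real s) \<le> (cmod (u - of_real s) + cmod u) / cmod (u - of_real s)"
        by (intro divide_right_mono) auto
      also have "\<dots> = 1 + cmod u / cmod (u - of_real s)"
        using us by (simp add: add_divide_distrib)
      also have "\<dots> \<le> 1 + cmod u / Im u"
        using ge u by (intro add_left_mono divide_left_mono mult_pos_pos) auto
      finally show ?thesis by simp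
    qed
    have "\<bar>s\<bar> / cmod (u - of_real s) \<le> ?K * min 1 \<bar>s\<bar>"
      using 1 2 by (cases "1 \<le> \<bar>s\<bar>") (simp_all only: min_absorb1 min_absorb2 linorder_not_le less_imp_le if_True if_False)
    then have "norm (?f t) \<le> ?K * min 1 \<bar>s\<bar> / cmod u"
      unfolding n by (intro divide_right_mono) auto
    then show "norm (?f t) \<le> ?K / cmod u * min 1 (\<bar>t\<bar> / B)"
      using B by (simp add: s_def)
  qed
  also have "\<dots> = ?K / cmod u * dispersion B"
    unfolding dispersion_def by (rule integral_mult_right_zero)
  finally show ?thesis .
qed

end

text \<open>Vanishing dispersion means that the rescaled measures approach the point mass at 0,
  whose transform is the identity. Measures, scales and arguments may all vary together.\<close>

lemma tendsto_rescaled_F_transform_id: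
  assumes M: "eventually (\<lambda>i. real_distribution (M i)) \<F>"
    and B: "eventually (\<lambda>i. B i > 0) \<F>"
    and d: "((\<lambda>i. real_distribution.dispersion (M i) (B i)) \<longlongrightarrow> 0) \<F>"
    and q: "(q \<longlongrightarrow> u) \<F>" "Im u > 0"
  shows "((\<lambda>i. F_transform (M i) (of_real (B i) * q i) / of_real (B i)) \<longlongrightarrow> u) \<F>"
proof (rule tendsto_rescaled_F_transform[OF M B q _ q(2)])
  have u: "u \<noteq> 0" using q(2) by auto
  have "((\<lambda>i. of_real (B i) * cauchy_transform (M i) (of_real (B i) * u) - 1 / u) \<longlongrightarrow> 0) \<F>"
  proof (rule Lim_null_comparison)
    show "eventually (\<lambda>i. norm (of_real (B i) * cauchy_transform (M i) (of_real (B i) * u) - 1 / u)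
      \<le> max (1 / Im u) (1 + cmod u / Im u) / cmod u * real_distribution.dispersion (M i) (B i)) \<F>"
      using M B by eventually_elim (rule real_distribution.norm_rescaled_cauchy_transform_diff_le[OF _ _ q(2)])
    show "((\<lambda>i. max (1 / Im u) (1 + cmod u / Im u) / cmod u * real_distribution.dispersion (M i) (B i)) \<longlongrightarrow> 0) \<F>"
      by (rule tendsto_mult_right_zero[OF d])
  qed
  then have "((\<lambda>i. of_real (B i) * cauchy_transform (M i) (of_real (B i) * u)) \<longlongrightarrow> 1 / u) \<F>"
    by (rule LIM_zero_cancel)
  then have "((\<lambda>i. 1 / (of_real (B i) * cauchy_transform (M i) (of_real (B i) * u))) \<longlongrightarrow> 1 / (1 / u)) \<F>"
    using u by (intro tendsto_divide tendsto_const) auto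
  then show "((\<lambda>i. F_transform (M i) (of_real (B i) * u) / of_real (B i)) \<longlongrightarrow> u) \<F>"
    by (simp add: F_transform_def mult.commute)
qed

section \<open>Poisson integrals and Cauchy transforms\<close>

lemma has_bochner_integral_inverse_1_plus_square:
  "has_bochner_integral lborel (\<lambda>x::real. inverse (1 + x\<^sup>2)) pi"
  using integrable_inverse_1_plus_square LBINT_inverse_1_plus_square
  by (simp add: has_bochner_integral_iff interval_lebesgue_integral_def set_lebesgue_integral_def
      set_integrable_def)

definition poisson_kernel :: "complex \<Rightarrow> real \<Rightarrow> real" where
  "poisson_kernel z t = Im z / (pi * (cmod (z - of_real t))\<^sup>2)"

lemma poisson_kernel_pos: "Im z > 0 \<Longrightarrow> poisson_kernel z t > 0"
  using diff_of_real_nonzero[of z t] by (simp add: poisson_kernel_def)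

lemma borel_measurable_poisson_kernel [measurable]:
  "poisson_kernel z \<in> borel_measurable borel"
  unfolding poisson_kernel_def[abs_def] by measurable

lemma poisson_kernel_affine:
  assumes "Im z > 0"
  shows "poisson_kernel z (Re z + Im z * u) = inverse (1 + u\<^sup>2) / (pi * Im z)"
proof -
  have "(cmod (z - of_real (Re z + Im z * u)))\<^sup>2 = (Im z)\<^sup>2 * (1 + u\<^sup>2)"
    by (simp add: cmod_power2 power_mult_distrib algebra_simps)
  then show ?thesis
    using assms by (simp add: poisson_kernel_def power2_eq_square divide_simps)
qed

lemma has_bochner_integral_poisson_kernel:
  assumes z: "Im z > 0"
  shows "has_bochner_integral lborel (poisson_kernel z) 1"
proof -
  have "has_bochner_integral lborel (\<lambda>u. inverse (1 + u\<^sup>2) / (pi * Im z)) (pi / (pi * Im z))"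
    by (intro has_bochner_integral_divide_zero has_bochner_integral_inverse_1_plus_square)
  then show ?thesis
    using z unfolding poisson_kernel_affine[OF z, symmetric]
    by (subst lborel_has_bochner_integral_real_affine_iff[of "Im z" _ _ "Re z"])
      (simp_all add: divide_inverse mult.assoc[symmetric])
qed

text \<open>Closing the segment \<open>[-R, R]\<close> by a half circle, the pole at \<open>z\<close> is removed by
  subtracting \<open>H z\<close> and the factor \<open>1 / (\<zeta> - cnj z)\<close> makes the integral over the arc \<open>O(1/R)\<close>,
  for any bounded \<open>H\<close>.\<close>

lemma contour_integral_segment_bound:
  fixes H :: "complex \<Rightarrow> complex"
  assumes d: "d > 0" and hol: "H holomorphic_on {\<zeta>. Im \<zeta> > - d}"
    and C: "\<And>\<zeta>. Im \<zeta> \<ge> 0 \<Longrightarrow> norm (H \<zeta>) \<le> C"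
    and z: "Im z > 0" and R: "R > 0" "R \<ge> 2 * cmod z"
  shows "norm (integral {-R..R} (\<lambda>t. (H (of_real t) - H z) / of_real ((cmod (z - of_real t))\<^sup>2)))
      \<le> 8 * C * pi / R"
proof -
  \<comment> \<open>The cut at -Im z keeps the pole \<open>cnj z\<close> of \<open>k\<close> outside
    the half plane \<open>S\<close>, so only the pole at \<open>z\<close> has to be removed.\<close>
  define d' where "d' = min d (Im z)"
  define S where "S = {\<zeta>. Im \<zeta> > - d'}"
  have d': "d' > 0" "d' \<le> d" "d' \<le> Im z"
    using d z by (auto simp: d'_def)
  have S: "open S" "convex S"
    unfolding S_def using open_halfspace_Im_gt convex_halfspace_Im_gt by auto
  define E where "E = (\<lambda>\<zeta>. if \<zeta> = z then deriv H z else (H \<zeta> - H z) / (\<zeta> - z))"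
  define k where "k = (\<lambda>\<zeta>. E \<zeta> / (\<zeta> - cnj z))"
  have E: "E holomorphic_on S"
    unfolding E_def by (intro pole_lemma_open S holomorphic_on_subset[OF hol]) (use d' in \<open>auto simp: S_def\<close>)
  have k: "k holomorphic_on S"
    unfolding k_def by (intro holomorphic_intros E) (use d' in \<open>auto simp: S_def\<close>)
  let ?l = "linepath (of_real (- R)) (of_real R) :: real \<Rightarrow> complex"
  let ?c = "part_circlepath 0 R 0 pi"
  have lS: "path_image ?l \<subseteq> S"
    using d' by (auto simp: closed_segment_def S_def)
  have ImE: "Im \<zeta> \<ge> 0 \<and> cmod \<zeta> = R" if "\<zeta> \<in> path_image ?c" for \<zeta>
    using that R by (auto simp: path_image_part_circlepath' image_iff norm_mult closed_segment_eq_real_ivl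
        intro!: mult_nonneg_nonneg sin_ge_zero)
  have cS: "path_image ?c \<subseteq> S"
    using ImE d' by (force simp: S_def)
  have zero: "(k has_contour_integral 0) (?l +++ ?c)"
    by (rule Cauchy_theorem_convex_simple[OF k S(2)])
      (use lS cS in \<open>auto intro!: valid_path_join simp: path_image_join exp_minus\<close>)
  have il: "k contour_integrable_on ?l"
    using k S lS contour_integrable_holomorphic_simple[OF k S(1)] by simp
  have ic: "k contour_integrable_on ?c"
    using k S cS contour_integrable_holomorphic_simple[OF k S(1)] by simp
  have sum: "contour_integral ?l k + contour_integral ?c k = 0"
    using has_contour_integral_unique[OF has_contour_integral_join[OF has_contour_integral_integral[OF il] has_contour_integral_integral[OF ic]] zero]
    by simp
  \<comment> \<open>On the arc the numerator is at most 2C and both distances are at least R / 2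
    because R >= 2 |z|; the quotient is 8C / R^2, and the arc has length R pi.\<close>
  have "norm (contour_integral ?c k) \<le> 8 * C / R\<^sup>2 * R * (pi - 0)"
  proof (rule has_contour_integral_bound_part_circlepath[OF has_contour_integral_integral[OF ic]])
    have C0: "C \<ge> 0" using C[of z] z norm_ge_zero[of "H z"] by linarith
    then show "0 \<le> 8 * C / R\<^sup>2" by simp
    fix \<zeta> assume "\<zeta> \<in> path_image ?c"
    then have \<zeta>: "Im \<zeta> \<ge> 0" "cmod \<zeta> = R" using ImE by auto
    have 1: "cmod (\<zeta> - z) \<ge> R / 2" "cmod (\<zeta> - cnj z) \<ge> R / 2"
      using norm_triangle_ineq2[of \<zeta> z] norm_triangle_ineq2[of \<zeta> "cnj z"] \<zeta> R by auto
    then have ne: "\<zeta> \<noteq> z" using R by auto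
    have "norm (H \<zeta> - H z) \<le> 2 * C"
      using norm_triangle_ineq4[of "H \<zeta>" "H z"] C[of \<zeta>] C[of z] \<zeta> z by auto
    moreover have "R / 2 * (R / 2) \<le> cmod (\<zeta> - z) * cmod (\<zeta> - cnj z)"
      using 1 R by (intro mult_mono) auto
    ultimately have "norm (H \<zeta> - H z) / (cmod (\<zeta> - z) * cmod (\<zeta> - cnj z)) \<le> 2 * C / (R / 2 * (R / 2))"
      using R C0 by (intro frac_le) auto
    then show "norm (k \<zeta>) \<le> 8 * C / R\<^sup>2"
      using ne by (simp add: k_def E_def norm_divide norm_mult power2_eq_square)
  qed (use R in auto)
  then have bound: "norm (contour_integral ?l k) \<le> 8 * C * pi / R"
    using sum R by (simp add: add_eq_0_iff power2_eq_square field_simps)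
  have keq: "k (of_real t) = (H (of_real t) - H z) / of_real ((cmod (z - of_real t))\<^sup>2)" for t
  proof -
    have "of_real t \<noteq> z" using z by auto
    moreover have "(of_real t - z) * (of_real t - cnj z) = of_real ((cmod (z - of_real t))\<^sup>2)"
    proof -
      have "(of_real t - z) * (of_real t - cnj z) = (z - of_real t) * cnj (z - of_real t)"
        by (simp add: algebra_simps)
      then show ?thesis unfolding complex_norm_square .
    qed
    ultimately show ?thesis by (simp add: k_def E_def)
  qed
  have "((\<lambda>t. k (of_real t)) has_integral contour_integral ?l k) {-R..R}"
    using has_contour_integral_integral[OF il] R
    by (subst (asm) has_contour_integral_linepath_Reals_iff) auto
  note i = this[unfolded keq]
  from integral_unique[OF i] bound show ?thesis by simp
qed

text \<open>The segment bound says that the integral of (H t - H z) / |z - t|^2 over the real line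
  vanishes; the integrand is dominated by a multiple of the Poisson kernel since \<open>H\<close> is
  bounded. Multiplying by Im z / pi and using that the kernel has mass one gives the
  formula.\<close>

lemma poisson_integral_half_plane:
  fixes H :: "complex \<Rightarrow> complex"
  assumes d: "d > 0" and hol: "H holomorphic_on {\<zeta>. Im \<zeta> > - d}"
    and C: "\<And>\<zeta>. Im \<zeta> \<ge> 0 \<Longrightarrow> norm (H \<zeta>) \<le> C"
    and z: "Im z > 0"
  shows "has_bochner_integral lborel (\<lambda>t. of_real (poisson_kernel z t) * H (of_real t)) (H z)"
proof -
  let ?k = "\<lambda>t. (H (of_real t) - H z) / of_real ((cmod (z - of_real t))\<^sup>2)"
  have cont: "continuous_on UNIV (\<lambda>t::real. H (of_real t))"
    by (rule continuous_on_compose2[OF holomorphic_on_imp_continuous_on[OF hol]])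
      (use d in \<open>auto intro!: continuous_intros\<close>)
  then have [measurable]: "(\<lambda>t::real. H (of_real t)) \<in> borel_measurable borel"
    by (rule borel_measurable_continuous_onI)
  have P: "integrable lborel (poisson_kernel z)" "integral\<^sup>L lborel (poisson_kernel z) = 1"
    using has_bochner_integral_poisson_kernel[OF z] by (auto simp: has_bochner_integral_iff)
  have kb: "norm (?k t) \<le> 2 * C * pi / Im z * poisson_kernel z t" for t
  proof -
    have "norm (H (of_real t) - H z) \<le> 2 * C"
      using norm_triangle_ineq4[of "H (of_real t)" "H z"] C[of "of_real t"] C[of z] z by auto
    then have "norm (?k t) \<le> 2 * C / (cmod (z - of_real t))\<^sup>2"
      by (simp add: norm_divide divide_right_mono flip: of_real_power)
    then show ?thesis using z by (simp add: poisson_kernel_def)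
  qed
  have intb: "integrable lborel (\<lambda>t. 2 * C * pi / Im z * poisson_kernel z t)"
    by (intro integrable_mult_right P)
  have ik: "integrable lborel ?k"
    by (rule Bochner_Integration.integrable_bound[OF intb])
      (use order_trans[OF kb abs_ge_self] in \<open>auto intro!: AE_I2 simp del: abs_mult abs_divide\<close>)
  have "(\<lambda>n. LINT t|lborel. indicator {- real n..real n} t *\<^sub>R ?k t) \<longlonglongrightarrow> (LINT t|lborel. ?k t)"
  proof (rule integral_dominated_convergence[OF _ _ intb])
    show "AE t in lborel. (\<lambda>n. indicator {- real n..real n} t *\<^sub>R ?k t) \<longlonglongrightarrow> ?k t"
    proof (rule AE_I2)
      fix t :: real
      have "eventually (\<lambda>n. real n \<ge> \<bar>t\<bar>) sequentially"
        using filterlim_real_sequentially by (simp add: filterlim_at_top)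
      then have "eventually (\<lambda>n. indicator {- real n..real n} t *\<^sub>R ?k t = ?k t) sequentially"
        by eventually_elim (auto simp: indicator_def)
      then show "(\<lambda>n. indicator {- real n..real n} t *\<^sub>R ?k t) \<longlonglongrightarrow> ?k t"
        by (rule tendsto_eventually)
    qed
    show "AE t in lborel. norm (indicator {- real n..real n} t *\<^sub>R ?k t) \<le> 2 * C * pi / Im z * poisson_kernel z t" for n
    proof (rule AE_I2)
      fix t :: real
      have "norm (indicator {- real n..real n} t *\<^sub>R ?k t) \<le> norm (?k t)"
        by (auto simp: indicator_def)
      then show "norm (indicator {- real n..real n} t *\<^sub>R ?k t) \<le> 2 * C * pi / Im z * poisson_kernel z t"
        using kb[of t] by linarith
    qed
  qed auto
  moreover have "(\<lambda>n. LINT t|lborel. indicator {- real n..real n} t *\<^sub>R ?k t) \<longlonglongrightarrow> 0"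
  proof (rule Lim_null_comparison)
    have "(\<lambda>n. 8 * C * pi * inverse (real n)) \<longlonglongrightarrow> 8 * C * pi * 0"
      by (intro tendsto_mult tendsto_const tendsto_inverse_0_at_top filterlim_real_sequentially)
    then show "(\<lambda>n. 8 * C * pi / real n) \<longlonglongrightarrow> 0"
      by (simp add: divide_inverse)
    have "eventually (\<lambda>n. real n \<ge> 2 * cmod z \<and> real n \<ge> 1) sequentially"
      using filterlim_real_sequentially by (simp add: filterlim_at_top eventually_conj_iff)
    then show "eventually (\<lambda>n. norm (LINT t|lborel. indicator {- real n..real n} t *\<^sub>R ?k t) \<le> 8 * C * pi / real n) sequentially"
    proof eventually_elim
      case (elim n)
      have "set_integrable lborel {- real n..real n} ?k"
        unfolding set_integrable_def by (rule integrable_mult_indicator[OF _ ik]) auto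
      then have "(LINT t|lborel. indicator {- real n..real n} t *\<^sub>R ?k t) = integral {- real n..real n} ?k"
        using set_borel_integral_eq_integral(2) by (simp add: set_lebesgue_integral_def)
      then show ?case
        using contour_integral_segment_bound[OF d hol C z, of "real n"] elim by auto
    qed
  qed
  ultimately have k0: "(LINT t|lborel. ?k t) = 0"
    by (rule LIMSEQ_unique)
  have "has_bochner_integral lborel ?k 0"
    using ik k0 by (simp add: has_bochner_integral_iff)
  then have "has_bochner_integral lborel (\<lambda>t. of_real (Im z / pi) * ?k t + of_real (poisson_kernel z t) * H z)
    (of_real (Im z / pi) * 0 + of_real 1 * H z)"
    by (intro has_bochner_integral_add has_bochner_integral_mult_right has_bochner_integral_mult_left
        has_bochner_integral_of_real has_bochner_integral_poisson_kernel z)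
  moreover have "of_real (Im z / pi) * ?k t + of_real (poisson_kernel z t) * H z = of_real (poisson_kernel z t) * H (of_real t)" for t
    unfolding poisson_kernel_def by (simp add: add_divide_distrib[symmetric]) (simp add: algebra_simps)
  ultimately show ?thesis by simp
qed

section \<open>Representing measures obtained from boundary values\<close>

lemma poisson_kernel_imaginary: "poisson_kernel (\<i> * of_real y) t = y / (pi * (y\<^sup>2 + t\<^sup>2))"
  by (simp add: poisson_kernel_def cmod_power2 add.commute)

lemma has_bochner_integral_Im:
  "has_bochner_integral M f x \<Longrightarrow> has_bochner_integral M (\<lambda>t. Im (f t)) (Im x)"
  by (rule has_bochner_integral_bounded_linear[OF bounded_linear_Im])

lemma (in real_distribution) Im_cauchy_transform_poisson:
  assumes z: "Im z > 0"
  shows "Im (cauchy_transform M z) = - pi * (LINT t|M. poisson_kernel z t)"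
proof -
  have "(LINT t|M. poisson_kernel z t) = (LINT t|M. Im z / pi * (1 / (cmod (z - of_real t))\<^sup>2))"
    by (simp add: poisson_kernel_def)
  also have "\<dots> = Im z / pi * cauchy_energy M z"
    unfolding cauchy_energy_def by (rule integral_mult_right_zero)
  finally show ?thesis by (simp add: Im_cauchy_transform z)
qed

lemma (in real_distribution) tendsto_cauchy_transform_imaginary:
  "((\<lambda>y. \<i> * of_real y * cauchy_transform M (\<i> * of_real y)) \<longlongrightarrow> 1) at_top"
proof -
  have "((\<lambda>y. of_real y * cauchy_transform M (of_real y * \<i>) - 1 / \<i>) \<longlongrightarrow> 0) at_top"
  proof (rule Lim_null_comparison)
    show "\<forall>\<^sub>F y in at_top. norm (of_real y * cauchy_transform M (of_real y * \<i>) - 1 / \<i>)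
      \<le> max (1 / Im \<i>) (1 + cmod \<i> / Im \<i>) / cmod \<i> * dispersion y"
      using eventually_gt_at_top[of 0] by eventually_elim (rule norm_rescaled_cauchy_transform_diff_le; simp)
    show "((\<lambda>y. max (1 / Im \<i>) (1 + cmod \<i> / Im \<i>) / cmod \<i> * dispersion y) \<longlongrightarrow> 0) at_top"
      by (rule tendsto_mult_right_zero[OF dispersion_tendsto_0])
  qed
  then have "((\<lambda>y. of_real y * cauchy_transform M (of_real y * \<i>)) \<longlongrightarrow> 1 / \<i>) at_top"
    by (rule LIM_zero_cancel)
  then have "((\<lambda>y. \<i> * (of_real y * cauchy_transform M (of_real y * \<i>))) \<longlongrightarrow> \<i> * (1 / \<i>)) at_top"
    by (intro tendsto_mult tendsto_const)
  then show ?thesis by (simp add: mult_ac)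
qed

text \<open>When \<open>H\<close> extends across the real line, Stieltjes inversion names the
  measure: it has density -Im H / pi. The Poisson formula recovers Im H from it, and the
  normalisation at infinity fixes the total mass.\<close>

lemma cauchy_transform_boundary_measure:
  fixes H :: "complex \<Rightarrow> complex"
  assumes d: "d > 0" and hol: "H holomorphic_on {\<zeta>. Im \<zeta> > - d}"
    and C: "\<And>\<zeta>. Im \<zeta> \<ge> 0 \<Longrightarrow> norm (H \<zeta>) \<le> C"
    and neg: "\<And>t. Im (H (of_real t)) \<le> 0"
    and lim: "((\<lambda>y. \<i> * of_real y * H (\<i> * of_real y)) \<longlongrightarrow> 1) at_top"
  obtains M where "real_distribution M" "\<And>z. Im z > 0 \<Longrightarrow> Im (cauchy_transform M z) = Im (H z)"
proof
  define p where "p t = - Im (H (of_real t)) / pi" for t :: real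
  have p0: "p t \<ge> 0" for t
    using neg[of t] by (simp add: p_def divide_nonpos_pos)
  have "continuous_on UNIV (\<lambda>t::real. H (of_real t))"
    by (rule continuous_on_compose2[OF holomorphic_on_imp_continuous_on[OF hol]])
      (use d in \<open>auto intro!: continuous_intros\<close>)
  then have "continuous_on UNIV p"
    unfolding p_def by (intro continuous_intros) auto
  then have [measurable]: "p \<in> borel_measurable borel"
    by (rule borel_measurable_continuous_onI)
  have P: "has_bochner_integral lborel (\<lambda>t. p t * poisson_kernel z t) (- Im (H z) / pi)" if "Im z > 0" for z
  proof -
    have "has_bochner_integral lborel (\<lambda>t. - Im (of_real (poisson_kernel z t) * H (of_real t)) / pi) (- Im (H z) / pi)"
      by (intro has_bochner_integral_divide_zero has_bochner_integral_minus has_bochner_integral_Im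
          poisson_integral_half_plane[OF d hol C that])
    then show ?thesis by (simp add: p_def mult.commute)
  qed
  \<comment> \<open>With y = n + 1 this weight equals y^2 / (y^2 + t^2), which increases to 1, so
    monotone convergence yields integrability of \<open>p\<close> and its mass together. The
    successor avoids y = 0.\<close>
  let ?q = "\<lambda>n t. pi * real (Suc n) * poisson_kernel (\<i> * of_real (real (Suc n))) t"
  have q: "?q n t = 1 - t\<^sup>2 / ((real (Suc n))\<^sup>2 + t\<^sup>2)" for n t
  proof -
    have "(real (Suc n))\<^sup>2 + t\<^sup>2 > 0" by (intro add_pos_nonneg) auto
    then show ?thesis unfolding poisson_kernel_imaginary by (simp add: power2_eq_square divide_simps)
  qed
  have Pn: "has_bochner_integral lborel (\<lambda>t. p t * ?q n t) (- real (Suc n) * Im (H (\<i> * of_real (real (Suc n)))))" for n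
  proof -
    have "has_bochner_integral lborel (\<lambda>t. pi * real (Suc n) * (p t * poisson_kernel (\<i> * of_real (real (Suc n))) t))
      (pi * real (Suc n) * (- Im (H (\<i> * of_real (real (Suc n)))) / pi))"
      by (intro has_bochner_integral_mult_right P) simp
    moreover have "pi * real (Suc n) * (- Im (H (\<i> * of_real (real (Suc n)))) / pi)
      = - real (Suc n) * Im (H (\<i> * of_real (real (Suc n))))"
      by (simp del: of_nat_Suc)
    ultimately show ?thesis by (simp only: mult_ac)
  qed
  have "has_bochner_integral lborel p 1"
  proof -
    have int: "integrable lborel (\<lambda>t. p t * ?q n t)" for n
      using Pn by (simp only: has_bochner_integral_iff)
    have mono: "AE t in lborel. mono (\<lambda>n. p t * ?q n t)"
    proof (intro AE_I2 monoI mult_left_mono p0)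
      fix t :: real and m n :: nat assume "m \<le> n"
      moreover have "(real (Suc m))\<^sup>2 + t\<^sup>2 > 0" "(real (Suc n))\<^sup>2 + t\<^sup>2 > 0"
        by (intro add_pos_nonneg; simp)+
      ultimately show "?q m t \<le> ?q n t"
        unfolding q by (intro diff_left_mono divide_left_mono add_right_mono power_mono mult_pos_pos) auto
    qed
    have nonneg: "AE t in lborel. 0 \<le> p t * ?q n t" for n
      by (intro AE_I2 mult_nonneg_nonneg p0 less_imp_le[OF poisson_kernel_pos]) auto
    have lim_p: "AE t in lborel. (\<lambda>n. p t * ?q n t) \<longlonglongrightarrow> p t"
    proof (rule AE_I2)
      fix t :: real
      have "filterlim (\<lambda>n. (real (Suc n))\<^sup>2 + t\<^sup>2) at_top sequentially"
        by real_asymp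
      then have "(\<lambda>n. p t * (1 - t\<^sup>2 * inverse ((real (Suc n))\<^sup>2 + t\<^sup>2))) \<longlonglongrightarrow> p t * (1 - t\<^sup>2 * 0)"
        by (intro tendsto_intros tendsto_inverse_0_at_top)
      then show "(\<lambda>n. p t * ?q n t) \<longlonglongrightarrow> p t"
        unfolding q by (simp add: divide_inverse)
    qed
    have "filterlim (\<lambda>n. real (Suc n)) at_top sequentially" by real_asymp
    then have "(\<lambda>n. Re (\<i> * of_real (real (Suc n)) * H (\<i> * of_real (real (Suc n))))) \<longlonglongrightarrow> Re 1"
      by (intro tendsto_Re filterlim_compose[OF lim])
    then have "(\<lambda>n. - real (Suc n) * Im (H (\<i> * of_real (real (Suc n))))) \<longlonglongrightarrow> 1"
      by (simp only: Re_complex_of_real Im_complex_of_real times_complex.sel) (simp del: of_nat_Suc)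
    then have lim_int: "(\<lambda>n. LINT t|lborel. p t * ?q n t) \<longlonglongrightarrow> 1"
      using Pn by (simp only: has_bochner_integral_iff)
    show ?thesis
      using integral_monotone_convergence_nonneg[OF int mono nonneg lim_p lim_int]
      by (simp add: has_bochner_integral_iff)
  qed
  then have "integral\<^sup>N lborel (\<lambda>t. ennreal (p t)) = 1"
    using p0 by (simp add: has_bochner_integral_iff nn_integral_eq_integral)
  then show "real_distribution (density lborel (\<lambda>t. ennreal (p t)))" (is "real_distribution ?M")
    by (auto intro!: real_distribution.intro prob_spaceI real_distribution_axioms.intro simp: emeasure_density)
  then interpret M: real_distribution ?M .
  fix z :: complex assume z: "Im z > 0"
  have "(LINT t|?M. poisson_kernel z t) = (LINT t|lborel. p t * poisson_kernel z t)"
    using p0 by (subst integral_real_density) auto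
  also have "\<dots> = - Im (H z) / pi"
    using P[OF z] by (simp add: has_bochner_integral_iff)
  finally show "Im (cauchy_transform ?M z) = Im (H z)"
    by (simp add: M.Im_cauchy_transform_poisson[OF z])
qed

text \<open>The expression 1 + y Im G(iy) is the integral of t^2 / (y^2 + t^2), and this integrand
  is at least 1/2 wherever |t| >= y.\<close>

lemma (in real_distribution) measure_abs_ge_le:
  assumes y: "y > 0"
  shows "measure M {t. \<bar>t\<bar> \<ge> y} \<le> 2 * (1 + y * Im (cauchy_transform M (\<i> * of_real y)))"
proof -
  have [measurable]: "{t::real. \<bar>t\<bar> \<ge> y} \<in> sets borel" by measurable
  have pos: "y\<^sup>2 + t\<^sup>2 > 0" for t using y by (intro add_pos_nonneg) auto
  have i: "integrable M (\<lambda>t. pi * y * poisson_kernel (\<i> * of_real y) t)"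
  proof (rule integrable_bounded[of _ 1])
    fix t
    have "pi * y * poisson_kernel (\<i> * of_real y) t = y\<^sup>2 / (y\<^sup>2 + t\<^sup>2)"
      unfolding poisson_kernel_imaginary by (simp add: power2_eq_square)
    also have "norm \<dots> \<le> 1" using pos[of t] by simp
    finally show "norm (pi * y * poisson_kernel (\<i> * of_real y) t) \<le> 1" .
  qed simp
  have "measure M {t. \<bar>t\<bar> \<ge> y} = (LINT t|M. indicator {t. \<bar>t\<bar> \<ge> y} t)"
    by simp
  also have "\<dots> \<le> (LINT t|M. 2 * (1 - pi * y * poisson_kernel (\<i> * of_real y) t))"
  proof (rule integral_mono)
    show "integrable M (\<lambda>t. 2 * (1 - pi * y * poisson_kernel (\<i> * of_real y) t))"
      using i by auto
    show "integrable M (indicator {t. y \<le> \<bar>t\<bar>} :: real \<Rightarrow> real)"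
      by (rule integrable_bounded[of _ 1]) (auto simp: indicator_def)
    fix t
    have eq: "2 * (1 - pi * y * poisson_kernel (\<i> * of_real y) t) = 2 * t\<^sup>2 / (y\<^sup>2 + t\<^sup>2)"
    proof -
      have "pi * y * poisson_kernel (\<i> * of_real y) t = y\<^sup>2 / (y\<^sup>2 + t\<^sup>2)"
        unfolding poisson_kernel_imaginary by (simp add: power2_eq_square)
      moreover have "1 - y\<^sup>2 / (y\<^sup>2 + t\<^sup>2) = t\<^sup>2 / (y\<^sup>2 + t\<^sup>2)"
        using pos[of t] y by (simp add: divide_simps)
      ultimately show ?thesis by simp
    qed
    have "y\<^sup>2 \<le> t\<^sup>2" if "y \<le> \<bar>t\<bar>"
      using power_mono[OF that, of 2] y by simp
    then show "indicator {t. y \<le> \<bar>t\<bar>} t \<le> 2 * (1 - pi * y * poisson_kernel (\<i> * of_real y) t)"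
      unfolding eq using pos[of t] by (auto simp: indicator_def field_simps)
  qed
  also have "\<dots> = 2 * (1 - pi * y * (LINT t|M. poisson_kernel (\<i> * of_real y) t))"
  proof -
    have "(LINT t|M. pi * y * poisson_kernel (\<i> * of_real y) t) = pi * y * (LINT t|M. poisson_kernel (\<i> * of_real y) t)"
      by (rule integral_mult_right_zero)
    then show ?thesis using i prob_space
      by (subst integral_mult_right_zero, subst Bochner_Integration.integral_diff) auto
  qed
  also have "\<dots> = 2 * (1 + y * Im (cauchy_transform M (\<i> * of_real y)))"
    using y by (simp add: Im_cauchy_transform_poisson)
  finally show ?thesis .
qed

text \<open>The tail bound at one height y0, chosen from the limit function, serves all large
  \<open>n\<close>. The finitely many remaining measures are each tight, and enlarging y0 to a
  common \<open>y\<close> only shrinks the tails.\<close>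

lemma tight_of_cauchy_transform:
  assumes M: "\<And>n. real_distribution (M n)"
    and conv: "\<And>y. y > 0 \<Longrightarrow> (\<lambda>n. Im (cauchy_transform (M n) (\<i> * of_real y))) \<longlonglongrightarrow> h y"
    and h: "((\<lambda>y. y * h y) \<longlongrightarrow> -1) at_top"
  shows "tight M"
  unfolding tight_def
proof (intro conjI allI impI M)
  fix e :: real assume e: "e > 0"
  define I where "I n y = 2 * (1 + y * Im (cauchy_transform (M n) (\<i> * of_real y)))" for n y
  have single: "eventually (\<lambda>y. I n y < e) at_top" for n
  proof -
    interpret real_distribution "M n" by (rule M)
    have "((\<lambda>y. 2 * (1 - Re (\<i> * of_real y * cauchy_transform (M n) (\<i> * of_real y)))) \<longlongrightarrow> 2 * (1 - Re 1)) at_top"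
      by (intro tendsto_intros tendsto_cauchy_transform_imaginary)
    then have "((\<lambda>y. I n y) \<longlongrightarrow> 0) at_top"
      by (simp add: I_def)
    with e show ?thesis by (auto dest: order_tendstoD)
  qed
  have "((\<lambda>y. 2 * (1 + y * h y)) \<longlongrightarrow> 2 * (1 + - 1)) at_top"
    by (intro tendsto_intros h)
  then have "eventually (\<lambda>y. 2 * (1 + y * h y) < e) at_top"
    using e by (auto dest: order_tendstoD)
  then obtain y0 where y0: "y0 > 0" "2 * (1 + y0 * h y0) < e"
    using eventually_happens[OF eventually_conj[OF _ eventually_gt_at_top[of 0]]] by (auto simp: trivial_limit_at_top_linorder)
  have "(\<lambda>n. I n y0) \<longlonglongrightarrow> 2 * (1 + y0 * h y0)"
    unfolding I_def by (intro tendsto_intros conv y0)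
  then have "eventually (\<lambda>n. I n y0 < e) sequentially"
    using y0(2) by (rule order_tendstoD)
  then obtain N where N: "\<And>n. n \<ge> N \<Longrightarrow> I n y0 < e"
    by (auto simp: eventually_sequentially)
  have "eventually (\<lambda>y. (\<forall>n\<in>{..<N}. I n y < e) \<and> y \<ge> y0) at_top"
    by (intro eventually_conj eventually_ball_finite eventually_ge_at_top) (auto intro: single)
  from eventually_happens'[OF trivial_limit_at_top_linorder this]
  obtain y where y: "y \<ge> y0" "\<And>n. n < N \<Longrightarrow> I n y < e"
    by auto
  have tail: "measure (M n) {t. \<bar>t\<bar> \<ge> y} < e" for n
  proof -
    interpret real_distribution "M n" by (rule M)
    show ?thesis
    proof (cases "n < N")
      case True
      then show ?thesis using measure_abs_ge_le[of y] y y0 unfolding I_def by fastforce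
    next
      case False
      have "measure (M n) {t. \<bar>t\<bar> \<ge> y} \<le> measure (M n) {t. \<bar>t\<bar> \<ge> y0}"
        using y by (intro finite_measure_mono) auto
      with measure_abs_ge_le[of y0] N[of n] y0 False show ?thesis unfolding I_def by fastforce
    qed
  qed
  have "measure (M n) {-y<..y} > 1 - e" for n
  proof -
    interpret real_distribution "M n" by (rule M)
    have "1 = measure (M n) (space (M n))" by (rule prob_space[symmetric])
    also have "\<dots> \<le> measure (M n) ({-y<..y} \<union> {t. \<bar>t\<bar> \<ge> y})"
      by (intro finite_measure_mono) auto
    also have "\<dots> \<le> measure (M n) {-y<..y} + measure (M n) {t. \<bar>t\<bar> \<ge> y}"
      by (intro measure_Un_le) auto
    finally show ?thesis using tail[of n] by linarith
  qed
  moreover have "-y < y" using y y0 by simp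
  ultimately show "\<exists>a b. a < b \<and> (\<forall>n. measure (M n) {a<..b} > 1 - e)" by blast
qed

text \<open>For s >= 0 the function exp (i s \<zeta>) is bounded on the upper half plane, so the
  Poisson formula at the point t + i expresses exp (i s t - s) through its boundary values.
  Integrating over \<open>t\<close> shows that Im G on the line at height 1 determines the
  characteristic function there.\<close>

lemma (in real_distribution) char_eq_integral_cauchy_transform:
  assumes s: "s \<ge> 0"
  shows "char M s = exp (of_real s) *
    (LINT x|lborel. of_real (- Im (cauchy_transform M (of_real x + \<i>)) / pi) * iexp (s * x))"
proof -
  interpret pair_sigma_finite M lborel ..
  let ?f = "\<lambda>t x. of_real (poisson_kernel (of_real t + \<i>) x) * iexp (s * x)"
  have P: "has_bochner_integral lborel (\<lambda>x. ?f t x) (exp (\<i> * of_real s * (of_real t + \<i>)))" for t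
  proof -
    have "has_bochner_integral lborel (\<lambda>x. of_real (poisson_kernel (of_real t + \<i>) x) * exp (\<i> * of_real s * of_real x))
      (exp (\<i> * of_real s * (of_real t + \<i>)))"
    proof (rule poisson_integral_half_plane[where d=1 and C=1 and H="\<lambda>\<zeta>. exp (\<i> * of_real s * \<zeta>)"])
      show "(\<lambda>\<zeta>. exp (\<i> * of_real s * \<zeta>)) holomorphic_on {\<zeta>. - 1 < Im \<zeta>}"
        by (intro holomorphic_intros)
      show "norm (exp (\<i> * of_real s * \<zeta>)) \<le> 1" if "Im \<zeta> \<ge> 0" for \<zeta>
        using that s by simp
    qed auto
    then show ?thesis by (simp add: mult.assoc)
  qed
  have norm_f: "norm (?f t x) = poisson_kernel (of_real t + \<i>) x" for t x
    using poisson_kernel_pos[of "of_real t + \<i>" x] by (simp add: norm_mult)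
  have int: "integrable (M \<Otimes>\<^sub>M lborel) (case_prod ?f)"
  proof (rule Fubini_integrable)
    show "case_prod ?f \<in> borel_measurable (M \<Otimes>\<^sub>M lborel)"
      unfolding poisson_kernel_def by measurable
    have "(LINT x|lborel. norm (case_prod ?f (t, x))) = 1" for t
      using has_bochner_integral_poisson_kernel[of "of_real t + \<i>"]
      by (simp only: norm_f split) (simp add: has_bochner_integral_iff)
    then show "integrable M (\<lambda>t. LINT x|lborel. norm (case_prod ?f (t, x)))" by simp
    show "AE t in M. integrable lborel (\<lambda>x. case_prod ?f (t, x))"
      using P by (simp add: has_bochner_integral_iff)
  qed
  have "(LINT t|M. exp (\<i> * of_real s * (of_real t + \<i>))) = (LINT t|M. (LINT x|lborel. ?f t x))"
    using P by (simp add: has_bochner_integral_iff)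
  also have "\<dots> = (LINT x|lborel. (LINT t|M. ?f t x))"
    by (rule Fubini_integral[OF int, symmetric])
  also have "\<dots> = (LINT x|lborel. of_real (- Im (cauchy_transform M (of_real x + \<i>)) / pi) * iexp (s * x))"
  proof (intro Bochner_Integration.integral_cong refl)
    fix x
    \<comment> \<open>At height 1 the kernel depends only on (t - x)^2, so the roles of pole and
      boundary point can be exchanged, turning the inner integral into Im G.\<close>
    have "poisson_kernel (of_real t + \<i>) x = poisson_kernel (of_real x + \<i>) t" for t
      by (simp add: poisson_kernel_def cmod_power2 power2_commute)
    then have "(LINT t|M. ?f t x) = (LINT t|M. of_real (poisson_kernel (of_real x + \<i>) t) * iexp (s * x))"
      by simp
    also have "\<dots> = (LINT t|M. of_real (poisson_kernel (of_real x + \<i>) t)) * iexp (s * x)"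
      by (rule integral_mult_left_zero)
    also have "(LINT t|M. of_real (poisson_kernel (of_real x + \<i>) t)) = (of_real (LINT t|M. poisson_kernel (of_real x + \<i>) t) :: complex)"
      by (rule integral_complex_of_real)
    finally show "(LINT t|M. ?f t x) = of_real (- Im (cauchy_transform M (of_real x + \<i>)) / pi) * iexp (s * x)"
      by (simp add: Im_cauchy_transform_poisson)
  qed
  also have "(LINT t|M. exp (\<i> * of_real s * (of_real t + \<i>))) = (LINT t|M. exp (- of_real s) * iexp (s * t))"
    by (intro Bochner_Integration.integral_cong refl) (simp add: exp_add[symmetric] algebra_simps)
  also have "\<dots> = exp (- of_real s) * char M s"
    unfolding char_def by (rule integral_mult_right_zero)
  finally show ?thesis by (simp add: exp_minus field_simps)
qed

text \<open>Nonnegative frequencies are settled by the inversion formula, negative ones by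
  conjugation. Working with imaginary parts alone fits the Poisson construction, which delivers only
  these.\<close>

lemma real_distribution_eqI_Im_cauchy_transform:
  assumes M: "real_distribution M" and N: "real_distribution N"
    and eq: "\<And>z. Im z > 0 \<Longrightarrow> Im (cauchy_transform M z) = Im (cauchy_transform N z)"
  shows "M = N"
proof (rule Levy_uniqueness[OF M N ext])
  have pos: "char M s = char N s" if "s \<ge> 0" for s
    using real_distribution.char_eq_integral_cauchy_transform[OF M that]
      real_distribution.char_eq_integral_cauchy_transform[OF N that] eq by simp
  have neg: "char K (- s) = cnj (char K s)" for K :: "real measure" and s
    unfolding char_def Bochner_Integration.integral_cnj[symmetric] by (simp add: exp_cnj)
  show "char M s = char N s" for s
  proof (cases "s \<ge> 0")
    case False
    then show ?thesis using pos[of "- s"] neg[of M "- s"] neg[of N "- s"] by simp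
  qed (rule pos)
qed

section \<open>Weak convergence and existence of measures through Cauchy transforms\<close>

lemma weak_conv_m_cauchy_transform:
  assumes M: "\<And>n. real_distribution (M n)" and N: "real_distribution N"
    and conv: "weak_conv_m M N" and z: "Im z > 0"
  shows "(\<lambda>n. cauchy_transform (M n) z) \<longlonglongrightarrow> cauchy_transform N z"
  unfolding cauchy_transform_def
proof (rule weak_conv_imp_integral_bdd_continuous_conv[OF M N conv])
  show "isCont (\<lambda>t. 1 / (z - of_real t)) x" for x
    using diff_of_real_nonzero[of z x] z by (intro continuous_intros) auto
  show "norm (1 / (z - of_real t)) \<le> 1 / Im z" for t
    by (rule norm_cauchy_kernel_le[OF z])
qed

text \<open>A continuity theorem in the style of Levy: convergence on the imaginary axis gives
  tightness, and uniqueness identifies every subsequential limit with \<open>N\<close>.\<close>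

lemma weak_conv_m_of_cauchy_transform:
  assumes M: "\<And>n. real_distribution (M n)" and N: "real_distribution N"
    and conv: "\<And>z. Im z > 0 \<Longrightarrow> (\<lambda>n. Im (cauchy_transform (M n) z)) \<longlonglongrightarrow> Im (cauchy_transform N z)"
  shows "weak_conv_m M N"
proof (rule tight_subseq_weak_converge[OF M N])
  show "tight M"
  proof (rule tight_of_cauchy_transform[OF M])
    show "(\<lambda>n. Im (cauchy_transform (M n) (\<i> * of_real y))) \<longlonglongrightarrow> Im (cauchy_transform N (\<i> * of_real y))" if "y > 0" for y
      by (rule conv) (use that in simp)
    have "((\<lambda>y. - Re (\<i> * of_real y * cauchy_transform N (\<i> * of_real y))) \<longlongrightarrow> - Re 1) at_top"
      by (intro tendsto_intros real_distribution.tendsto_cauchy_transform_imaginary N)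
    then show "((\<lambda>y. y * Im (cauchy_transform N (\<i> * of_real y))) \<longlongrightarrow> -1) at_top"
      by simp
  qed
  fix s :: "nat \<Rightarrow> nat" and \<nu>
  assume s: "strict_mono s" and \<nu>: "real_distribution \<nu>" and w: "weak_conv_m (M \<circ> s) \<nu>"
  have "\<nu> = N"
  proof (rule real_distribution_eqI_Im_cauchy_transform[OF \<nu> N])
    fix z :: complex assume z: "Im z > 0"
    have "(\<lambda>n. Im (cauchy_transform ((M \<circ> s) n) z)) \<longlonglongrightarrow> Im (cauchy_transform \<nu> z)"
      by (intro tendsto_Im weak_conv_m_cauchy_transform[OF _ \<nu> w z]) (simp add: M)
    moreover have "(\<lambda>n. Im (cauchy_transform ((M \<circ> s) n) z)) \<longlonglongrightarrow> Im (cauchy_transform N z)"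
      using LIMSEQ_subseq_LIMSEQ[OF conv[OF z] s] by (simp add: o_def)
    ultimately show "Im (cauchy_transform \<nu> z) = Im (cauchy_transform N z)"
      by (rule LIMSEQ_unique)
  qed
  with w show "weak_conv_m (M \<circ> s) N" by simp
qed

text \<open>A nonconstant \<open>f\<close> would be an open map, but no nonempty open set lies in
  the real line.\<close>

lemma holomorphic_zero_Im_constant_on:
  assumes f: "f holomorphic_on S" and S: "open S" "connected S"
    and Im: "\<And>z. z \<in> S \<Longrightarrow> Im (f z) = 0"
  shows "f constant_on S"
proof (rule ccontr)
  assume nc: "\<not> ?thesis"
  then have ne: "S \<noteq> {}" by (auto simp: constant_on_def)
  then obtain a where a: "a \<in> S" by auto
  have "open (f ` S)"
    by (rule open_mapping_thm[OF f S S(1) order_refl nc])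
  then obtain e where e: "e > 0" "ball (f a) e \<subseteq> f ` S"
    using a by (meson imageI open_contains_ball)
  have "f a + \<i> * of_real (e / 2) \<in> ball (f a) e"
    using e by (simp add: dist_norm norm_mult)
  with e have "Im (f a + \<i> * of_real (e / 2)) = 0" using Im by fastforce
  with Im[OF a] e show False by simp
qed

text \<open>Shifting \<open>H\<close> upwards by \<epsilon> makes it holomorphic across the real
  line and bounded by 1 / \<epsilon>, so it has a boundary measure. These measures are tight, and a
  subsequential limit has the right imaginary part. The real part can then differ only by a
  constant, which the behaviour at infinity excludes.\<close>

lemma cauchy_transform_exists:
  fixes H :: "complex \<Rightarrow> complex"
  assumes hol: "H holomorphic_on {z. Im z > 0}"
    and bound: "\<And>z. Im z > 0 \<Longrightarrow> norm (H z) \<le> 1 / Im z"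
    and neg: "\<And>z. Im z > 0 \<Longrightarrow> Im (H z) \<le> 0"
    and lim: "((\<lambda>y. \<i> * of_real y * H (\<i> * of_real y)) \<longlongrightarrow> 1) at_top"
  obtains M where "real_distribution M" "\<And>z. Im z > 0 \<Longrightarrow> cauchy_transform M z = H z"
proof -
  define \<epsilon> where "\<epsilon> n = inverse (real (Suc n))" for n
  have \<epsilon>: "\<epsilon> n > 0" for n by (simp add: \<epsilon>_def)
  have "\<exists>M. real_distribution M \<and> (\<forall>z. Im z > 0 \<longrightarrow> Im (cauchy_transform M z) = Im (H (z + \<i> * of_real (\<epsilon> n))))" for n
  proof -
    obtain M where "real_distribution M"
      "\<And>z. Im z > 0 \<Longrightarrow> Im (cauchy_transform M z) = Im (H (z + \<i> * of_real (\<epsilon> n)))"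
    proof (rule cauchy_transform_boundary_measure[of "\<epsilon> n" "\<lambda>z. H (z + \<i> * of_real (\<epsilon> n))" "1 / \<epsilon> n"])
      show "(\<lambda>z. H (z + \<i> * of_real (\<epsilon> n))) holomorphic_on {\<zeta>. - \<epsilon> n < Im \<zeta>}"
        by (rule holomorphic_on_compose_gen[OF _ hol, unfolded o_def]) (auto intro!: holomorphic_intros)
      show "norm (H (\<zeta> + \<i> * of_real (\<epsilon> n))) \<le> 1 / \<epsilon> n" if "Im \<zeta> \<ge> 0" for \<zeta>
        by (rule order_trans[OF bound]) (use that \<epsilon>[of n] in \<open>auto intro!: divide_left_mono mult_pos_pos\<close>)
      show "Im (H (of_real t + \<i> * of_real (\<epsilon> n))) \<le> 0" for t
        by (rule neg) (simp add: \<epsilon>)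
      \<comment> \<open>The hypothesis normalises by the shifted height y + \<epsilon>; this factor
        converts it to the height y.\<close>
      have 1: "((\<lambda>y. y / (y + \<epsilon> n)) \<longlongrightarrow> 1) at_top"
        using \<epsilon>[of n] by real_asymp
      have 2: "((\<lambda>y. \<i> * of_real (y + \<epsilon> n) * H (\<i> * of_real (y + \<epsilon> n))) \<longlongrightarrow> 1) at_top"
        by (rule filterlim_compose[OF lim]) real_asymp
      have "((\<lambda>y. of_real (y / (y + \<epsilon> n)) * (\<i> * of_real (y + \<epsilon> n) * H (\<i> * of_real (y + \<epsilon> n)))) \<longlongrightarrow> of_real 1 * 1) at_top"
        by (intro tendsto_mult tendsto_of_real 1 2)
      moreover have "eventually (\<lambda>y. of_real (y / (y + \<epsilon> n)) * (\<i> * of_real (y + \<epsilon> n) * H (\<i> * of_real (y + \<epsilon> n)))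
        = \<i> * of_real y * H (\<i> * of_real y + \<i> * of_real (\<epsilon> n))) at_top"
        using eventually_gt_at_top[of 0]
      proof eventually_elim
        case (elim y)
        have cancel: "a / b * (\<i> * b * h) = \<i> * a * h" if "b \<noteq> 0" for a b h :: complex
          using that by simp
        have "complex_of_real (y + \<epsilon> n) \<noteq> 0"
          using \<epsilon>[of n] elim by (simp only: of_real_eq_0_iff)
        then have "of_real y / complex_of_real (y + \<epsilon> n) * (\<i> * of_real (y + \<epsilon> n) * h) = \<i> * of_real y * h" for h
          by (rule cancel)
        moreover have "\<i> * complex_of_real (y + \<epsilon> n) = \<i> * of_real y + \<i> * of_real (\<epsilon> n)"
          by (simp add: distrib_left)
        ultimately show ?case by (simp only: of_real_divide)
      qed
      ultimately show "((\<lambda>y. \<i> * of_real y * H (\<i> * of_real y + \<i> * of_real (\<epsilon> n))) \<longlongrightarrow> 1) at_top"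
        by (auto dest: Lim_transform_eventually)
    qed (use \<epsilon> in auto)
    then show ?thesis by blast
  qed
  then obtain Mn where Mn: "\<And>n. real_distribution (Mn n)"
    and ImMn: "\<And>n z. Im z > 0 \<Longrightarrow> Im (cauchy_transform (Mn n) z) = Im (H (z + \<i> * of_real (\<epsilon> n)))"
    by metis
  have conv: "(\<lambda>n. Im (cauchy_transform (Mn n) z)) \<longlonglongrightarrow> Im (H z)" if z: "Im z > 0" for z
  proof -
    have "open {z. Im z > 0}" by (rule open_halfspace_Im_gt)
    then have cont: "isCont H z"
      using holomorphic_on_imp_continuous_on[OF hol] z by (simp add: continuous_on_eq_continuous_at)
    have "(\<lambda>n. z + \<i> * of_real (\<epsilon> n)) \<longlonglongrightarrow> z + \<i> * of_real 0"
      unfolding \<epsilon>_def by (intro tendsto_intros LIMSEQ_inverse_real_of_nat)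
    then have "(\<lambda>n. z + \<i> * of_real (\<epsilon> n)) \<longlonglongrightarrow> z"
      by simp
    from isCont_tendsto_compose[OF cont this]
    have "(\<lambda>n. H (z + \<i> * of_real (\<epsilon> n))) \<longlonglongrightarrow> H z" .
    then show ?thesis unfolding ImMn[OF z] by (rule tendsto_Im)
  qed
  have "tight Mn"
  proof (rule tight_of_cauchy_transform[OF Mn])
    show "(\<lambda>n. Im (cauchy_transform (Mn n) (\<i> * of_real y))) \<longlonglongrightarrow> Im (H (\<i> * of_real y))" if "y > 0" for y
      by (rule conv) (use that in simp)
    have "((\<lambda>y. - Re (\<i> * of_real y * H (\<i> * of_real y))) \<longlongrightarrow> - Re 1) at_top"
      by (intro tendsto_intros lim)
    then show "((\<lambda>y. y * Im (H (\<i> * of_real y))) \<longlongrightarrow> -1) at_top"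
      by simp
  qed
  from tight_imp_convergent_subsubsequence[OF this strict_mono_id]
  obtain r M where r: "strict_mono r" and M: "real_distribution M" and w: "weak_conv_m (Mn \<circ> id \<circ> r) M"
    by auto
  have ImM: "Im (cauchy_transform M z) = Im (H z)" if z: "Im z > 0" for z
  proof (rule LIMSEQ_unique)
    show "(\<lambda>n. Im (cauchy_transform ((Mn \<circ> id \<circ> r) n) z)) \<longlonglongrightarrow> Im (cauchy_transform M z)"
      by (intro tendsto_Im weak_conv_m_cauchy_transform[OF _ M w z]) (simp add: Mn)
    show "(\<lambda>n. Im (cauchy_transform ((Mn \<circ> id \<circ> r) n) z)) \<longlonglongrightarrow> Im (H z)"
      using LIMSEQ_subseq_LIMSEQ[OF conv[OF z] r] by (simp add: o_def)
  qed
  interpret M: real_distribution M by (rule M)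
  have "(\<lambda>z. cauchy_transform M z - H z) constant_on {z. Im z > 0}"
    by (rule holomorphic_zero_Im_constant_on)
      (auto intro!: holomorphic_intros M.cauchy_transform_holomorphic hol convex_connected
        simp: ImM open_halfspace_Im_gt convex_halfspace_Im_gt)
  then obtain c where c: "\<And>z. Im z > 0 \<Longrightarrow> cauchy_transform M z - H z = c"
    unfolding constant_on_def by blast
  have inv: "((\<lambda>y. inverse (of_real y) :: complex) \<longlongrightarrow> of_real 0) at_top"
    unfolding of_real_inverse[symmetric] by (intro tendsto_of_real tendsto_inverse_0_at_top filterlim_ident)
  \<comment> \<open>Both normalised functions tend to 1, so their difference divided by
    \<open>y\<close> tends to 0, yet it equals the constant i c.\<close>
  have "((\<lambda>y. inverse (of_real y) * (\<i> * of_real y * cauchy_transform M (\<i> * of_real y) - \<i> * of_real y * H (\<i> * of_real y)))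
    \<longlongrightarrow> of_real 0 * (1 - 1)) at_top"
    by (intro tendsto_mult tendsto_diff inv M.tendsto_cauchy_transform_imaginary lim)
  moreover have "eventually (\<lambda>y. inverse (of_real y) * (\<i> * of_real y * cauchy_transform M (\<i> * of_real y) - \<i> * of_real y * H (\<i> * of_real y)) = \<i> * c) at_top"
    using eventually_gt_at_top[of 0]
  proof eventually_elim
    case (elim y)
    then show ?case
      using c[of "\<i> * of_real y"] by (simp add: field_simps)
  qed
  ultimately have "((\<lambda>y::real. \<i> * c) \<longlongrightarrow> 0) at_top"
    by (auto dest: Lim_transform_eventually)
  then have "\<i> * c = 0"
    by (simp only: tendsto_const_iff[OF trivial_limit_at_top_linorder])
  then have "cauchy_transform M z = H z" if "Im z > 0" for z
    using c[OF that] by simp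
  with M show thesis by (rule that)
qed

text \<open>The candidate Cauchy transform is G of \<open>\<mu>\<close> composed with F of
  \<open>\<nu>\<close>. Its bound 1 / Im z holds because F raises imaginary parts, and its
  normalisation at infinity follows by applying the large-scale identity limit to the inner and then
  to the outer transform.\<close>

lemma F_transform_compose_exists:
  assumes \<mu>: "real_distribution \<mu>" and \<nu>: "real_distribution \<nu>"
  shows "\<exists>!\<rho>. real_distribution \<rho> \<and>
    (\<forall>z. Im z > 0 \<longrightarrow> F_transform \<rho> z = F_transform \<mu> (F_transform \<nu> z))"
proof -
  interpret \<mu>: real_distribution \<mu> by (rule \<mu>)
  interpret \<nu>: real_distribution \<nu> by (rule \<nu>)
  let ?H = "\<lambda>z. cauchy_transform \<mu> (F_transform \<nu> z)"
  have "((\<lambda>y. F_transform \<nu> (of_real y * \<i>) / of_real y) \<longlongrightarrow> \<i>) at_top"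
    by (rule tendsto_rescaled_F_transform_id)
      (auto simp: \<nu> \<nu>.dispersion_tendsto_0 eventually_gt_at_top)
  then have "((\<lambda>y. F_transform \<mu> (of_real y * (F_transform \<nu> (of_real y * \<i>) / of_real y)) / of_real y) \<longlongrightarrow> \<i>) at_top"
    by (intro tendsto_rescaled_F_transform_id[where M = "\<lambda>_. \<mu>" and B = "\<lambda>y. y"])
      (auto simp: \<mu> \<mu>.dispersion_tendsto_0 eventually_gt_at_top)
  then have "((\<lambda>y. \<i> / (F_transform \<mu> (of_real y * (F_transform \<nu> (of_real y * \<i>) / of_real y)) / of_real y)) \<longlongrightarrow> \<i> / \<i>) at_top"
    by (intro tendsto_divide tendsto_const) auto
  then have lim1: "((\<lambda>y. \<i> / (F_transform \<mu> (of_real y * (F_transform \<nu> (of_real y * \<i>) / of_real y)) / of_real y)) \<longlongrightarrow> 1) at_top"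
    by simp
  have lim: "((\<lambda>y. \<i> * of_real y * ?H (\<i> * of_real y)) \<longlongrightarrow> 1) at_top"
  proof (rule Lim_transform_eventually[OF lim1])
    show "\<forall>\<^sub>F y in at_top. \<i> / (F_transform \<mu> (of_real y * (F_transform \<nu> (of_real y * \<i>) / of_real y)) / of_real y)
      = \<i> * of_real y * ?H (\<i> * of_real y)"
      using eventually_gt_at_top[of 0]
      by eventually_elim (simp add: mult.commute, simp add: F_transform_def)
  qed
  have "?H holomorphic_on {z. Im z > 0}"
    by (rule holomorphic_on_compose_gen[OF \<nu>.F_transform_holomorphic \<mu>.cauchy_transform_holomorphic, unfolded o_def])
      (auto simp: \<nu>.Im_F_transform_pos)
  moreover have "norm (?H z) \<le> 1 / Im z" if z: "Im z > 0" for z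
    by (rule order_trans[OF \<mu>.norm_cauchy_transform_le])
      (use z \<nu>.Im_F_transform_ge[OF z] \<nu>.Im_F_transform_pos[OF z] in \<open>auto intro!: divide_left_mono\<close>)
  moreover have "Im (?H z) \<le> 0" if z: "Im z > 0" for z
    by (intro less_imp_le \<mu>.Im_cauchy_transform_neg \<nu>.Im_F_transform_pos z)
  ultimately obtain \<rho> where \<rho>: "real_distribution \<rho>" "\<And>z. Im z > 0 \<Longrightarrow> cauchy_transform \<rho> z = ?H z"
    using cauchy_transform_exists[OF _ _ _ lim] by blast
  show ?thesis
  proof (rule ex1I[of _ \<rho>])
    show "real_distribution \<rho> \<and> (\<forall>z. Im z > 0 \<longrightarrow> F_transform \<rho> z = F_transform \<mu> (F_transform \<nu> z))"
      using \<rho> by (simp add: F_transform_def)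
    fix \<sigma> assume \<sigma>: "real_distribution \<sigma> \<and> (\<forall>z. Im z > 0 \<longrightarrow> F_transform \<sigma> z = F_transform \<mu> (F_transform \<nu> z))"
    have "cauchy_transform \<sigma> z = ?H z" if "Im z > 0" for z
      using \<sigma> that by (metis F_transform_def div_by_1 divide_divide_eq_right mult_1)
    then show "\<sigma> = \<rho>"
      using \<sigma> \<rho> by (intro real_distribution_eqI_Im_cauchy_transform) auto
  qed
qed

lemma
  assumes "real_distribution \<mu>" "real_distribution \<nu>"
  shows real_distribution_mono_conv: "real_distribution (mono_conv \<mu> \<nu>)"
    and F_transform_mono_conv: "Im z > 0 \<Longrightarrow> F_transform (mono_conv \<mu> \<nu>) z = F_transform \<mu> (F_transform \<nu> z)"
  using theI'[OF F_transform_compose_exists[OF assms]] unfolding mono_conv_def[symmetric] by auto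

section \<open>The arc-sine law\<close>

definition arcsine_density :: "real \<Rightarrow> real" where
  "arcsine_density x = (if \<bar>x\<bar> < sqrt 2 then 1 / (pi * sqrt (2 - x\<^sup>2)) else 0)"

lemma arcsine_density_nonneg: "arcsine_density x \<ge> 0"
proof -
  have "x\<^sup>2 \<le> 2" if "\<bar>x\<bar> < sqrt 2"
    using that by (metis abs_ge_zero less_imp_le power2_abs power_mono real_sqrt_pow2 zero_le_numeral)
  then show ?thesis by (simp add: arcsine_density_def)
qed

lemma borel_measurable_arcsine_density [measurable]: "arcsine_density \<in> borel_measurable borel"
  unfolding arcsine_density_def[abs_def] by measurable

lemma arcsine_law_eq: "arcsine_law = density lborel (\<lambda>x. ennreal (arcsine_density x))"
  by (simp add: arcsine_law_def arcsine_density_def)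

text \<open>The densities in question blow up at the endpoints; nonnegativity lets one-sided limits
  of an antiderivative give integrability together with the value.\<close>

lemma FTC_sqrt2_interval:
  fixes f F :: "real \<Rightarrow> real"
  assumes F: "\<And>x. \<bar>x\<bar> < sqrt 2 \<Longrightarrow> (F has_real_derivative f x) (at x)"
    and cont: "\<And>x. \<bar>x\<bar> < sqrt 2 \<Longrightarrow> isCont f x"
    and nonneg: "\<And>x. \<bar>x\<bar> < sqrt 2 \<Longrightarrow> f x \<ge> 0"
    and lim: "(F \<longlongrightarrow> A) (at_right (- sqrt 2))" "(F \<longlongrightarrow> B) (at_left (sqrt 2))"
  shows "has_bochner_integral lborel (\<lambda>x. if \<bar>x\<bar> < sqrt 2 then f x else 0) (B - A)"
proof -
  let ?a = "ereal (- sqrt 2)" and ?b = "ereal (sqrt 2)"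
  have i: "set_integrable lborel (einterval ?a ?b) f" "(LBINT x=?a..?b. f x) = B - A"
    by (rule interval_integral_FTC_nonneg[where F=F];
        (use assms in \<open>auto simp: ereal_tendsto_simps1 abs_less_iff\<close>))+
  have eq: "indicator (einterval ?a ?b) x *\<^sub>R f x = (if \<bar>x\<bar> < sqrt 2 then f x else 0)" for x
    by (auto simp: indicator_def einterval_def abs_less_iff)
  have "?a \<le> ?b" by simp
  then show ?thesis
    using i unfolding interval_lebesgue_integral_def set_lebesgue_integral_def set_integrable_def eq
    by (simp add: has_bochner_integral_iff)
qed

lemma real_distribution_arcsine: "real_distribution arcsine_law"
proof -
  have "has_bochner_integral lborel arcsine_density (1 / 2 - (- 1 / 2))"
    unfolding arcsine_density_def
  proof (rule FTC_sqrt2_interval[where F = "\<lambda>x. arcsin (x / sqrt 2) / pi"])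
    fix x :: real assume x: "\<bar>x\<bar> < sqrt 2"
    then have x2: "x\<^sup>2 < 2"
      by (metis abs_ge_zero power2_abs power_strict_mono real_sqrt_pow2 zero_le_numeral zero_less_numeral)
    have s: "sqrt (2 - x\<^sup>2) = sqrt 2 * sqrt (1 - (x / sqrt 2)\<^sup>2)"
      by (simp add: real_sqrt_mult[symmetric] power_divide right_diff_distrib)
    have "-1 < x / sqrt 2" "x / sqrt 2 < 1"
      using x by (auto simp: abs_less_iff field_simps)
    then have "((\<lambda>x. arcsin (x / sqrt 2) / pi) has_real_derivative inverse (sqrt (1 - (x / sqrt 2)\<^sup>2)) * (1 / sqrt 2) / pi) (at x)"
      by (intro DERIV_cdivide DERIV_chain2[OF DERIV_arcsin]) (auto intro!: derivative_eq_intros)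
    then show "((\<lambda>x. arcsin (x / sqrt 2) / pi) has_real_derivative 1 / (pi * sqrt (2 - x\<^sup>2))) (at x)"
      unfolding s by (simp add: divide_inverse mult_ac)
    show "isCont (\<lambda>x. 1 / (pi * sqrt (2 - x\<^sup>2))) x"
      using x2 by (intro continuous_intros) auto
    show "1 / (pi * sqrt (2 - x\<^sup>2)) \<ge> 0" using x2 by simp
  next
    have c: "continuous_on {- sqrt 2..sqrt 2} (\<lambda>x. arcsin (x / sqrt 2) / pi)"
      by (intro continuous_intros) (auto simp: field_simps)
    have "((\<lambda>x. arcsin (x / sqrt 2) / pi) \<longlongrightarrow> arcsin (- sqrt 2 / sqrt 2) / pi) (at_right (- sqrt 2))"
      using continuous_on_Icc_at_rightD[OF c] by simp
    then show "((\<lambda>x. arcsin (x / sqrt 2) / pi) \<longlongrightarrow> - 1 / 2) (at_right (- sqrt 2))"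
      by simp
    have "((\<lambda>x. arcsin (x / sqrt 2) / pi) \<longlongrightarrow> arcsin (sqrt 2 / sqrt 2) / pi) (at_left (sqrt 2))"
      using continuous_on_Icc_at_leftD[OF c] by simp
    then show "((\<lambda>x. arcsin (x / sqrt 2) / pi) \<longlongrightarrow> 1 / 2) (at_left (sqrt 2))"
      by simp
  qed
  then have "integral\<^sup>N lborel (\<lambda>t. ennreal (arcsine_density t)) = 1"
    using arcsine_density_nonneg by (simp add: has_bochner_integral_iff nn_integral_eq_integral)
  then show ?thesis
    unfolding arcsine_law_eq
    by (auto intro!: real_distribution.intro prob_spaceI real_distribution_axioms.intro simp: emeasure_density)
qed

text \<open>The antiderivative is
  \<open>arctan (\<surd>(y\<^sup>2 + 2) x / (y \<surd>(2 - x\<^sup>2))) / (\<pi> \<surd>(y\<^sup>2 + 2))\<close>.\<close>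

lemma has_bochner_integral_arcsine_poisson:
  assumes y: "y > 0"
  shows "has_bochner_integral lborel (\<lambda>x. arcsine_density x * (y / (y\<^sup>2 + x\<^sup>2))) (1 / sqrt (y\<^sup>2 + 2))"
proof -
  define c where "c = sqrt (y\<^sup>2 + 2)"
  have c: "c > 0" "c\<^sup>2 = y\<^sup>2 + 2"
    by (auto simp: c_def add_nonneg_pos intro!: real_sqrt_pow2)
  define F where "F = (\<lambda>x. arctan (c / y * (x / sqrt (2 - x\<^sup>2))) / (pi * c))"
  have x2: "x\<^sup>2 < 2" if "\<bar>x\<bar> < sqrt 2" for x :: real
    using that by (metis abs_ge_zero power2_abs power_strict_mono real_sqrt_pow2 zero_le_numeral zero_less_numeral)
  have "has_bochner_integral lborel
    (\<lambda>x. if \<bar>x\<bar> < sqrt 2 then y / (pi * sqrt (2 - x\<^sup>2) * (y\<^sup>2 + x\<^sup>2)) else 0) (1 / (2 * c) - - (1 / (2 * c)))"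
  proof (rule FTC_sqrt2_interval[where F = F])
    fix x :: real assume "\<bar>x\<bar> < sqrt 2"
    note x = x2[OF this]
    define s where "s = sqrt (2 - x\<^sup>2)"
    have s: "s > 0" "s\<^sup>2 = 2 - x\<^sup>2" using x by (auto simp: s_def)
    have pos: "y\<^sup>2 + x\<^sup>2 > 0" using y by (intro add_pos_nonneg) auto
    have d1: "((\<lambda>x. x / sqrt (2 - x\<^sup>2)) has_real_derivative 2 / s ^ 3) (at x)"
    proof -
      have "((\<lambda>x. x / sqrt (2 - x\<^sup>2)) has_real_derivative (s - x * (- (2 * x) * (inverse s / 2))) / (s * s)) (at x)"
        using x s unfolding s_def by (auto intro!: derivative_eq_intros)
      moreover have "(s - x * (- (2 * x) * (inverse s / 2))) / (s * s) = 2 / s ^ 3"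
      proof -
        have "(s - x * (- (2 * x) * (inverse s / 2))) / (s * s) = (s\<^sup>2 + x\<^sup>2) / s ^ 3"
          using s(1) by (simp add: field_simps power2_eq_square power3_eq_cube)
        then show ?thesis by (simp add: s(2))
      qed
      ultimately show ?thesis by simp
    qed
    have "(F has_real_derivative (inverse (1 + (c / y * (x / s))\<^sup>2) * (c / y * (2 / s ^ 3))) / (pi * c)) (at x)"
      unfolding F_def s_def
      by (rule DERIV_cdivide, rule DERIV_chain2[OF DERIV_arctan], rule DERIV_cmult, rule d1[unfolded s_def])
    moreover have "(inverse (1 + (c / y * (x / s))\<^sup>2) * (c / y * (2 / s ^ 3))) / (pi * c) = y / (pi * s * (y\<^sup>2 + x\<^sup>2))"
    proof -
      have "1 + (c / y * (x / s))\<^sup>2 = (y\<^sup>2 * s\<^sup>2 + c\<^sup>2 * x\<^sup>2) / (y\<^sup>2 * s\<^sup>2)"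
        using y s(1) by (simp add: field_simps power_mult_distrib power_divide)
      \<comment> \<open>Here the choice c^2 = y^2 + 2 pays off: combined with s^2 = 2 - x^2 the
        mixed terms cancel, leaving twice the Poisson denominator.\<close>
      also have "y\<^sup>2 * s\<^sup>2 + c\<^sup>2 * x\<^sup>2 = 2 * (y\<^sup>2 + x\<^sup>2)"
        unfolding s(2) c(2) by (simp add: algebra_simps)
      finally show ?thesis
        using y s(1) c(1) pos by (simp add: divide_simps power2_eq_square power3_eq_cube)
    qed
    ultimately show "(F has_real_derivative y / (pi * sqrt (2 - x\<^sup>2) * (y\<^sup>2 + x\<^sup>2))) (at x)"
      by (simp add: s_def)
    show "isCont (\<lambda>x. y / (pi * sqrt (2 - x\<^sup>2) * (y\<^sup>2 + x\<^sup>2))) x"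
      using x pos by (intro continuous_intros) auto
    show "y / (pi * sqrt (2 - x\<^sup>2) * (y\<^sup>2 + x\<^sup>2)) \<ge> 0"
      using x pos y by simp
  next
    have q: "c / y > 0" using c y by simp
    have l1: "filterlim (\<lambda>x. c / y * (x / sqrt (2 - x\<^sup>2))) at_top (at_left (sqrt 2))"
    proof (rule filterlim_tendsto_pos_mult_at_top[OF tendsto_const q])
      have "((\<lambda>x. sqrt (2 - x\<^sup>2)) \<longlongrightarrow> sqrt (2 - (sqrt 2)\<^sup>2)) (at_left (sqrt 2))"
        by (intro tendsto_intros)
      moreover have "eventually (\<lambda>x. 0 < sqrt (2 - x\<^sup>2)) (at_left (sqrt 2))"
      proof -
        have "eventually (\<lambda>x. x \<in> {0<..<sqrt 2}) (at_left (sqrt 2))"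
          by (rule eventually_at_left_real) simp
        then show ?thesis by eventually_elim (use x2 in auto)
      qed
      ultimately have "filterlim (\<lambda>x. sqrt (2 - x\<^sup>2)) (at_right 0) (at_left (sqrt 2))"
        by (auto simp: filterlim_at elim: eventually_mono)
      then show "filterlim (\<lambda>x. x / sqrt (2 - x\<^sup>2)) at_top (at_left (sqrt 2))"
        unfolding divide_inverse
        by (intro filterlim_tendsto_pos_mult_at_top[where c = "sqrt 2"] filterlim_compose[OF filterlim_inverse_at_top_right] tendsto_intros) auto
    qed
    have "(F \<longlongrightarrow> (pi / 2) / (pi * c)) (at_left (sqrt 2))"
      unfolding F_def using c by (intro tendsto_divide filterlim_compose[OF tendsto_arctan_at_top l1] tendsto_const) auto
    then show L: "(F \<longlongrightarrow> 1 / (2 * c)) (at_left (sqrt 2))"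
      using c by simp
    \<comment> \<open>Oddness transfers the limit at the right endpoint to the left one.\<close>
    have "F (- x) = - F x" for x by (simp add: F_def arctan_minus)
    then have "F = (\<lambda>x. - F (- x))" by (intro ext) simp
    moreover have "((\<lambda>x. - F (- x)) \<longlongrightarrow> - (1 / (2 * c))) (at_right (- sqrt 2))"
      by (intro tendsto_minus filterlim_compose[OF L])
        (simp only: filterlim_def at_left_minus[of "sqrt 2"] order_refl)
    ultimately show "(F \<longlongrightarrow> - (1 / (2 * c))) (at_right (- sqrt 2))" by simp
  qed
  moreover have "(if \<bar>x\<bar> < sqrt 2 then y / (pi * sqrt (2 - x\<^sup>2) * (y\<^sup>2 + x\<^sup>2)) else 0) = arcsine_density x * (y / (y\<^sup>2 + x\<^sup>2))" for x
    by (simp add: arcsine_density_def)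
  moreover have "1 / (2 * c) - - (1 / (2 * c)) = 1 / c" by simp
  ultimately show ?thesis by (simp add: c_def)
qed

text \<open>On the imaginary axis Im G is a Poisson integral, known from the explicit
  antiderivative, while Re G vanishes because the density is even.\<close>

lemma F_transform_arcsine_imaginary:
  assumes y: "y > 0"
  shows "F_transform arcsine_law (\<i> * of_real y) = \<i> * of_real (sqrt (y\<^sup>2 + 2))"
proof -
  interpret real_distribution arcsine_law by (rule real_distribution_arcsine)
  let ?z = "\<i> * of_real y"
  have z: "Im ?z > 0" using y by simp
  have "(LINT t|arcsine_law. poisson_kernel ?z t) = (LINT t|lborel. arcsine_density t * poisson_kernel ?z t)"
    unfolding arcsine_law_eq using arcsine_density_nonneg by (subst integral_real_density) auto
  also have "\<dots> = (LINT t|lborel. arcsine_density t * (y / (y\<^sup>2 + t\<^sup>2)) / pi)"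
    by (simp add: poisson_kernel_imaginary mult.commute)
  also have "\<dots> = 1 / sqrt (y\<^sup>2 + 2) / pi"
    using has_bochner_integral_divide_zero[OF has_bochner_integral_arcsine_poisson[OF y]]
    by (simp only: has_bochner_integral_iff)
  finally have Im: "Im (cauchy_transform arcsine_law ?z) = - 1 / sqrt (y\<^sup>2 + 2)"
    by (simp add: Im_cauchy_transform_poisson[OF z])
  have even: "arcsine_density (- t) = arcsine_density t" for t
    by (simp add: arcsine_density_def)
  have "Re (cauchy_transform arcsine_law ?z) = (LINT t|arcsine_law. Re (1 / (?z - of_real t)))"
    unfolding cauchy_transform_def by (rule integral_Re[symmetric]) (rule integrable_cauchy_kernel[OF z])
  also have "\<dots> = (LINT t|arcsine_law. - t / (y\<^sup>2 + t\<^sup>2))"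
    by (simp add: Re_divide add.commute)
  also have "\<dots> = (LINT t|lborel. arcsine_density t * (- t / (y\<^sup>2 + t\<^sup>2)))" (is "_ = ?I")
    unfolding arcsine_law_eq using arcsine_density_nonneg by (subst integral_real_density) auto
  also have "?I = - ?I"
    by (subst lborel_integral_real_affine[where c="-1" and t=0]) (simp_all add: even)
  then have "?I = 0" by simp
  finally have "Re (cauchy_transform arcsine_law ?z) = 0" .
  with Im have "cauchy_transform arcsine_law ?z = - \<i> / of_real (sqrt (y\<^sup>2 + 2))"
    by (simp add: complex_eq_iff)
  moreover have "complex_of_real (sqrt (y\<^sup>2 + 2)) \<noteq> 0"
    by (simp add: add_nonneg_eq_0_iff)
  ultimately show ?thesis
    unfolding F_transform_def by simp
qed

section \<open>Monotone convolution semigroups\<close>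

lemma cauchy_transform_eq_F_transform: "cauchy_transform M z = 1 / F_transform M z"
  by (simp add: F_transform_def)

lemma real_distribution_return: "real_distribution (return borel c)"
  by (auto intro!: real_distribution.intro prob_space_return real_distribution_axioms.intro)

lemma F_transform_return: "Im z > 0 \<Longrightarrow> F_transform (return borel c) z = z - of_real c"
  by (simp add: F_transform_def cauchy_transform_def integral_return)

text \<open>Test integrals along a real parameter are checked on arbitrary sequences tending to
  infinity, where the sequential continuity theorem applies.\<close>

lemma weak_conv_along_at_topI:
  fixes M :: "real \<Rightarrow> real measure"
  assumes M: "\<And>t. t > 0 \<Longrightarrow> real_distribution (M t)" and N: "real_distribution N"
    and conv: "\<And>z. Im z > 0 \<Longrightarrow> ((\<lambda>t. F_transform (M t) z) \<longlongrightarrow> F_transform N z) at_top"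
  shows "weak_conv_along M N at_top"
  unfolding weak_conv_along_def
proof (intro allI impI tendsto_at_topI_sequentially)
  fix f :: "real \<Rightarrow> real" and X :: "nat \<Rightarrow> real"
  assume f: "continuous_on UNIV f \<and> bounded (range f)" and X: "filterlim X at_top sequentially"
  \<comment> \<open>The cut-off at 1 makes every term a measure with positive parameter; it alters
    only finitely many terms.\<close>
  define Y where "Y n = max (X n) 1" for n
  have YX: "eventually (\<lambda>n. Y n = X n) sequentially"
    using filterlim_at_top[THEN iffD1, OF X, rule_format, of 1] by eventually_elim (simp add: Y_def)
  have Y: "filterlim Y at_top sequentially"
    by (rule filterlim_at_top_mono[OF X]) (simp add: Y_def)
  have MY: "real_distribution (M (Y n))" for n
    by (rule M) (simp add: Y_def)
  have "weak_conv_m (\<lambda>n. M (Y n)) N"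
  proof (rule weak_conv_m_of_cauchy_transform[OF MY N])
    fix z :: complex assume z: "Im z > 0"
    have "F_transform N z \<noteq> 0"
      using real_distribution.Im_F_transform_pos[OF N z] by auto
    then show "(\<lambda>n. Im (cauchy_transform (M (Y n)) z)) \<longlonglongrightarrow> Im (cauchy_transform N z)"
      unfolding cauchy_transform_eq_F_transform
      by (intro tendsto_Im tendsto_divide tendsto_const filterlim_compose[OF conv[OF z] Y])
  qed
  then have "weak_conv_along (\<lambda>n. M (Y n)) N sequentially"
    by (simp add: weak_conv_along_sequentially MY N)
  with f have "(\<lambda>n. LINT x|M (Y n). f x) \<longlonglongrightarrow> (LINT x|N. f x)"
    by (simp add: weak_conv_along_def)
  moreover have "eventually (\<lambda>n. (LINT x|M (Y n). f x) = (LINT x|M (X n). f x)) sequentially"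
    using YX by eventually_elim simp
  ultimately show "(\<lambda>n. LINT x|M (X n). f x) \<longlonglongrightarrow> (LINT x|N. f x)"
    by (rule Lim_transform_eventually)
qed

locale monotone_semigroup =
  fixes \<mu> :: "real \<Rightarrow> real measure"
  assumes semigroup: "mono_conv_semigroup \<mu>"
begin

lemma real_distribution_semigroup: "t \<ge> 0 \<Longrightarrow> real_distribution (\<mu> t)"
  using semigroup by (simp add: mono_conv_semigroup_def)

lemma mono_conv_semigroup_add: "s \<ge> 0 \<Longrightarrow> t \<ge> 0 \<Longrightarrow> mono_conv (\<mu> s) (\<mu> t) = \<mu> (s + t)"
  using semigroup by (simp add: mono_conv_semigroup_def)

lemma F_transform_add:
  "s \<ge> 0 \<Longrightarrow> t \<ge> 0 \<Longrightarrow> Im z > 0 \<Longrightarrow>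
    F_transform (\<mu> (s + t)) z = F_transform (\<mu> s) (F_transform (\<mu> t) z)"
  by (simp add: F_transform_mono_conv real_distribution_semigroup flip: mono_conv_semigroup_add)

lemma F_transform_0: "Im z > 0 \<Longrightarrow> F_transform (\<mu> 0) z = z"
  using semigroup by (simp add: mono_conv_semigroup_def F_transform_return)

lemma Im_F_transform_semigroup: "t \<ge> 0 \<Longrightarrow> Im z > 0 \<Longrightarrow> Im (F_transform (\<mu> t) z) > 0"
  using real_distribution.Im_F_transform_pos real_distribution_semigroup by blast

lemma mono_conv_power_semigroup: "t \<ge> 0 \<Longrightarrow> mono_conv_power n (\<mu> t) = \<mu> (real n * t)"
proof (induction n)
  case 0
  then show ?case using semigroup by (simp add: mono_conv_power_def mono_conv_semigroup_def)
next
  case (Suc n)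
  have "mono_conv_power (Suc n) (\<mu> t) = mono_conv (\<mu> t) (mono_conv_power n (\<mu> t))"
    by (simp add: mono_conv_power_def)
  with Suc show ?case by (simp add: mono_conv_semigroup_add algebra_simps)
qed

section \<open>Uniform negligibility of bounded times at large scales\<close>

definition disp :: "real \<Rightarrow> real \<Rightarrow> real" where
  "disp r B = real_distribution.dispersion (\<mu> r) B"

lemma continuous_on_disp: "B > 0 \<Longrightarrow> continuous_on {0..} (\<lambda>r. disp r B)"
  unfolding continuous_on_def
proof
  fix r :: real assume B: "B > 0" and r: "r \<in> {0..}"
  have "weak_conv_along \<mu> (\<mu> r) (at r within {0..})"
    using semigroup r by (simp add: mono_conv_semigroup_def)
  moreover have "continuous_on UNIV (\<lambda>t. min 1 (\<bar>t\<bar> / B))"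
    using B by (intro continuous_intros) auto
  moreover have "bounded (range (\<lambda>t. min 1 (\<bar>t\<bar> / B)))"
    using B by (intro boundedI[of _ 1]) auto
  ultimately have "((\<lambda>i. LINT x|\<mu> i. min 1 (\<bar>x\<bar> / B)) \<longlongrightarrow> (LINT x|\<mu> r. min 1 (\<bar>x\<bar> / B))) (at r within {0..})"
    by (simp add: weak_conv_along_def)
  then have "((\<lambda>i. LINT x|\<mu> i. min 1 (\<bar>x\<bar> / B)) \<longlongrightarrow> disp r B) (at r within {0..})"
    using r by (simp add: disp_def real_distribution.dispersion_def real_distribution_semigroup)
  then show "((\<lambda>r. disp r B) \<longlongrightarrow> disp r B) (at r within {0..})"
    by (rule Lim_transform_eventually)
      (auto simp: eventually_at_filter disp_def real_distribution.dispersion_def real_distribution_semigroup)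
qed

text \<open>A Dini argument: the dispersion is continuous in time on [0, T] and decreases to 0 as
  the scale grows. Bad times at growing scales would accumulate at some \<open>l\<close>; fixing a
  scale \<open>C\<close> that is good for \<open>l\<close>, continuity makes nearby times good at
  \<open>C\<close>, hence at every larger scale.\<close>

lemma disp_uniform:
  assumes e: "e > 0"
  shows "eventually (\<lambda>B. \<forall>r\<in>{0..T}. disp r B < e) at_top"
proof (rule ccontr)
  assume "\<not> ?thesis"
  then have "\<exists>B r. B \<ge> real n + 1 \<and> r \<in> {0..T} \<and> disp r B \<ge> e" for n
    unfolding eventually_at_top_linorder not_ex not_all not_imp Bex_def Ball_def not_less by blast
  then obtain B r where B: "\<And>n. B n \<ge> real n + 1" and r: "\<And>n. r n \<in> {0..T}"
    and ge: "\<And>n. disp (r n) (B n) \<ge> e"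
    by metis
  obtain l s where l: "l \<in> {0..T}" and s: "strict_mono s" and lim: "(r \<circ> s) \<longlonglongrightarrow> l"
    using compact_Icc[of 0 T] r unfolding compact_def by blast
  interpret real_distribution "\<mu> l" using l by (intro real_distribution_semigroup) simp
  have "eventually (\<lambda>C. disp l C < e \<and> C > 0) at_top"
    using dispersion_tendsto_0 e unfolding disp_def
    by (intro eventually_conj eventually_gt_at_top) (auto dest: order_tendstoD)
  from eventually_happens'[OF trivial_limit_at_top_linorder this]
  obtain C where C: "C > 0" "disp l C < e" by auto
  have "(\<lambda>n. disp ((r \<circ> s) n) C) \<longlonglongrightarrow> disp l C"
    by (rule continuous_on_tendsto_compose[OF continuous_on_disp[OF C(1)] lim])
      (use l r in auto)
  then have "eventually (\<lambda>n. disp (r (s n)) C < e) sequentially"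
    using C(2) by (auto dest: order_tendstoD)
  moreover have "eventually (\<lambda>n. real n \<ge> C) sequentially"
    using filterlim_real_sequentially by (simp add: filterlim_at_top)
  ultimately have "eventually (\<lambda>n. False) sequentially"
  proof eventually_elim
    case (elim n)
    have "C \<le> B (s n)"
      using elim B[of "s n"] seq_suble[OF s, of n] by linarith
    then have "disp (r (s n)) (B (s n)) \<le> disp (r (s n)) C"
      unfolding disp_def using r C by (intro real_distribution.dispersion_antimono real_distribution_semigroup) auto
    with elim ge[of "s n"] show ?case by simp
  qed
  then show False by simp
qed

lemma tendsto_F_transform_remainder:
  assumes r: "eventually (\<lambda>i. r i \<in> {0..T}) \<F>" and B: "filterlim B at_top \<F>"
    and q: "(q \<longlongrightarrow> u) \<F>" "Im u > 0"
  shows "((\<lambda>i. F_transform (\<mu> (r i)) (of_real (B i) * q i) / of_real (B i)) \<longlongrightarrow> u) \<F>"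
proof (rule tendsto_rescaled_F_transform_id[OF _ _ _ q])
  show rd: "eventually (\<lambda>i. real_distribution (\<mu> (r i))) \<F>"
    using r by eventually_elim (simp add: real_distribution_semigroup)
  show B0: "eventually (\<lambda>i. B i > 0) \<F>"
    using B by (simp add: filterlim_at_top_dense)
  show "((\<lambda>i. real_distribution.dispersion (\<mu> (r i)) (B i)) \<longlongrightarrow> 0) \<F>"
  proof (rule order_tendstoI)
    fix a :: real assume "a < 0"
    show "eventually (\<lambda>i. a < real_distribution.dispersion (\<mu> (r i)) (B i)) \<F>"
      using rd B0
    proof eventually_elim
      case (elim i)
      from real_distribution.dispersion_nonneg[OF this] \<open>a < 0\<close> show ?case by simp
    qed
  next
    fix a :: real assume "a > 0"
    from eventually_compose_filterlim[OF disp_uniform[OF this] B] r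
    show "eventually (\<lambda>i. real_distribution.dispersion (\<mu> (r i)) (B i) < a) \<F>"
      by eventually_elim (auto simp: disp_def)
  qed
qed

text \<open>The extra time acts outermost, F_t = F_(t - s) o F_s, on points that already converge
  after rescaling. As the extra times stay in [0, T], their transforms tend to the identity at that
  scale.\<close>

lemma tendsto_F_transform_shift:
  assumes s: "eventually (\<lambda>i. 0 \<le> s i \<and> s i \<le> t i \<and> t i \<le> s i + T) \<F>"
    and B: "filterlim B at_top \<F>"
    and z: "Im z > 0"
    and lim: "((\<lambda>i. F_transform (\<mu> (s i)) (of_real (B i) * z) / of_real (B i)) \<longlongrightarrow> w) \<F>" "Im w > 0"
  shows "((\<lambda>i. F_transform (\<mu> (t i)) (of_real (B i) * z) / of_real (B i)) \<longlongrightarrow> w) \<F>"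
proof -
  have "eventually (\<lambda>i. t i - s i \<in> {0..T}) \<F>"
    using s by eventually_elim auto
  note 1 = tendsto_F_transform_remainder[OF this B lim]
  have "eventually (\<lambda>i. B i > 0) \<F>"
    using B by (simp add: filterlim_at_top_dense)
  with s have "eventually (\<lambda>i. F_transform (\<mu> (t i - s i)) (of_real (B i) *
      (F_transform (\<mu> (s i)) (of_real (B i) * z) / of_real (B i))) / of_real (B i)
    = F_transform (\<mu> (t i)) (of_real (B i) * z) / of_real (B i)) \<F>"
  proof eventually_elim
    case (elim i)
    then show ?case
      using z F_transform_add[of "t i - s i" "s i" "of_real (B i) * z"] by simp
  qed
  from Lim_transform_eventually[OF 1 this] show ?thesis .
qed

lemma weak_conv_along_rescaledI:
  assumes N: "real_distribution N" and B: "\<And>t. t > 0 \<Longrightarrow> B t > 0"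
    and conv: "\<And>z. Im z > 0 \<Longrightarrow>
      ((\<lambda>t. F_transform (\<mu> t) (of_real (B t) * z) / of_real (B t)) \<longlongrightarrow> F_transform N z) at_top"
  shows "weak_conv_along (\<lambda>t. dilation (1 / B t) (\<mu> t)) N at_top"
proof (rule weak_conv_along_at_topI[OF _ N])
  show "real_distribution (dilation (1 / B t) (\<mu> t))" if "t > 0" for t
    using that by (intro real_distribution.real_distribution_dilation real_distribution_semigroup) simp
  fix z :: complex assume z: "Im z > 0"
  have "eventually (\<lambda>t. F_transform (\<mu> t) (of_real (B t) * z) / of_real (B t)
    = F_transform (dilation (1 / B t) (\<mu> t)) z) at_top"
    using eventually_gt_at_top[of 0]
    by eventually_elim (simp add: real_distribution.F_transform_dilation real_distribution_semigroup B)
  from Lim_transform_eventually[OF conv[OF z] this]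
  show "((\<lambda>t. F_transform (dilation (1 / B t) (\<mu> t)) z) \<longlongrightarrow> F_transform N z) at_top" .
qed

end

section \<open>The law of large numbers\<close>

context real_distribution
begin

text \<open>The first-moment analogue of \<open>dispersion\<close>: dominated by |t|, it vanishes at
  infinity exactly by dominated convergence when the mean exists.\<close>

definition mean_tail :: "real \<Rightarrow> real" where
  "mean_tail B = (LINT t|M. \<bar>t\<bar> * min 1 (\<bar>t\<bar> / B))"

lemma mean_tail_tendsto_0:
  assumes "integrable M (\<lambda>t. t)"
  shows "(mean_tail \<longlongrightarrow> 0) at_top"
proof -
  have "((\<lambda>B. LINT t|M. \<bar>t\<bar> * min 1 (\<bar>t\<bar> / B)) \<longlongrightarrow> (LINT t|M. 0)) at_top"
  proof (rule integral_dominated_convergence_at_top[where w = "\<lambda>t. \<bar>t\<bar>"])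
    show "\<forall>\<^sub>F B in at_top. AE t in M. norm (\<bar>t\<bar> * min 1 (\<bar>t\<bar> / B)) \<le> \<bar>t\<bar>"
      using eventually_gt_at_top[of 0]
    proof eventually_elim
      case (elim B)
      have "\<bar>t\<bar> * min 1 (\<bar>t\<bar> / B) \<le> \<bar>t\<bar> * 1" "0 \<le> \<bar>t\<bar> * min 1 (\<bar>t\<bar> / B)" for t
        using elim by (intro mult_left_mono mult_nonneg_nonneg; simp)+
      then show ?case by (intro AE_I2) simp
    qed
    show "AE t in M. ((\<lambda>B. \<bar>t\<bar> * min 1 (\<bar>t\<bar> / B)) \<longlongrightarrow> 0) at_top"
    proof (rule AE_I2)
      fix t :: real
      have "((\<lambda>B. \<bar>t\<bar> / B) \<longlongrightarrow> 0) at_top"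
        by (intro tendsto_divide_0[OF tendsto_const] filterlim_at_top_imp_at_infinity filterlim_ident)
      then have "((\<lambda>B. \<bar>t\<bar> * min 1 (\<bar>t\<bar> / B)) \<longlongrightarrow> \<bar>t\<bar> * min 1 0) at_top"
        by (intro tendsto_mult tendsto_min tendsto_const)
      then show "((\<lambda>B. \<bar>t\<bar> * min 1 (\<bar>t\<bar> / B)) \<longlongrightarrow> 0) at_top" by simp
    qed
  qed (simp_all add: integrable_abs[OF assms])
  then show ?thesis by (simp add: mean_tail_def[abs_def])
qed

text \<open>The left-hand side is the norm of the integral of t^2 / (\<zeta> - t). In the cone
  |\<zeta> - t| is at least \<delta> |\<zeta>|, so |t| / |\<zeta> - t| is bounded both by a constant
  and by a multiple of |t| / |\<zeta>|.\<close>

lemma norm_cauchy_transform_expansion_le: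
  assumes int: "integrable M (\<lambda>t. t)" and \<zeta>: "Im \<zeta> \<ge> \<delta> * cmod \<zeta>" "\<zeta> \<noteq> 0" and \<delta>: "\<delta> > 0"
  shows "norm (\<zeta> * (\<zeta> * cauchy_transform M \<zeta> - 1) - of_real (LINT t|M. t)) \<le> (1 + 1 / \<delta>) * mean_tail (cmod \<zeta>)"
proof -
  have z: "Im \<zeta> > 0" using \<zeta> \<delta> by (smt (verit) mult_pos_pos zero_less_norm_iff)
  let ?f = "\<lambda>t. of_real t * of_real t / (\<zeta> - of_real t)"
  have bound: "norm (?f t) \<le> (1 + 1 / \<delta>) * (\<bar>t\<bar> * min 1 (\<bar>t\<bar> / cmod \<zeta>))" for t
  proof -
    have nz: "cmod (\<zeta> - of_real t) > 0" using diff_of_real_nonzero[of \<zeta> t] z by simp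
    have ge: "cmod (\<zeta> - of_real t) \<ge> \<delta> * cmod \<zeta>"
      using Im_le_cmod_diff_of_real[of \<zeta> t] \<zeta> by linarith
    have pos: "\<delta> * cmod \<zeta> > 0" using \<delta> \<zeta> by simp
    have 1: "\<bar>t\<bar> / cmod (\<zeta> - of_real t) \<le> (1 + 1 / \<delta>) * (\<bar>t\<bar> / cmod \<zeta>)"
    proof -
      have "\<bar>t\<bar> / cmod (\<zeta> - of_real t) \<le> \<bar>t\<bar> / (\<delta> * cmod \<zeta>)"
        using ge nz pos by (intro divide_left_mono) auto
      also have "\<dots> = 1 / \<delta> * (\<bar>t\<bar> / cmod \<zeta>)" by simp
      also have "\<dots> \<le> (1 + 1 / \<delta>) * (\<bar>t\<bar> / cmod \<zeta>)"
        by (intro mult_right_mono) auto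
      finally show ?thesis .
    qed
    have 2: "\<bar>t\<bar> / cmod (\<zeta> - of_real t) \<le> (1 + 1 / \<delta>) * 1"
    proof -
      have "\<bar>t\<bar> \<le> cmod (\<zeta> - of_real t) + cmod \<zeta>"
        using norm_triangle_ineq4[of \<zeta> "\<zeta> - of_real t"] by simp
      then have "\<bar>t\<bar> / cmod (\<zeta> - of_real t) \<le> (cmod (\<zeta> - of_real t) + cmod \<zeta>) / cmod (\<zeta> - of_real t)"
        by (intro divide_right_mono) auto
      also have "\<dots> = 1 + cmod \<zeta> / cmod (\<zeta> - of_real t)"
        using nz by (simp add: add_divide_distrib)
      also have "\<dots> \<le> 1 + cmod \<zeta> / (\<delta> * cmod \<zeta>)"
        using ge nz pos by (intro add_left_mono divide_left_mono) auto
      finally show ?thesis using \<zeta> by simp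
    qed
    have "\<bar>t\<bar> / cmod (\<zeta> - of_real t) \<le> (1 + 1 / \<delta>) * min 1 (\<bar>t\<bar> / cmod \<zeta>)"
      using 1 2 by (cases "1 \<le> \<bar>t\<bar> / cmod \<zeta>")
        (simp_all only: min_absorb1 min_absorb2 linorder_not_le less_imp_le)
    then have "\<bar>t\<bar> * (\<bar>t\<bar> / cmod (\<zeta> - of_real t)) \<le> \<bar>t\<bar> * ((1 + 1 / \<delta>) * min 1 (\<bar>t\<bar> / cmod \<zeta>))"
      by (rule mult_left_mono) simp
    then show ?thesis by (simp add: norm_divide norm_mult mult_ac)
  qed
  have inttail: "integrable M (\<lambda>t. (1 + 1 / \<delta>) * (\<bar>t\<bar> * min 1 (\<bar>t\<bar> / cmod \<zeta>)))"
  proof (intro integrable_mult_right Bochner_Integration.integrable_bound[OF integrable_abs[OF int]] AE_I2)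
    fix t :: real
    have "\<bar>t\<bar> * min 1 (\<bar>t\<bar> / cmod \<zeta>) \<le> \<bar>t\<bar> * 1" "0 \<le> \<bar>t\<bar> * min 1 (\<bar>t\<bar> / cmod \<zeta>)"
      by (intro mult_left_mono mult_nonneg_nonneg; simp)+
    then show "norm (\<bar>t\<bar> * min 1 (\<bar>t\<bar> / cmod \<zeta>)) \<le> norm \<bar>t\<bar>" by simp
  qed simp
  have intf: "integrable M ?f"
    by (rule Bochner_Integration.integrable_bound[OF inttail])
      (auto intro!: AE_I2 order_trans[OF bound abs_ge_self] simp del: abs_mult)
  have eq: "?f t = \<zeta> * (\<zeta> * (1 / (\<zeta> - of_real t)) - 1) - of_real t" for t
    using diff_of_real_nonzero[of \<zeta> t] z by (simp add: field_simps)
  have "(LINT t|M. ?f t) = \<zeta> * (\<zeta> * cauchy_transform M \<zeta> - 1) - of_real (LINT t|M. t)"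
  proof -
    have 1: "integrable M (\<lambda>t. \<zeta> * (1 / (\<zeta> - of_real t)))"
      by (intro integrable_mult_right integrable_cauchy_kernel z)
    then have 2: "integrable M (\<lambda>t. \<zeta> * (1 / (\<zeta> - of_real t)) - 1)"
      by (rule Bochner_Integration.integrable_diff) simp
    have "(LINT t|M. \<zeta> * (\<zeta> * (1 / (\<zeta> - of_real t)) - 1) - of_real t)
      = (LINT t|M. \<zeta> * (\<zeta> * (1 / (\<zeta> - of_real t)) - 1)) - (LINT t|M. of_real t)"
      by (rule Bochner_Integration.integral_diff[OF integrable_mult_right[OF 2] integrable_of_real[OF int]])
    also have "(LINT t|M. \<zeta> * (\<zeta> * (1 / (\<zeta> - of_real t)) - 1)) = \<zeta> * (LINT t|M. \<zeta> * (1 / (\<zeta> - of_real t)) - 1)"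
      by (rule integral_mult_right_zero)
    also have "(LINT t|M. \<zeta> * (1 / (\<zeta> - of_real t)) - 1) = (LINT t|M. \<zeta> * (1 / (\<zeta> - of_real t))) - (LINT t|M. 1)"
      by (rule Bochner_Integration.integral_diff[OF 1]) simp
    also have "(LINT t|M. \<zeta> * (1 / (\<zeta> - of_real t))) = \<zeta> * cauchy_transform M \<zeta>"
      unfolding cauchy_transform_def by (rule integral_mult_right_zero)
    finally show ?thesis using prob_space unfolding eq by simp
  qed
  then have "norm (\<zeta> * (\<zeta> * cauchy_transform M \<zeta> - 1) - of_real (LINT t|M. t)) = norm (LINT t|M. ?f t)"
    by simp
  also have "\<dots> \<le> (LINT t|M. (1 + 1 / \<delta>) * (\<bar>t\<bar> * min 1 (\<bar>t\<bar> / cmod \<zeta>)))"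
    by (rule Bochner_Integration.integral_norm_bound_integral[OF intf inttail bound])
  also have "\<dots> = (1 + 1 / \<delta>) * mean_tail (cmod \<zeta>)"
    unfolding mean_tail_def by (rule integral_mult_right_zero)
  finally show ?thesis .
qed

text \<open>With h = \<zeta> (\<zeta> G - 1), which tends to the mean, one has F = \<zeta>^2 /
  (\<zeta> + h) = \<zeta> - h + h^2 / (\<zeta> + h), and the last term vanishes at infinity. The
  restricted filter turns the limit within the cone into one threshold \<open>R\<close>.\<close>

lemma F_transform_mean_expansion:
  assumes int: "integrable M (\<lambda>t. t)" and \<delta>: "\<delta> > 0" and e: "e > 0"
  obtains R where "R > 0" "\<And>\<zeta>. Im \<zeta> \<ge> \<delta> * cmod \<zeta> \<Longrightarrow> cmod \<zeta> \<ge> R \<Longrightarrow>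
    norm (F_transform M \<zeta> - \<zeta> + of_real (LINT t|M. t)) < e"
proof -
  define a where "a = (LINT t|M. t)"
  define \<F> where "\<F> = inf at_infinity (principal {\<zeta>. Im \<zeta> \<ge> \<delta> * cmod \<zeta>})"
  define h where "h \<zeta> = \<zeta> * (\<zeta> * cauchy_transform M \<zeta> - 1)" for \<zeta>
  have S: "eventually (\<lambda>\<zeta>. Im \<zeta> \<ge> \<delta> * cmod \<zeta>) \<F>"
    by (simp add: \<F>_def eventually_inf_principal)
  have inf: "filterlim (\<lambda>\<zeta>. \<zeta>) at_infinity \<F>"
    by (simp add: \<F>_def filterlim_def)
  then have n: "filterlim cmod at_top \<F>"
    by (rule filterlim_compose[OF filterlim_norm_at_top])
  then have nz: "eventually (\<lambda>\<zeta>. cmod \<zeta> > \<bar>a\<bar> + 1) \<F>"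
    by (simp add: filterlim_at_top_dense)
  have "((\<lambda>\<zeta>. h \<zeta> - of_real a) \<longlongrightarrow> 0) \<F>"
  proof (rule Lim_null_comparison)
    show "eventually (\<lambda>\<zeta>. norm (h \<zeta> - of_real a) \<le> (1 + 1 / \<delta>) * mean_tail (cmod \<zeta>)) \<F>"
      using S nz
    proof eventually_elim
      case (elim \<zeta>)
      then have "\<zeta> \<noteq> 0" by auto
      with elim show ?case
        unfolding h_def a_def using norm_cauchy_transform_expansion_le[OF int _ _ \<delta>] by simp
    qed
    show "((\<lambda>\<zeta>. (1 + 1 / \<delta>) * mean_tail (cmod \<zeta>)) \<longlongrightarrow> 0) \<F>"
      by (intro tendsto_mult_right_zero filterlim_compose[OF mean_tail_tendsto_0[OF int] n])
  qed
  then have h: "(h \<longlongrightarrow> of_real a) \<F>"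
    by (rule LIM_zero_cancel)
  have "filterlim (\<lambda>\<zeta>. h \<zeta> + \<zeta>) at_infinity \<F>"
    by (rule tendsto_add_filterlim_at_infinity[OF h inf])
  then have lim: "((\<lambda>\<zeta>. - h \<zeta> + h \<zeta> * h \<zeta> / (h \<zeta> + \<zeta>) + of_real a) \<longlongrightarrow> - of_real a + 0 + of_real a) \<F>"
    by (intro tendsto_add tendsto_minus h tendsto_const tendsto_divide_0[OF tendsto_mult[OF h h]])
  have ev: "eventually (\<lambda>\<zeta>. - h \<zeta> + h \<zeta> * h \<zeta> / (h \<zeta> + \<zeta>) + of_real a = F_transform M \<zeta> - \<zeta> + of_real a) \<F>"
    using S nz
  proof eventually_elim
    case (elim \<zeta>)
    have z: "\<zeta> \<noteq> 0" using elim by auto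
    then have "Im \<zeta> > 0" using elim \<delta> by (smt (verit) mult_pos_pos zero_less_norm_iff)
    then have G: "cauchy_transform M \<zeta> \<noteq> 0" by (rule cauchy_transform_nonzero)
    have hz: "h \<zeta> + \<zeta> = \<zeta> * \<zeta> * cauchy_transform M \<zeta>" by (simp add: h_def algebra_simps)
    then have nz: "h \<zeta> + \<zeta> \<noteq> 0" using z G by simp
    have "F_transform M \<zeta> = \<zeta> * \<zeta> / (h \<zeta> + \<zeta>)"
      unfolding hz F_transform_def using z G by simp
    moreover have "\<zeta> * \<zeta> / (h \<zeta> + \<zeta>) = \<zeta> - h \<zeta> + h \<zeta> * h \<zeta> / (h \<zeta> + \<zeta>)"
      using nz by (simp add: field_simps)
    ultimately show ?case by simp
  qed
  have "((\<lambda>\<zeta>. F_transform M \<zeta> - \<zeta> + of_real a) \<longlongrightarrow> 0) \<F>"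
    using Lim_transform_eventually[OF lim ev] by simp
  then have "eventually (\<lambda>\<zeta>. norm (F_transform M \<zeta> - \<zeta> + of_real a) < e) \<F>"
    using e by (auto simp: tendsto_iff)
  then obtain b where b: "\<And>\<zeta>. cmod \<zeta> \<ge> b \<Longrightarrow> Im \<zeta> \<ge> \<delta> * cmod \<zeta> \<Longrightarrow> norm (F_transform M \<zeta> - \<zeta> + of_real a) < e"
    by (auto simp: \<F>_def eventually_inf_principal eventually_at_infinity)
  show thesis
    by (rule that[of "max b 1"]) (use b in \<open>auto simp: a_def\<close>)
qed

end

section \<open>Iterating the mean expansion along the semigroup\<close>

context monotone_semigroup
begin

text \<open>Each of the roughly t / \<open>t\<^sub>0\<close> steps shifts the point by minus the
  mean with error below \<open>e\<close>, so the total error is at most e / \<open>t\<^sub>0\<close>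
  after division by \<open>t\<close>. What must be ensured is that the orbit never leaves the cone
  in which the expansion holds.\<close>

lemma tendsto_F_transform_mean:
  assumes t0: "t\<^sub>0 > 0" and int: "integrable (\<mu> t\<^sub>0) (\<lambda>t. t)" and z: "Im z > 0"
  shows "((\<lambda>t. F_transform (\<mu> (real (nat \<lfloor>t / t\<^sub>0\<rfloor>) * t\<^sub>0)) (of_real t * z) / of_real t)
    \<longlongrightarrow> z - of_real ((LINT t|\<mu> t\<^sub>0. t) / t\<^sub>0)) at_top"
proof -
  interpret M: real_distribution "\<mu> t\<^sub>0"
    using t0 by (intro real_distribution_semigroup) simp
  define a where "a = (LINT t|\<mu> t\<^sub>0. t)"
  define n where "n t = nat \<lfloor>t / t\<^sub>0\<rfloor>" for t
  have n: "real (n t) * t\<^sub>0 \<le> t" "t \<le> real (n t) * t\<^sub>0 + t\<^sub>0" if "t > 0" for t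
  proof -
    have "t / t\<^sub>0 \<ge> 0" using that t0 by simp
    then have "real (n t) \<le> t / t\<^sub>0" "t / t\<^sub>0 \<le> real (n t) + 1"
      unfolding n_def by linarith+
    then show "real (n t) * t\<^sub>0 \<le> t" "t \<le> real (n t) * t\<^sub>0 + t\<^sub>0"
      using t0 by (simp_all add: field_simps)
  qed
  have close: "eventually (\<lambda>t. norm (F_transform (\<mu> (real (n t) * t\<^sub>0)) (of_real t * z) / of_real t
      - z + of_real (real (n t) / t * a)) \<le> e / t\<^sub>0) at_top" if e: "0 < e" "e \<le> 1" for e
  proof -
    \<comment> \<open>Along the orbit |\<zeta>| <= t L: the number of steps is at most t /
      \<open>t\<^sub>0\<close>, and each moves the point by at most |a| + e <= |a| + 1. Since
      imaginary parts stay above t Im z, the aperture Im z / L works for all steps.\<close>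
    define L where "L = cmod z + (\<bar>a\<bar> + 1) / t\<^sub>0"
    have L: "L > 0" using t0 by (auto simp: L_def intro!: add_nonneg_pos)
    have \<delta>: "Im z / L > 0" using z L by simp
    obtain R where R: "R > 0" "\<And>\<zeta>. Im \<zeta> \<ge> Im z / L * cmod \<zeta> \<Longrightarrow> cmod \<zeta> \<ge> R \<Longrightarrow>
        norm (F_transform (\<mu> t\<^sub>0) \<zeta> - \<zeta> + of_real a) < e"
      using M.F_transform_mean_expansion[OF int \<delta> e(1)] unfolding a_def by blast
    show ?thesis
      using eventually_gt_at_top[of 0] eventually_ge_at_top[of "R / Im z"]
    proof eventually_elim
      case (elim t)
      have tR: "t * Im z \<ge> R" using elim z by (simp add: field_simps)
      have step: "norm (F_transform (\<mu> (real k * t\<^sub>0)) (of_real t * z) - of_real t * z + of_real (real k * a)) \<le> real k * e"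
        if "k \<le> n t" for k
        using that
      proof (induction k)
        case 0
        then show ?case using z elim by (simp add: F_transform_0)
      next
        case (Suc k)
        define \<zeta> where "\<zeta> = F_transform (\<mu> (real k * t\<^sub>0)) (of_real t * z)"
        have IH: "norm (\<zeta> - of_real t * z + of_real (real k * a)) \<le> real k * e"
          using Suc by (simp add: \<zeta>_def)
        have Imtz: "Im (of_real t * z) > 0" using z elim by simp
        have Im\<zeta>: "Im \<zeta> \<ge> t * Im z"
          using real_distribution.Im_F_transform_ge[OF real_distribution_semigroup Imtz, of "real k * t\<^sub>0"] t0
          by (simp add: \<zeta>_def)
        have "real k \<le> t / t\<^sub>0"
        proof -
          have "real k * t\<^sub>0 \<le> real (n t) * t\<^sub>0" using Suc.prems t0 by simp
          also have "\<dots> \<le> t" by (rule n(1)) (use elim in simp)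
          finally show ?thesis using t0 by (simp add: pos_le_divide_eq)
        qed
        then have kb: "real k * (\<bar>a\<bar> + 1) \<le> t / t\<^sub>0 * (\<bar>a\<bar> + 1)"
          by (intro mult_right_mono) auto
        have "cmod \<zeta> \<le> norm (\<zeta> - of_real t * z + of_real (real k * a)) + norm (of_real t * z - of_real (real k * a))"
          using norm_triangle_ineq[of "\<zeta> - of_real t * z + of_real (real k * a)" "of_real t * z - of_real (real k * a)"] by simp
        also have "norm (of_real t * z - of_real (real k * a)) \<le> t * cmod z + real k * \<bar>a\<bar>"
          using norm_triangle_ineq4[of "of_real t * z" "of_real (real k * a)"] elim
          by (simp add: norm_mult abs_mult)
        finally have "cmod \<zeta> \<le> t * cmod z + real k * (\<bar>a\<bar> + e)"
          using IH by (simp add: algebra_simps)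
        also have "\<dots> \<le> t * cmod z + real k * (\<bar>a\<bar> + 1)"
          using e by (intro add_left_mono mult_left_mono) auto
        also have "\<dots> \<le> t * L"
          using kb by (simp add: L_def algebra_simps add_divide_distrib)
        finally have "Im z / L * cmod \<zeta> \<le> Im z / L * (t * L)"
          using \<delta> by (intro mult_left_mono) auto
        also have "\<dots> = t * Im z" using L by simp
        finally have "Im \<zeta> \<ge> Im z / L * cmod \<zeta>" using Im\<zeta> by simp
        moreover have "cmod \<zeta> \<ge> R"
          using tR Im\<zeta> abs_Im_le_cmod[of \<zeta>] by linarith
        ultimately have "norm (F_transform (\<mu> t\<^sub>0) \<zeta> - \<zeta> + of_real a) < e"
          by (rule R(2))
        moreover have "F_transform (\<mu> (real (Suc k) * t\<^sub>0)) (of_real t * z) = F_transform (\<mu> t\<^sub>0) \<zeta>"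
          using F_transform_add[of t\<^sub>0 "real k * t\<^sub>0", OF _ _ Imtz] t0 by (simp add: \<zeta>_def algebra_simps)
        ultimately have "norm ((F_transform (\<mu> (real (Suc k) * t\<^sub>0)) (of_real t * z) - \<zeta> + of_real a)
            + (\<zeta> - of_real t * z + of_real (real k * a))) \<le> e + real k * e"
          using IH by (intro norm_triangle_mono) simp_all
        then show ?case by (simp add: algebra_simps)
      qed
      have "F_transform (\<mu> (real (n t) * t\<^sub>0)) (of_real t * z) / of_real t - z + of_real (real (n t) / t * a)
        = (F_transform (\<mu> (real (n t) * t\<^sub>0)) (of_real t * z) - of_real t * z + of_real (real (n t) * a)) / of_real t"
        using elim by (simp add: field_simps)
      also have "norm \<dots> \<le> real (n t) * e / t"
        using step[of "n t"] elim by (simp add: norm_divide divide_right_mono)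
      also have "\<dots> \<le> e / t\<^sub>0"
        using mult_right_mono[OF n(1)[of t], of e] elim t0 e by (simp add: field_simps)
      finally show ?case .
    qed
  qed
  have "((\<lambda>t. real (n t) / t) \<longlongrightarrow> 1 / t\<^sub>0) at_top"
  proof (rule tendsto_sandwich)
    show "\<forall>\<^sub>F t in at_top. 1 / t\<^sub>0 - 1 / t \<le> real (n t) / t"
      using eventually_gt_at_top[of 0]
    proof eventually_elim
      case (elim t)
      have "t * t \<le> t * (real (n t) * t\<^sub>0 + t\<^sub>0)"
        using n(2)[OF elim] elim by (intro mult_left_mono) auto
      then show ?case using elim t0 by (simp add: field_simps)
    qed
    show "\<forall>\<^sub>F t in at_top. real (n t) / t \<le> 1 / t\<^sub>0"
      using eventually_gt_at_top[of 0] by eventually_elim (use n t0 in \<open>simp add: field_simps\<close>)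
    show "((\<lambda>t. 1 / t\<^sub>0 - 1 / t) \<longlongrightarrow> 1 / t\<^sub>0) at_top"
      using t0 by real_asymp
  qed simp
  then have 1: "((\<lambda>t. z - of_real (real (n t) / t * a)) \<longlongrightarrow> z - of_real (1 / t\<^sub>0 * a)) at_top"
    by (rule tendsto_diff[OF tendsto_const tendsto_of_real[OF tendsto_mult[OF _ tendsto_const]]])
  have 2: "((\<lambda>t. F_transform (\<mu> (real (n t) * t\<^sub>0)) (of_real t * z) / of_real t
      - (z - of_real (real (n t) / t * a))) \<longlongrightarrow> 0) at_top"
  proof (rule tendstoI)
    fix \<epsilon> :: real assume "\<epsilon> > 0"
    \<comment> \<open>The cap 1 is the one built into \<open>L\<close>; the other bound makes the
      accumulated error at most \<epsilon> / 2.\<close>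
    define e where "e = min 1 (\<epsilon> * t\<^sub>0 / 2)"
    have e: "0 < e" "e \<le> 1" using \<open>\<epsilon> > 0\<close> t0 by (auto simp: e_def)
    have "e \<le> \<epsilon> * t\<^sub>0 / 2" by (simp add: e_def)
    then have "e / t\<^sub>0 \<le> \<epsilon> / 2" using t0 by (simp add: field_simps)
    then have "e / t\<^sub>0 < \<epsilon>" using \<open>\<epsilon> > 0\<close> by linarith
    with close[OF e] show "eventually (\<lambda>t. dist (F_transform (\<mu> (real (n t) * t\<^sub>0)) (of_real t * z) / of_real t
      - (z - of_real (real (n t) / t * a))) 0 < \<epsilon>) at_top"
      by (auto elim!: eventually_mono simp: algebra_simps)
  qed
  from tendsto_add[OF 2 1] show ?thesis by (simp add: n_def a_def)
qed

lemma weak_law_of_large_numbers: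
  assumes t0: "t\<^sub>0 > 0" and int: "integrable (\<mu> t\<^sub>0) (\<lambda>t. t)"
  shows "weak_conv_along (\<lambda>t. dilation (1 / t) (\<mu> t)) (return borel ((LINT t|\<mu> t\<^sub>0. t) / t\<^sub>0)) at_top"
proof (rule weak_conv_along_rescaledI[OF real_distribution_return])
  fix z :: complex assume z: "Im z > 0"
  show "((\<lambda>t. F_transform (\<mu> t) (of_real t * z) / of_real t)
    \<longlongrightarrow> F_transform (return borel ((LINT t|\<mu> t\<^sub>0. t) / t\<^sub>0)) z) at_top"
    unfolding F_transform_return[OF z]
  proof (rule tendsto_F_transform_shift[OF _ filterlim_ident z tendsto_F_transform_mean[OF t0 int z]])
    show "eventually (\<lambda>t. 0 \<le> real (nat \<lfloor>t / t\<^sub>0\<rfloor>) * t\<^sub>0 \<and> real (nat \<lfloor>t / t\<^sub>0\<rfloor>) * t\<^sub>0 \<le> t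
      \<and> t \<le> real (nat \<lfloor>t / t\<^sub>0\<rfloor>) * t\<^sub>0 + t\<^sub>0) at_top"
      using eventually_gt_at_top[of 0]
    proof eventually_elim
      case (elim t)
      have "t / t\<^sub>0 \<ge> 0" using elim t0 by simp
      then have "real (nat \<lfloor>t / t\<^sub>0\<rfloor>) \<le> t / t\<^sub>0" "t / t\<^sub>0 \<le> real (nat \<lfloor>t / t\<^sub>0\<rfloor>) + 1"
        by linarith+
      then show ?case using t0 by (simp add: field_simps)
    qed
  qed (use z in simp)
qed simp

end

section \<open>Attraction to the arc-sine law\<close>

context monotone_semigroup
begin

text \<open>The scalar by which scales are compared: it falls with the height \<open>y\<close> and
  grows with the time \<open>t\<close>.\<close>

definition Im_ratio :: "real \<Rightarrow> real \<Rightarrow> real" where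
  "Im_ratio t y = Im (F_transform (\<mu> t) (\<i> * of_real y)) / y"

lemma Im_ratio_antimono: "t \<ge> 0 \<Longrightarrow> 0 < y1 \<Longrightarrow> y1 \<le> y2 \<Longrightarrow> Im_ratio t y2 \<le> Im_ratio t y1"
  unfolding Im_ratio_def
  by (intro real_distribution.Im_F_transform_ratio_antimono real_distribution_semigroup)

lemma Im_ratio_mono:
  assumes "0 \<le> s" "s \<le> t" "y > 0"
  shows "Im_ratio s y \<le> Im_ratio t y"
proof -
  have z: "Im (\<i> * of_real y) > 0" using assms by simp
  have "Im (F_transform (\<mu> s) (\<i> * of_real y)) \<le> Im (F_transform (\<mu> (t - s)) (F_transform (\<mu> s) (\<i> * of_real y)))"
    using assms by (intro real_distribution.Im_F_transform_ge real_distribution_semigroup Im_F_transform_semigroup z) auto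
  also have "\<dots> = Im (F_transform (\<mu> t) (\<i> * of_real y))"
    using F_transform_add[of "t - s" s, OF _ _ z] assms by simp
  finally show ?thesis
    unfolding Im_ratio_def using assms by (intro divide_right_mono) auto
qed

end

section \<open>Asymptotics of the norming sequence\<close>

locale arcsine_attracted_semigroup = monotone_semigroup +
  fixes t\<^sub>0 :: real and B :: "nat \<Rightarrow> real"
  assumes t0: "t\<^sub>0 > 0" and B_pos: "B n > 0"
    and attracted: "weak_conv_along (\<lambda>n. dilation (1 / B n) (mono_conv_power n (\<mu> t\<^sub>0))) arcsine_law sequentially"
begin

lemma tendsto_F_transform_arcsine:
  assumes z: "Im z > 0"
  shows "(\<lambda>n. F_transform (\<mu> (real n * t\<^sub>0)) (of_real (B n) * z) / of_real (B n)) \<longlonglongrightarrow> F_transform arcsine_law z"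
proof -
  let ?M = "\<lambda>n. dilation (1 / B n) (\<mu> (real n * t\<^sub>0))"
  have rd: "real_distribution (\<mu> (real n * t\<^sub>0))" for n
    using t0 by (intro real_distribution_semigroup) simp
  have M: "real_distribution (?M n)" for n
    by (intro real_distribution.real_distribution_dilation rd)
  have "weak_conv_m ?M arcsine_law"
    using attracted t0 by (simp add: mono_conv_power_semigroup weak_conv_along_sequentially[OF M real_distribution_arcsine])
  from weak_conv_m_cauchy_transform[OF M real_distribution_arcsine this z]
  have "(\<lambda>n. F_transform (?M n) z) \<longlonglongrightarrow> F_transform arcsine_law z"
    unfolding F_transform_def
    by (intro tendsto_divide tendsto_const) (simp_all add: real_distribution.cauchy_transform_nonzero real_distribution_arcsine z)
  then show ?thesis
    by (simp add: real_distribution.F_transform_dilation rd B_pos)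
qed

text \<open>Another block of \<open>n\<close> steps at the same scale sends the limit point i s to i
  sqrt (s^2 + 2). The inner values only converge to i s, so the moving-argument lemma is what allows
  the induction.\<close>

lemma tendsto_F_transform_multiple:
  assumes y: "y > 0"
  shows "(\<lambda>n. F_transform (\<mu> (real (k * n) * t\<^sub>0)) (of_real (B n) * (\<i> * of_real y)) / of_real (B n))
    \<longlonglongrightarrow> \<i> * of_real (sqrt (y\<^sup>2 + 2 * real k))"
proof (induction k)
  case 0
  have "F_transform (\<mu> 0) (of_real (B n) * (\<i> * of_real y)) / of_real (B n) = \<i> * of_real y" for n
    using B_pos[of n] y by (subst F_transform_0) auto
  then show ?case using y by simp
next
  case (Suc k)
  let ?s = "sqrt (y\<^sup>2 + 2 * real k)"
  have s: "?s > 0" "?s\<^sup>2 = y\<^sup>2 + 2 * real k"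
    using y by (auto intro!: add_pos_nonneg)
  let ?q = "\<lambda>n. F_transform (\<mu> (real (k * n) * t\<^sub>0)) (of_real (B n) * (\<i> * of_real y)) / of_real (B n)"
  have "(\<lambda>n. F_transform (\<mu> (real n * t\<^sub>0)) (of_real (B n) * ?q n) / of_real (B n)) \<longlonglongrightarrow> F_transform arcsine_law (\<i> * of_real ?s)"
  proof (rule tendsto_rescaled_F_transform[OF _ _ Suc.IH])
    show "\<forall>\<^sub>F n in sequentially. real_distribution (\<mu> (real n * t\<^sub>0))"
      using t0 by (simp add: real_distribution_semigroup)
    show "(\<lambda>n. F_transform (\<mu> (real n * t\<^sub>0)) (of_real (B n) * (\<i> * of_real ?s)) / of_real (B n)) \<longlonglongrightarrow> F_transform arcsine_law (\<i> * of_real ?s)"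
      by (rule tendsto_F_transform_arcsine) (use s in simp)
    show "Im (F_transform arcsine_law (\<i> * of_real ?s)) > 0"
      by (rule real_distribution.Im_F_transform_pos[OF real_distribution_arcsine]) (use s in simp)
  qed (use B_pos s in auto)
  also have "F_transform arcsine_law (\<i> * of_real ?s) = \<i> * of_real (sqrt (y\<^sup>2 + 2 * real (Suc k)))"
    by (simp only: F_transform_arcsine_imaginary[OF s(1)] s(2)) (simp add: algebra_simps)
  also have "(\<lambda>n. F_transform (\<mu> (real n * t\<^sub>0)) (of_real (B n) * ?q n) / of_real (B n))
    = (\<lambda>n. F_transform (\<mu> (real (Suc k * n) * t\<^sub>0)) (of_real (B n) * (\<i> * of_real y)) / of_real (B n))"
  proof
    fix n
    have "F_transform (\<mu> (real n * t\<^sub>0 + real (k * n) * t\<^sub>0)) (of_real (B n) * (\<i> * of_real y))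
      = F_transform (\<mu> (real n * t\<^sub>0)) (F_transform (\<mu> (real (k * n) * t\<^sub>0)) (of_real (B n) * (\<i> * of_real y)))"
      using t0 B_pos[of n] y by (intro F_transform_add) auto
    moreover have "real n * t\<^sub>0 + real (k * n) * t\<^sub>0 = real (Suc k * n) * t\<^sub>0"
      by (simp add: algebra_simps)
    ultimately show "F_transform (\<mu> (real n * t\<^sub>0)) (of_real (B n) * ?q n) / of_real (B n)
      = F_transform (\<mu> (real (Suc k * n) * t\<^sub>0)) (of_real (B n) * (\<i> * of_real y)) / of_real (B n)"
      using B_pos[of n] by simp
  qed
  finally show ?case .
qed

lemma tendsto_Im_ratio:
  assumes y: "y > 0"
  shows "(\<lambda>n. Im_ratio (real (k * n) * t\<^sub>0) (B n * y)) \<longlonglongrightarrow> sqrt (1 + 2 * real k / y\<^sup>2)"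
proof -
  have "(\<lambda>n. Im (F_transform (\<mu> (real (k * n) * t\<^sub>0)) (of_real (B n) * (\<i> * of_real y)) / of_real (B n)) / y)
    \<longlonglongrightarrow> Im (\<i> * of_real (sqrt (y\<^sup>2 + 2 * real k))) / y"
    by (intro tendsto_divide tendsto_Im tendsto_F_transform_multiple tendsto_const) (use y in auto)
  moreover have "sqrt (y\<^sup>2 + 2 * real k) / y = sqrt (1 + 2 * real k / y\<^sup>2)"
  proof -
    have "y\<^sup>2 + 2 * real k = y\<^sup>2 * (1 + 2 * real k / y\<^sup>2)"
      using y by (simp add: field_simps)
    then have "sqrt (y\<^sup>2 + 2 * real k) = y * sqrt (1 + 2 * real k / y\<^sup>2)"
      using y by (simp only: real_sqrt_mult real_sqrt_abs abs_of_pos)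
    then show ?thesis using y by simp
  qed
  ultimately show ?thesis
    by (simp add: Im_ratio_def mult.commute mult.left_commute)
qed

lemma tendsto_Im_ratio_1: "(\<lambda>n. Im_ratio (real n * t\<^sub>0) (B n)) \<longlonglongrightarrow> sqrt 3"
  using tendsto_Im_ratio[of 1 1] by simp

text \<open>At time \<open>k * n\<close> the ratio tends to sqrt 3 at height
  \<open>B (k * n)\<close> and to sqrt (1 + 2k / a^2) at height \<open>B n * a\<close>. These limits
  are strictly ordered according to whether a^2 is below or above \<open>k\<close>, and antitonicity
  in the height turns this into an order of the heights.\<close>

lemma tendsto_ratio_multiple:
  assumes k: "k \<ge> 1"
  shows "(\<lambda>n. B (k * n) / B n) \<longlonglongrightarrow> sqrt (real k)"
proof -
  have "filterlim (\<lambda>n. k * n) sequentially sequentially"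
    by (rule filterlim_subseq) (use k in \<open>auto intro!: strict_monoI\<close>)
  from filterlim_compose[OF tendsto_Im_ratio_1 this]
  have lim: "(\<lambda>n. Im_ratio (real (k * n) * t\<^sub>0) (B (k * n))) \<longlonglongrightarrow> sqrt 3" .
  show ?thesis
  proof (rule order_tendstoI)
    fix a assume a: "a < sqrt (real k)"
    show "\<forall>\<^sub>F n in sequentially. a < B (k * n) / B n"
    proof (cases "a > 0")
      case True
      have "a\<^sup>2 < real k" using a True by (metis less_le real_less_lsqrt not_le real_le_lsqrt real_less_rsqrt real_sqrt_less_iff real_sqrt_unique)
      then have "3 < 1 + 2 * real k / a\<^sup>2" using True by (simp add: field_simps)
      then have "sqrt 3 < sqrt (1 + 2 * real k / a\<^sup>2)" by simp
      then obtain c where c: "sqrt 3 < c" "c < sqrt (1 + 2 * real k / a\<^sup>2)" using dense by blast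
      show ?thesis
        using order_tendstoD(2)[OF lim c(1)] order_tendstoD(1)[OF tendsto_Im_ratio[OF True] c(2)]
      proof eventually_elim
        case (elim n)
        have "B n * a < B (k * n)"
        proof (rule ccontr)
          assume "\<not> ?thesis"
          then have "Im_ratio (real (k * n) * t\<^sub>0) (B n * a) \<le> Im_ratio (real (k * n) * t\<^sub>0) (B (k * n))"
            using t0 B_pos by (intro Im_ratio_antimono) auto
          with elim show False by simp
        qed
        then show ?case using B_pos[of n] by (simp add: field_simps)
      qed
    next
      case False
      then show ?thesis using B_pos by (intro always_eventually allI) (smt (verit) divide_pos_pos)
    qed
  next
    fix a assume a: "a > sqrt (real k)"
    then have a0: "a > 0" by (smt (verit) real_sqrt_ge_zero of_nat_0_le_iff)
    have "real k < a\<^sup>2" using a a0 by (metis less_eq_real_def real_sqrt_less_iff real_sqrt_unique)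
    then have "1 + 2 * real k / a\<^sup>2 < 3" using a0 by (simp add: field_simps)
    then have "sqrt (1 + 2 * real k / a\<^sup>2) < sqrt 3" by simp
    then obtain c where c: "c < sqrt 3" "sqrt (1 + 2 * real k / a\<^sup>2) < c" using dense by blast
    show "\<forall>\<^sub>F n in sequentially. B (k * n) / B n < a"
      using order_tendstoD(1)[OF lim c(1)] order_tendstoD(2)[OF tendsto_Im_ratio[OF a0] c(2)]
    proof eventually_elim
      case (elim n)
      have "B (k * n) < B n * a"
      proof (rule ccontr)
        assume "\<not> ?thesis"
        then have "Im_ratio (real (k * n) * t\<^sub>0) (B (k * n)) \<le> Im_ratio (real (k * n) * t\<^sub>0) (B n * a)"
          using t0 B_pos[of n] a0 by (intro Im_ratio_antimono) auto
        with elim show False by simp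
      qed
      then show ?case using B_pos[of n] by (simp add: field_simps)
    qed
  qed
qed

text \<open>At time \<open>n\<close> the ratio at height \<open>y * B n\<close> eventually exceeds a
  constant above sqrt 3, and it can only grow by time \<open>m\<close>. At height \<open>B m\<close>
  it is eventually below that constant, so \<open>B m\<close> cannot lie below
  \<open>y * B n\<close>. The threshold is common to all later pairs of indices.\<close>

lemma almost_increasing:
  assumes y: "0 < y" "y < 1"
  obtains N where "\<And>m n. N \<le> n \<Longrightarrow> n \<le> m \<Longrightarrow> y * B n \<le> B m"
proof -
  have "y\<^sup>2 < 1" using y by (simp add: abs_square_less_1)
  then have "3 < 1 + 2 * real 1 / y\<^sup>2" using y by (simp add: field_simps)
  then have "sqrt 3 < sqrt (1 + 2 * real 1 / y\<^sup>2)" by simp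
  then obtain c where c: "sqrt 3 < c" "c < sqrt (1 + 2 * real 1 / y\<^sup>2)" using dense by blast
  have "\<forall>\<^sub>F n in sequentially. Im_ratio (real n * t\<^sub>0) (B n) < c \<and> c < Im_ratio (real (1 * n) * t\<^sub>0) (B n * y)"
    by (intro eventually_conj order_tendstoD(2)[OF tendsto_Im_ratio_1 c(1)] order_tendstoD(1)[OF tendsto_Im_ratio[OF y(1)] c(2)])
  then obtain N where N: "\<And>n. n \<ge> N \<Longrightarrow> Im_ratio (real n * t\<^sub>0) (B n) < c"
      "\<And>n. n \<ge> N \<Longrightarrow> c < Im_ratio (real n * t\<^sub>0) (B n * y)"
    by (auto simp: eventually_sequentially)
  show thesis
  proof (rule that)
    fix m n assume mn: "N \<le> n" "n \<le> m"
    show "y * B n \<le> B m"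
    proof (rule ccontr)
      assume "\<not> ?thesis"
      then have "Im_ratio (real m * t\<^sub>0) (B n * y) \<le> Im_ratio (real m * t\<^sub>0) (B m)"
        using t0 B_pos[of m] by (intro Im_ratio_antimono) (auto simp: mult.commute)
      moreover have "Im_ratio (real n * t\<^sub>0) (B n * y) \<le> Im_ratio (real m * t\<^sub>0) (B n * y)"
        using t0 B_pos[of n] y mn by (intro Im_ratio_mono mult_right_mono) auto
      ultimately show False using N(1)[of m] N(2)[of n] mn by simp
    qed
  qed
qed

lemma filterlim_B: "filterlim B at_top sequentially"
  unfolding filterlim_at_top
proof
  fix Z :: real
  obtain N where N: "\<And>m n. N \<le> n \<Longrightarrow> n \<le> m \<Longrightarrow> 1 / 2 * B n \<le> B m"
    using almost_increasing[of "1/2"] by auto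
  \<comment> \<open>The 8 compensates three factors 1/2: almost monotonicity is used twice and the
    bound j / 2 on the ratio once. Multiples by j^2 are taken because their limiting ratio is
    j.\<close>
  obtain j :: nat where j: "real j > max 1 (8 * Z / B N)" using reals_Archimedean2 by blast
  have "real j < real (j\<^sup>2) \<or> j \<le> 1" by (cases "j \<le> 1") (auto simp: power2_eq_square)
  then have jj: "sqrt (real (j\<^sup>2)) = real j" "j\<^sup>2 \<ge> 1" using j by (auto simp: power2_eq_square)
  have "real j / 2 < sqrt (real (j\<^sup>2))" using jj j by simp
  from order_tendstoD(1)[OF tendsto_ratio_multiple[OF jj(2)] this]
  obtain n where n: "n \<ge> N" "real j / 2 < B (j\<^sup>2 * n) / B n"
    by (metis (no_types, lifting) eventually_sequentially nat_le_linear)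
  have "Z \<le> B m" if m: "m \<ge> j\<^sup>2 * n" for m
  proof -
    have jn: "N \<le> j\<^sup>2 * n" using n(1) jj(2) by (metis le_trans mult_le_mono1 nat_mult_1)
    have "8 * Z < real j * B N" using j B_pos[of N] by (simp add: field_simps)
    then have "Z \<le> 1 / 2 * (real j / 2 * (1 / 2 * B N))" by simp
    also have "\<dots> \<le> 1 / 2 * (real j / 2 * B n)"
      using N[of N n] n by (intro mult_left_mono) auto
    also have "\<dots> \<le> 1 / 2 * B (j\<^sup>2 * n)"
      using n(2) B_pos[of n] by (simp add: field_simps)
    also have "\<dots> \<le> B m" by (rule N[OF jn m])
    finally show ?thesis .
  qed
  then show "\<forall>\<^sub>F m in sequentially. Z \<le> B m"
    by (auto simp: eventually_sequentially)
qed

section \<open>The norming function in real time\<close>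

definition floor_index :: "real \<Rightarrow> nat" where
  "floor_index t = nat \<lfloor>t / t\<^sub>0\<rfloor>"

definition norming :: "real \<Rightarrow> real" where
  "norming t = B (floor_index t)"

lemma norming_pos: "norming t > 0"
  by (simp add: norming_def B_pos)

lemma floor_index_bounds:
  assumes "t > 0"
  shows "real (floor_index t) * t\<^sub>0 \<le> t" "t < real (floor_index t) * t\<^sub>0 + t\<^sub>0"
proof -
  have "t / t\<^sub>0 \<ge> 0" using assms t0 by simp
  then have "real (floor_index t) \<le> t / t\<^sub>0" "t / t\<^sub>0 < real (floor_index t) + 1"
    unfolding floor_index_def by linarith+
  then show "real (floor_index t) * t\<^sub>0 \<le> t" "t < real (floor_index t) * t\<^sub>0 + t\<^sub>0"
    using t0 by (simp_all add: field_simps)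
qed

lemma le_floor_index: "real m * t\<^sub>0 \<le> t \<Longrightarrow> m \<le> floor_index t"
  unfolding floor_index_def using t0 by (intro le_nat_floor) (simp add: pos_le_divide_eq)

lemma filterlim_floor_index: "filterlim floor_index sequentially at_top"
  unfolding filterlim_at_top
proof
  fix Z :: nat
  show "\<forall>\<^sub>F t in at_top. Z \<le> floor_index t"
    using eventually_ge_at_top[of "real Z * t\<^sub>0"] by eventually_elim (rule le_floor_index)
qed

text \<open>The factor \<open>c\<close> is approximated by p / (k + 1), integer multiples are
  compared through a common \<open>m\<close>, and almost monotonicity bridges the rounding. A
  one-sided bound is enough for the limit, since exchanging c with 1 / c yields the other
  side.\<close>

lemma norming_ratio_lower:
  assumes c: "c > 0" and \<theta>: "0 < \<theta>" "\<theta> < 1"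
  shows "\<forall>\<^sub>F t in at_top. \<theta> * sqrt c * norming t \<le> norming (c * t)"
proof -
  \<comment> \<open>Five factors \<open>y\<close> are lost below; three nested square roots give an
    eighth root of \<theta>, and \<theta> = y^8 <= y^5.\<close>
  define y where "y = sqrt (sqrt (sqrt \<theta>))"
  have y: "0 < y" "y < 1" using \<theta> by (simp_all add: y_def)
  have "y ^ 8 = ((y\<^sup>2)\<^sup>2)\<^sup>2" by (simp flip: power_mult)
  also have "\<dots> = \<theta>" using \<theta> by (simp add: y_def)
  finally have y8: "y ^ 8 = \<theta>" .
  then have y5: "\<theta> \<le> y ^ 5" using power_decreasing[of 5 8 y] y by simp
  obtain N where N: "\<And>m n. N \<le> n \<Longrightarrow> n \<le> m \<Longrightarrow> y * B n \<le> B m"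
    using almost_increasing[OF y] by blast
  \<comment> \<open>This quotient bounds p / (k + 1) from below for p = floor (c k). The slack y^2
    becomes a single \<open>y\<close> after taking the square root.\<close>
  have "((\<lambda>k. (c * real k - 1) / (real k + 1)) \<longlonglongrightarrow> c)"
    by real_asymp
  moreover have "y\<^sup>2 * c < c" using c y by (simp add: abs_square_less_1)
  ultimately have "\<forall>\<^sub>F k in sequentially. y\<^sup>2 * c < (c * real k - 1) / (real k + 1)"
    by (rule order_tendstoD)
  then have "\<forall>\<^sub>F k in sequentially. y\<^sup>2 * c < (c * real k - 1) / (real k + 1) \<and> k \<ge> 1"
    using eventually_ge_at_top[of "1::nat"] by (rule eventually_conj)
  then obtain k where k: "y\<^sup>2 * c < (c * real k - 1) / (real k + 1)" "k \<ge> 1"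
    using eventually_happens'[OF sequentially_bot] by blast
  define p where "p = nat \<lfloor>c * real k\<rfloor>"
  have ck: "c * real k \<ge> 0" using c by simp
  then have p: "real p \<le> c * real k" "c * real k - 1 \<le> real p"
    unfolding p_def by linarith+
  have pk: "y\<^sup>2 * c \<le> real p / (real k + 1)"
  proof -
    have "(c * real k - 1) / (real k + 1) \<le> real p / (real k + 1)"
      using p by (intro divide_right_mono) auto
    with k show ?thesis by linarith
  qed
  have "0 < y\<^sup>2 * c" using y c by simp
  with pk have "0 < real p / (real k + 1)" by linarith
  then have p1: "p \<ge> 1" by (cases "p = 0") auto
  have "sqrt (y\<^sup>2 * c) \<le> sqrt (real p / (real k + 1))" using pk by (rule real_sqrt_le_mono)
  then have "y * sqrt c \<le> sqrt (real p) / sqrt (real k + 1)"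
    using y by (simp add: real_sqrt_mult real_sqrt_divide)
  then have pk': "y * sqrt c * sqrt (real k + 1) \<le> sqrt (real p)"
    by (simp add: pos_le_divide_eq)
  \<comment> \<open>The condition m >= k is what places \<open>n\<close> below
    \<open>Suc k * m\<close>: for m = n div k one has n < k m + k.\<close>
  have "\<forall>\<^sub>F m in sequentially. y * sqrt (real p) < B (p * m) / B m \<and> B (Suc k * m) / B m < sqrt (real (Suc k)) / y \<and> m \<ge> max N k"
  proof (intro eventually_conj eventually_ge_at_top)
    show "\<forall>\<^sub>F m in sequentially. y * sqrt (real p) < B (p * m) / B m"
      by (rule order_tendstoD(1)[OF tendsto_ratio_multiple[OF p1]]) (use y p1 in simp)
    show "\<forall>\<^sub>F m in sequentially. B (Suc k * m) / B m < sqrt (real (Suc k)) / y"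
      by (rule order_tendstoD(2)[OF tendsto_ratio_multiple]) (use y in \<open>simp_all add: field_simps\<close>)
  qed
  then obtain m0 where m0: "\<And>m. m \<ge> m0 \<Longrightarrow> y * sqrt (real p) < B (p * m) / B m"
      "\<And>m. m \<ge> m0 \<Longrightarrow> B (Suc k * m) / B m < sqrt (real (Suc k)) / y" "\<And>m. m \<ge> m0 \<Longrightarrow> m \<ge> N \<and> m \<ge> k"
    by (auto simp: eventually_sequentially)
  show ?thesis
    using eventually_ge_at_top[of "real (k * m0) * t\<^sub>0"] eventually_gt_at_top[of 0]
  proof eventually_elim
    case (elim t)
    define n where "n = floor_index t"
    define m where "m = n div k"
    have "k * m0 \<le> n" unfolding n_def by (rule le_floor_index) (use elim in simp)
    then have mm0: "m \<ge> m0" using k unfolding m_def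
      by (metis div_le_mono less_le_trans nonzero_mult_div_cancel_left not_one_le_zero)
    then have mk: "m \<ge> N" "m \<ge> k" using m0 by auto
    have kmn: "k * m \<le> n" by (simp add: m_def)
    have "n < k * m + k" using k(2) unfolding m_def
      by (metis add.commute div_mult_mod_eq less_le_trans mod_less_divisor mult.commute nat_add_left_cancel_less zero_less_one)
    then have nk: "n \<le> Suc k * m" using mk by simp
    have "m \<le> k * m" using k(2) by simp
    then have "N \<le> n" using mk kmn by linarith
    have "real (p * m) * t\<^sub>0 \<le> c * t"
    proof -
      have "real (p * m) * t\<^sub>0 \<le> (c * real k) * real m * t\<^sub>0"
        using p t0 by (auto intro!: mult_right_mono)
      also have "\<dots> = c * (real (k * m) * t\<^sub>0)" by simp
      also have "\<dots> \<le> c * (real n * t\<^sub>0)"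
        using kmn c t0 by (intro mult_left_mono mult_right_mono) (auto simp del: of_nat_mult)
      also have "\<dots> \<le> c * t"
        using floor_index_bounds(1)[OF elim(2)] c by (intro mult_left_mono) (auto simp: n_def)
      finally show ?thesis .
    qed
    then have pm: "p * m \<le> floor_index (c * t)" by (rule le_floor_index)
    have Npm: "N \<le> p * m" using mk p1 by (metis le_trans mult_le_mono1 nat_mult_1)
    \<comment> \<open>The chain passes from \<open>n\<close> up to (k + 1) m, down to m, up to p m
      and on to the index of c t. Almost monotonicity costs two factors \<open>y\<close>, the two
      ratio limits one each, and the approximation of \<open>c\<close> one.\<close>
    have "\<theta> * sqrt c * B n \<le> y ^ 5 * sqrt c * B n"
      using y5 c B_pos[of n] by (intro mult_right_mono) auto
    also have "\<dots> = y ^ 4 * sqrt c * (y * B n)" by (simp add: power_numeral_reduce)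
    also have "\<dots> \<le> y ^ 4 * sqrt c * B (Suc k * m)"
      using N[OF \<open>N \<le> n\<close> nk] y c by (intro mult_left_mono) auto
    also have "\<dots> \<le> y ^ 4 * sqrt c * (sqrt (real (Suc k)) / y * B m)"
      using m0(2)[OF mm0] B_pos[of m] y c by (intro mult_left_mono) (auto simp: pos_divide_less_eq less_imp_le)
    also have "\<dots> = y\<^sup>2 * B m * (y * sqrt c * sqrt (real k + 1))"
      using y by (simp add: power_numeral_reduce field_simps)
    also have "\<dots> \<le> y\<^sup>2 * B m * sqrt (real p)"
      using pk' y B_pos[of m] by (intro mult_left_mono) auto
    also have "\<dots> = y * (y * sqrt (real p) * B m)" by (simp add: power2_eq_square)
    also have "\<dots> \<le> y * B (p * m)"
      using m0(1)[OF mm0] B_pos[of m] y by (intro mult_left_mono) (auto simp: pos_less_divide_eq less_imp_le)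
    also have "\<dots> \<le> B (floor_index (c * t))"
      by (rule N[OF Npm pm])
    finally show ?case by (simp add: norming_def n_def)
  qed
qed

lemma norming_regularly_varying: "norming \<in> regularly_varying (1 / 2)"
  unfolding regularly_varying_def
proof (intro CollectI conjI allI impI)
  have "norming \<in> borel_measurable borel"
    unfolding norming_def[abs_def] floor_index_def by measurable
  then show "norming \<in> borel_measurable (restrict_space borel {0<..})"
    by (rule measurable_restrict_space1)
  show "norming x > 0" for x by (rule norming_pos)
  fix c :: real assume c: "c > 0"
  have sc: "sqrt c > 0" using c by simp
  have "((\<lambda>x. norming (c * x) / norming x) \<longlongrightarrow> sqrt c) at_top"
  proof (rule order_tendstoI)
    fix a assume a: "a < sqrt c"
    then have "max 0 (a / sqrt c) < 1" using sc by (simp add: field_simps)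
    then obtain \<theta> where \<theta>: "max 0 (a / sqrt c) < \<theta>" "\<theta> < 1" using dense by blast
    then have "a < \<theta> * sqrt c" using sc by (simp add: field_simps)
    from norming_ratio_lower[OF c, of \<theta>] \<theta>
    have "\<forall>\<^sub>F t in at_top. \<theta> * sqrt c * norming t \<le> norming (c * t)" by simp
    then show "\<forall>\<^sub>F t in at_top. a < norming (c * t) / norming t"
    proof eventually_elim
      case (elim t)
      then have "\<theta> * sqrt c \<le> norming (c * t) / norming t"
        using norming_pos[of t] by (simp add: pos_le_divide_eq)
      with \<open>a < \<theta> * sqrt c\<close> show ?case by linarith
    qed
  next
    fix a assume a: "a > sqrt c"
    then have a0: "a > 0" using sc by linarith
    have "sqrt c / a < 1" using a a0 by (simp add: field_simps)
    then obtain \<theta> where \<theta>: "sqrt c / a < \<theta>" "\<theta> < 1" using dense by blast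
    have "0 < sqrt c / a" using sc a0 by simp
    with \<theta> have \<theta>0: "0 < \<theta>" by linarith
    have "sqrt c / \<theta> < a" using \<theta> \<theta>0 a0 by (simp add: field_simps)
    have "filterlim (\<lambda>t. c * t) at_top at_top"
      using c by (intro filterlim_tendsto_pos_mult_at_top[OF tendsto_const] filterlim_ident)
    \<comment> \<open>The lower bound for 1 / c, evaluated at c t, is the upper bound for c at
      t.\<close>
    from eventually_compose_filterlim[OF norming_ratio_lower[of "1 / c", OF _ \<theta>0 \<theta>(2)] this]
    have "\<forall>\<^sub>F t in at_top. \<theta> * sqrt (1 / c) * norming (c * t) \<le> norming t"
      using c by simp
    then show "\<forall>\<^sub>F t in at_top. norming (c * t) / norming t < a"
    proof eventually_elim
      case (elim t)
      then have "norming (c * t) / norming t \<le> sqrt c / \<theta>"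
        using norming_pos[of t] sc \<theta>0 by (simp add: real_sqrt_divide field_simps)
      with \<open>sqrt c / \<theta> < a\<close> show ?case by linarith
    qed
  qed
  then show "((\<lambda>x. norming (c * x) / norming x) \<longlongrightarrow> c powr (1 / 2)) at_top"
    using c by (simp add: powr_half_sqrt)
qed

lemma weak_conv_along_norming:
  "weak_conv_along (\<lambda>t. dilation (1 / norming t) (\<mu> t)) arcsine_law at_top"
proof (rule weak_conv_along_rescaledI[OF real_distribution_arcsine norming_pos])
  fix z :: complex assume z: "Im z > 0"
  show "((\<lambda>t. F_transform (\<mu> t) (of_real (norming t) * z) / of_real (norming t)) \<longlongrightarrow> F_transform arcsine_law z) at_top"
  proof (rule tendsto_F_transform_shift[OF _ _ z])
    show "\<forall>\<^sub>F t in at_top. 0 \<le> real (floor_index t) * t\<^sub>0 \<and> real (floor_index t) * t\<^sub>0 \<le> t \<and> t \<le> real (floor_index t) * t\<^sub>0 + t\<^sub>0"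
      using eventually_gt_at_top[of 0] by eventually_elim (use floor_index_bounds t0 less_imp_le in auto)
    show "filterlim norming at_top at_top"
      unfolding norming_def by (rule filterlim_compose[OF filterlim_B filterlim_floor_index])
    show "((\<lambda>t. F_transform (\<mu> (real (floor_index t) * t\<^sub>0)) (of_real (norming t) * z) / of_real (norming t))
      \<longlongrightarrow> F_transform arcsine_law z) at_top"
      unfolding norming_def by (rule filterlim_compose[OF tendsto_F_transform_arcsine[OF z] filterlim_floor_index])
    show "Im (F_transform arcsine_law z) > 0"
      by (rule real_distribution.Im_F_transform_pos[OF real_distribution_arcsine z])
  qed
qed

lemma strict_domain_of_attraction_semigroup:
  assumes t: "t > 0"
  shows "\<mu> t \<in> strict_domain_of_attraction arcsine_law"
  unfolding strict_domain_of_attraction_def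
proof (intro CollectI conjI exI allI)
  show "real_distribution (\<mu> t)" using t by (intro real_distribution_semigroup) simp
  \<comment> \<open>At n = 0 the value is \<open>B 0\<close>, also positive, so the sampled norming
    function is admissible for every index.\<close>
  show "norming (real n * t) > 0" for n by (rule norming_pos)
  have "filterlim (\<lambda>n. real n * t) at_top sequentially"
    using t by (intro filterlim_at_top_mult_tendsto_pos[OF tendsto_const] filterlim_real_sequentially)
  then show "weak_conv_along (\<lambda>n. dilation (1 / norming (real n * t)) (mono_conv_power n (\<mu> t))) arcsine_law sequentially"
    using weak_conv_along_norming t filterlim_compose
    unfolding weak_conv_along_def mono_conv_power_semigroup[OF less_imp_le[OF t]] by blast
qed

end

theorem theorem3p6:
  fixes \<mu> :: "real \<Rightarrow> real measure"
  assumes "mono_conv_semigroup \<mu>"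
  shows "((\<exists>t\<^sub>0>0. \<mu> t\<^sub>0 \<in> strict_domain_of_attraction arcsine_law) \<longrightarrow>
            (\<exists>B \<in> regularly_varying (1 / 2).
               weak_conv_along (\<lambda>t. dilation (1 / B t) (\<mu> t)) arcsine_law at_top) \<and>
            (\<forall>t>0. \<mu> t \<in> strict_domain_of_attraction arcsine_law))
       \<and> (\<forall>t\<^sub>0>0. \<forall>a. mean_exists (\<mu> t\<^sub>0) \<and> a = mean (\<mu> t\<^sub>0) \<longrightarrow>
            weak_conv_along (\<lambda>t. dilation (1 / t) (\<mu> t)) (return borel (a / t\<^sub>0)) at_top)"
proof (rule conjI)
  interpret monotone_semigroup \<mu> by standard (rule assms)
  show "(\<exists>t\<^sub>0>0. \<mu> t\<^sub>0 \<in> strict_domain_of_attraction arcsine_law) \<longrightarrow>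
    (\<exists>B \<in> regularly_varying (1 / 2).
       weak_conv_along (\<lambda>t. dilation (1 / B t) (\<mu> t)) arcsine_law at_top) \<and>
    (\<forall>t>0. \<mu> t \<in> strict_domain_of_attraction arcsine_law)"
  proof
    assume "\<exists>t\<^sub>0>0. \<mu> t\<^sub>0 \<in> strict_domain_of_attraction arcsine_law"
    then obtain t\<^sub>0 B where "t\<^sub>0 > 0" "\<And>n. B n > 0"
      "weak_conv_along (\<lambda>n. dilation (1 / B n) (mono_conv_power n (\<mu> t\<^sub>0))) arcsine_law sequentially"
      unfolding strict_domain_of_attraction_def by blast
    then interpret arcsine_attracted_semigroup \<mu> t\<^sub>0 B
      by unfold_locales
    show "(\<exists>B \<in> regularly_varying (1 / 2).
         weak_conv_along (\<lambda>t. dilation (1 / B t) (\<mu> t)) arcsine_law at_top) \<and>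
      (\<forall>t>0. \<mu> t \<in> strict_domain_of_attraction arcsine_law)"
      using norming_regularly_varying weak_conv_along_norming strict_domain_of_attraction_semigroup
      by blast
  qed
  show "\<forall>t\<^sub>0>0. \<forall>a. mean_exists (\<mu> t\<^sub>0) \<and> a = mean (\<mu> t\<^sub>0) \<longrightarrow>
    weak_conv_along (\<lambda>t. dilation (1 / t) (\<mu> t)) (return borel (a / t\<^sub>0)) at_top"
    using weak_law_of_large_numbers unfolding mean_exists_def mean_def by blast
qed

end
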